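(* Let $\mathcal{P}\in\mathbb{P}$ and let $\epsilon,\tau\in\mathbb{R}_{>0}$. Let $\mathcal{K}$ be an LTI feedback law $y\mapsto -u$ with bilinearly transformed transfer function $\tilde K$, and let $\tilde Q=\tilde K[I+\tilde P_{uy}\tilde K]^{-1}$ be the associated Youla parameter (equivalently $\tilde K=[I-\tilde Q\tilde P_{uy}]^{-1}\tilde Q$). Then $\mathcal{K}\in\mathbb{K}_\epsilon$ if and only if $\tilde Q\in\tilde{\mathbb{H}}_\infty$ and $$\tilde U\triangleq\begin{bmatrix}\tilde Q&\tilde Q\\0&\tilde F\end{bmatrix}$$ satisfies $$\tilde U(e^{j\Omega})+\tilde U^H(e^{j\Omega})\succeq 0,\qquad \forall\,\Omega\in[-\pi,\pi].$$
   Context: Notation. $X^H$ is the conjugate transpose, $\succeq$ the Hermitian semidefinite order, $j=\sqrt{-1}$, $\mathbb{C}_{>0}$ the open right half-plane, $\mathbb{O}_{>1}=\{q\in\mathbb{C}:|q|>1\}$. $\hat{\mathbb{H}}_\infty$ (resp. $\tilde{\mathbb{H}}_\infty$) is the set of matrix-valued functions analytic and uniformly bounded on $\mathbb{C}_{>0}$ (resp. on $\mathbb{O}_{>1}$). Values of an $\tilde{\mathbb{H}}_\infty$ function at $e^{j\Omega}$ are boundary (nontangential) limits, and inequalities on the unit circle are understood wherever these limits exist (almost every $\Omega$). Plant class $\mathbb{P}$. $\mathcal{P}:\{w,u\}\mapsto\{z,y\}$ is a finite-dimensional LTI system with $y(t),u(t)\in\mathbb{C}^{n_u}$ and transfer functions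 $\hat P_{ij}(s)=C_j(sI-A)^{-1}B_i+D_{ij}$, $i\in\{w,u\}$, $j\in\{z,y\}$, where $A,B_w,B_u,C_z,C_y,D_{uz},D_{uy}$ are constant complex matrices, $D_{wz}=0$, $D_{wy}=0$, and the overall realization is minimal. $\mathcal{P}\in\mathbb{P}$ means in addition: (i) all $\hat P_{ij}\in\hat{\mathbb{H}}_\infty$ (bounded $\mathbb{L}_2$ gain); (ii) $u\mapsto y$ is passive, equivalently $\hat P_{uy}(s)+\hat P_{uy}^H(s)\succeq0$ for all $s\in\mathbb{C}_{>0}$. Feedback class $\mathbb{K}_\epsilon$. The set of LTI mappings $\mathcal{K}:y\mapsto -u$ (i.e. $u=-\mathcal{K}y$) that are output-strictly passive with parameter $\epsilon$: $\int_{-\infty}^\infty[u^Hy+y^Hu]\,dt+\epsilon\|u\|_{\mathbb{L}_2}^2\le 0$ for all $y\in\mathbb{L}_2$. Equivalently, its transfer function $\hat K$ is analytic and uniformly bounded on $\mathbb{C}_{>0}$ and $\hat K^H(s)+\hat K(s)-\epsilon\hat K^H(s)\hat K(s)\succeq0$ for all $s\in\mathbb{C}_{>0}$. Bilinear transformation. For $\tau>0$, $q=\frac{1+2\tau s}{1-2\tau s}$, $s=\frac1{2\tau}\frac{q-1}{q+1}$, mapping $\mathbb{C}_{>0}$ to $\mathbb{O}_{>1}$ (with $s=1/(2\tau)$ going to $q=\infty$). Put $\tilde P_{ij}(q)=\hat P_{ij}\big(\frac1{2\tau}\frac{q-1}{q+1}\big)$, $\tilde K(q)=\hat K\big(\frac1{2\tau}\frac{q-1}{q+1}\big)$.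 The relations between $\tilde K$ and $\tilde Q$ are identities of meromorphic matrix functions on $\mathbb{O}_{>1}$ (with $I+\tilde P_{uy}\tilde K$ not identically singular); membership in $\tilde{\mathbb{H}}_\infty$ is after removing removable singularities. Factor $\tilde F$. $\tilde F$ is the rational matrix function with $\tilde F,\tilde F^{-1}\in\tilde{\mathbb{H}}_\infty$ and $\tilde F(\infty)$ Hermitian such that $[\tilde P_{uy}(q)+\tilde P_{uy}^H(q)+\epsilon I]^{-1}=\tilde F(q)+\tilde F^H(q)$ for all $|q|=1$. *)

theory Defs
  imports
    "HOL-Complex_Analysis.Complex_Analysis"
    "Jordan_Normal_Form.Schur_Decomposition"
begin

text \<open>
  Matrices are the dimension-indexed matrices of \<^theory>\<open>Jordan_Normal_Form.Matrix\<close>, so that all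
  dimensions, including a state dimension of 0 (a static system), range over the naturals.
  Conjugate transposition is \<^const>\<open>mat_adjoint\<close>.
\<close>

definition psd :: "complex mat \<Rightarrow> bool" where
  "psd M \<longleftrightarrow> square_mat M \<and> mat_adjoint M = M \<and>
     (\<forall>v \<in> carrier_vec (dim_row M). 0 \<le> Re ((M *\<^sub>v v) \<bullet>c v))"

text \<open>Meaningful for invertible square matrices only; otherwise the value is unspecified.\<close>

definition mat_inv :: "complex mat \<Rightarrow> complex mat" where
  "mat_inv M = the (mat_inverse M)"

definition right_half_plane :: "complex set" where
  "right_half_plane = {s. 0 < Re s}"

definition outside_disc :: "complex set" where
  "outside_disc = {q. 1 < cmod q}"


subsection \<open>Bounded analytic matrix functions and their boundary values\<close>

text \<open>Uniform boundedness is stated entrywise; for a fixed finite size this is the same as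
  boundedness in any matrix norm.\<close>

definition Hinf :: "complex set \<Rightarrow> nat \<Rightarrow> nat \<Rightarrow> (complex \<Rightarrow> complex mat) \<Rightarrow> bool" where
  "Hinf S nr nc G \<longleftrightarrow>
     (\<forall>z\<in>S. G z \<in> carrier_mat nr nc) \<and>
     (\<forall>i<nr. \<forall>j<nc. (\<lambda>z. G z $$ (i,j)) holomorphic_on S) \<and>
     (\<exists>M. \<forall>z\<in>S. \<forall>i<nr. \<forall>j<nc. cmod (G z $$ (i,j)) \<le> M)"

text \<open>The exterior Stolz region of aperture \<open>M\<close> at a point \<open>p\<close> of the unit circle.\<close>

definition stolz :: "complex \<Rightarrow> real \<Rightarrow> complex set" where
  "stolz p M = {q. 1 < cmod q \<and> cmod (q - p) < M * (cmod q - 1)}"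

definition nt_limit :: "(complex \<Rightarrow> complex) \<Rightarrow> complex \<Rightarrow> complex \<Rightarrow> bool" where
  "nt_limit f p l \<longleftrightarrow> (\<forall>M>1. (f \<longlongrightarrow> l) (at p within stolz p M))"

definition has_bdry_value :: "nat \<Rightarrow> nat \<Rightarrow> (complex \<Rightarrow> complex mat) \<Rightarrow> complex \<Rightarrow> bool" where
  "has_bdry_value nr nc G p \<longleftrightarrow> (\<forall>i<nr. \<forall>j<nc. \<exists>l. nt_limit (\<lambda>q. G q $$ (i,j)) p l)"

definition bdry_value :: "nat \<Rightarrow> nat \<Rightarrow> (complex \<Rightarrow> complex mat) \<Rightarrow> complex \<Rightarrow> complex mat" where
  "bdry_value nr nc G p =
     Matrix.mat nr nc (\<lambda>(i,j). THE l. nt_limit (\<lambda>q. G q $$ (i,j)) p l)"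


subsection \<open>State-space systems\<close>

datatype input_port = In_w | In_u
datatype output_port = Out_z | Out_y

record realization =
  ssA :: "complex mat"
  ssB :: "input_port \<Rightarrow> complex mat"
  ssC :: "output_port \<Rightarrow> complex mat"
  ssD :: "input_port \<Rightarrow> output_port \<Rightarrow> complex mat"

definition realization_dims ::
  "nat \<Rightarrow> (input_port \<Rightarrow> nat) \<Rightarrow> (output_port \<Rightarrow> nat) \<Rightarrow> realization \<Rightarrow> bool" where
  "realization_dims nx ni no P \<longleftrightarrow>
     ssA P \<in> carrier_mat nx nx \<and>
     (\<forall>i. ssB P i \<in> carrier_mat nx (ni i)) \<and>
     (\<forall>j. ssC P j \<in> carrier_mat (no j) nx) \<and>
     (\<forall>i j. ssD P i j \<in> carrier_mat (no j) (ni i))"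

definition resolvent_pencil :: "realization \<Rightarrow> complex \<Rightarrow> complex mat" where
  "resolvent_pencil P s = s \<cdot>\<^sub>m 1\<^sub>m (dim_row (ssA P)) - ssA P"

definition transfer ::
  "realization \<Rightarrow> input_port \<Rightarrow> output_port \<Rightarrow> complex \<Rightarrow> complex mat" where
  "transfer P i j s = ssC P j * mat_inv (resolvent_pencil P s) * ssB P i + ssD P i j"

text \<open>Transfer functions are compared as rational functions, that is, wherever neither resolvent
  is singular. Minimality refers to the overall system from all inputs to all outputs.\<close>

definition same_transfer :: "realization \<Rightarrow> realization \<Rightarrow> bool" where
  "same_transfer P P' \<longleftrightarrow>
     (\<forall>s. Determinant.det (resolvent_pencil P s) \<noteq> 0 \<and> Determinant.det (resolvent_pencil P' s) \<noteq> 0 \<longrightarrow>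
        (\<forall>i j. transfer P i j s = transfer P' i j s))"

definition minimal_realization ::
  "nat \<Rightarrow> (input_port \<Rightarrow> nat) \<Rightarrow> (output_port \<Rightarrow> nat) \<Rightarrow> realization \<Rightarrow> bool" where
  "minimal_realization nx ni no P \<longleftrightarrow> realization_dims nx ni no P \<and>
     (\<forall>nx' P'. realization_dims nx' ni no P' \<and> same_transfer P P' \<longrightarrow> nx \<le> nx')"

definition plant_class ::
  "nat \<Rightarrow> (input_port \<Rightarrow> nat) \<Rightarrow> (output_port \<Rightarrow> nat) \<Rightarrow> realization \<Rightarrow> bool" where
  "plant_class nx ni no P \<longleftrightarrow>
     minimal_realization nx ni no P \<and>
     (\<forall>j. ssD P In_w j = 0\<^sub>m (no j) (ni In_w)) \<and>
     (\<forall>i j. Hinf right_half_plane (no j) (ni i) (transfer P i j)) \<and>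
     (\<forall>s\<in>right_half_plane.
        psd (transfer P In_u Out_y s + mat_adjoint (transfer P In_u Out_y s)))"


subsection \<open>Feedback laws\<close>

text \<open>
  A feedback law \<open>u = - K y\<close> is given by its transfer function, a matrix of meromorphic functions on
  the right half-plane. \<^const>\<open>nicely_meromorphic_on\<close> fixes the representative: removable
  singularities are removed (and the value at a pole is the dummy 0), so that such a function is
  holomorphic wherever it has no pole.
\<close>

definition feedback_law :: "nat \<Rightarrow> (complex \<Rightarrow> complex mat) \<Rightarrow> bool" where
  "feedback_law n K \<longleftrightarrow>
     (\<forall>s\<in>right_half_plane. K s \<in> carrier_mat n n) \<and>
     (\<forall>i<n. \<forall>j<n. (\<lambda>s. K s $$ (i,j)) nicely_meromorphic_on right_half_plane)"

text \<open>Output strict passivity with parameter \<open>\<epsilon>\<close>, in its frequency-domain form: the transfer function is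
  stable, and \<open>K\<^sup>H + K - \<epsilon> K\<^sup>H K\<close> is positive semidefinite throughout the open right half-plane.\<close>

definition feedback_class :: "nat \<Rightarrow> real \<Rightarrow> (complex \<Rightarrow> complex mat) \<Rightarrow> bool" where
  "feedback_class n \<epsilon> K \<longleftrightarrow>
     Hinf right_half_plane n n K \<and>
     (\<forall>s\<in>right_half_plane.
        psd (mat_adjoint (K s) + K s - complex_of_real \<epsilon> \<cdot>\<^sub>m (mat_adjoint (K s) * K s)))"


subsection \<open>Bilinear transformation, Youla parameter and spectral factor\<close>

definition bilinear_transform :: "real \<Rightarrow> (complex \<Rightarrow> complex mat) \<Rightarrow> complex \<Rightarrow> complex mat" where
  "bilinear_transform \<tau> G q = G (1 / (2 * complex_of_real \<tau>) * ((q - 1) / (q + 1)))"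

text \<open>Not identically singular as a meromorphic function: pointwise values at poles are
  meaningless, hence the exclusion of discrete exceptional sets.\<close>

definition well_posed :: "nat \<Rightarrow> (complex \<Rightarrow> complex mat) \<Rightarrow> (complex \<Rightarrow> complex mat) \<Rightarrow> bool" where
  "well_posed n P K \<longleftrightarrow>
     \<not> (\<forall>\<^sub>\<approx>q\<in>outside_disc. Determinant.det (1\<^sub>m n + P q * K q) = 0)"

definition youla ::
  "nat \<Rightarrow> (complex \<Rightarrow> complex mat) \<Rightarrow> (complex \<Rightarrow> complex mat) \<Rightarrow> complex \<Rightarrow> complex mat" where
  "youla n P K q = Matrix.mat n n (\<lambda>(i,j).
     remove_sings (\<lambda>q'. (K q' * mat_inv (1\<^sub>m n + P q' * K q')) $$ (i,j)) q)"

definition rational_mat :: "nat \<Rightarrow> nat \<Rightarrow> (complex \<Rightarrow> complex mat) \<Rightarrow> bool" where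
  "rational_mat nr nc G \<longleftrightarrow> (\<forall>i<nr. \<forall>j<nc. \<exists>a b :: complex poly. b \<noteq> 0 \<and>
     (\<forall>q. poly b q \<noteq> 0 \<longrightarrow> G q $$ (i,j) = poly a q / poly b q))"

definition spectral_factor ::
  "nat \<Rightarrow> real \<Rightarrow> (complex \<Rightarrow> complex mat) \<Rightarrow> (complex \<Rightarrow> complex mat) \<Rightarrow> bool" where
  "spectral_factor n \<epsilon> P F \<longleftrightarrow>
     rational_mat n n F \<and>
     Hinf outside_disc n n F \<and>
     (\<forall>q\<in>outside_disc. Determinant.det (F q) \<noteq> 0) \<and>
     Hinf outside_disc n n (\<lambda>q. mat_inv (F q)) \<and>
     (\<exists>L \<in> carrier_mat n n. mat_adjoint L = L \<and>
        (\<forall>i<n. \<forall>j<n. ((\<lambda>q. F q $$ (i,j)) \<longlongrightarrow> L $$ (i,j)) at_infinity)) \<and>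
     (\<forall>p. cmod p = 1 \<longrightarrow>
        mat_inv (bdry_value n n P p + mat_adjoint (bdry_value n n P p)
                   + complex_of_real \<epsilon> \<cdot>\<^sub>m 1\<^sub>m n)
          = bdry_value n n F p + mat_adjoint (bdry_value n n F p))"

end

theory Submission
  imports Defs
begin
text \<open>
  Write \<open>R = P + P\<^sup>H + \<epsilon> I\<close> for \<open>P = P\<^sub>u\<^sub>y\<close>. Pointwise, output strict passivity of \<open>K\<close> is equivalent to
  \<open>Q + Q\<^sup>H \<ge> Q\<^sup>H R Q\<close>, because \<open>v = x + P K x\<close> turns the quadratic form of \<open>K\<close> at \<open>x\<close> into that of \<open>Q\<close> at \<open>v\<close>;
  either inequality also forces \<open>I + P K\<close>, respectively \<open>I - P Q\<close>, to be invertible and bounds \<open>K\<close> and \<open>Q\<close>.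
  On the circle \<open>F + F\<^sup>H = R\<^sup>-\<^sup>1\<close>, so a Schur complement turns the condition on \<open>U\<close> into
  \<open>Q + Q\<^sup>H \<ge> Q R Q\<^sup>H\<close>, which is equivalent to the former inequality since a contraction and its adjoint are
  contractions simultaneously.

  It remains to pass from the circle to its exterior. Boundary limits of bounded analytic functions exist
  almost everywhere: an antiderivative is Lipschitz up to the circle, hence differentiable there almost
  everywhere (Vitali covering), and a point of differentiability is a point of nontangential convergence.
  Cauchy's formula then shows that a bounded analytic function whose boundary limits have nonnegative real
  part has nonnegative real part. This is applied to \<open>Q\<close> and then to \<open>(Q + \<delta> I)\<^sup>-\<^sup>1 - P - \<epsilon>' I / 2\<close>
  with \<open>\<epsilon>' < \<epsilon>\<close> and \<open>\<delta>\<close> small.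
\<close>


text \<open>Positivity of \<open>Q\<close> has to come first: it makes \<open>Q + \<delta> I\<close>
  coercive, and only then is its inverse a bounded analytic function to which the boundary principle
  can be applied.

  In the direction from \<open>Q\<close> to \<open>K\<close> there is a second obstacle:
  \<open>K\<close> is known only as a meromorphic function. The passivity inequality is therefore
  proved off a sparse set; the entry bound 2 / \<epsilon> that it implies then excludes poles, and
  the inequality extends by continuity. The point s = 1 / (2 \<tau>), the image of q = \<infinity>,
  is not reached from the exterior of the disc and is filled in by the same removal.

  The plant and \<open>F\<close> are rational and bounded, so they have limits at every point of the
  circle. Only \<open>Q\<close> has exceptional points, which is why the condition on
  \<open>U\<close> at the existing limits is a condition at the existing limits of
  \<open>Q\<close>.\<close>

subsection \<open>Differentiability almost everywhere of Lipschitz functions\<close>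

text \<open>The covering theorem speaks of closed balls, hence the midpoints \<open>a\<close> and
  half-lengths \<open>r\<close>. The set is finally covered by open intervals: only the countably
  many endpoints are lost, and the union becomes an open set in which the lemma can be applied
  again.\<close>

lemma vitali_interval_cover:
  fixes T U :: "real set" and I :: "real \<Rightarrow> real \<Rightarrow> bool"
  assumes "open U"
    and fine: "\<And>x d. x \<in> T \<Longrightarrow> 0 < d \<Longrightarrow> \<exists>u v. u < v \<and> v - u < d \<and> u \<le> x \<and> x \<le> v \<and> I u v"
  obtains C :: "(real \<times> real) set" where "countable C"
    "\<And>u v. (u,v) \<in> C \<Longrightarrow> u < v \<and> I u v \<and> {u..v} \<subseteq> U"
    "disjoint_family_on (\<lambda>(u,v). {u..v}) C"
    "negligible (T \<inter> U - (\<Union>(u,v)\<in>C. {u<..<v}))"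
proof -
  define K where "K = {(u,v). u < v \<and> I u v \<and> {u..v} \<subseteq> U}"
  define a :: "real \<times> real \<Rightarrow> real" where "a = (\<lambda>(u,v). (u+v)/2)"
  define r :: "real \<times> real \<Rightarrow> real" where "r = (\<lambda>(u,v). (v-u)/2)"
  have cb: "cball (a i) (r i) = {fst i..snd i}" for i
    unfolding a_def r_def cball_eq_atLeastAtMost split_beta by (simp add: field_simps)
  have bb: "ball (a i) (r i) = {fst i<..<snd i}" for i
    unfolding a_def r_def ball_eq_greaterThanLessThan split_beta by (simp add: field_simps)
  have rpos: "0 < r i" if "i \<in> K" for i
    using that unfolding K_def r_def by (cases i) simp
  have S: "\<exists>i. i \<in> K \<and> x \<in> cball (a i) (r i) \<and> r i < d" if xd: "x \<in> T \<inter> U" "0 < d" for x d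
  proof -
    obtain e where e: "0 < e" "ball x e \<subseteq> U"
      using xd(1) assms(1) by (meson IntE openE)
    obtain u v where uv: "u < v" "v - u < min d e" "u \<le> x" "x \<le> v" "I u v"
      using fine[of x "min d e"] xd e by auto
    have "{u..v} \<subseteq> ball x e" using uv by (auto simp: dist_real_def)
    then have "(u,v) \<in> K" using uv e by (auto simp: K_def)
    moreover have "x \<in> cball (a (u,v)) (r (u,v))" using uv unfolding cb by auto
    moreover have "r (u,v) < d" using uv by (auto simp: r_def)
    ultimately show ?thesis by blast
  qed
  obtain C where C: "countable C" "C \<subseteq> K"
     "pairwise (\<lambda>i j. disjnt (cball (a i) (r i)) (cball (a j) (r j))) C"
     "negligible (T \<inter> U - (\<Union>i \<in> C. cball (a i) (r i)))"
    by (rule Vitali_covering_theorem_cballs[of K r "T \<inter> U" a]) (use rpos S in blast)+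
  have "negligible (fst ` C \<union> snd ` C)"
    unfolding negligible_iff_null_sets
    by (intro null_sets_completionI countable_imp_null_set_lborel) (use C in auto)
  then have "negligible ((T \<inter> U - (\<Union>i \<in> C. cball (a i) (r i))) \<union> (fst ` C \<union> snd ` C))"
    using C(4) by (simp add: negligible_Un_eq)
  moreover have "T \<inter> U - (\<Union>(u,v)\<in>C. {u<..<v})
      \<subseteq> (T \<inter> U - (\<Union>i \<in> C. cball (a i) (r i))) \<union> (fst ` C \<union> snd ` C)"
  proof
    fix x assume x: "x \<in> T \<inter> U - (\<Union>(u,v)\<in>C. {u<..<v})"
    show "x \<in> (T \<inter> U - (\<Union>i \<in> C. cball (a i) (r i))) \<union> (fst ` C \<union> snd ` C)"
    proof (cases "\<exists>i\<in>C. x \<in> cball (a i) (r i)")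
      case True
      then obtain i where i: "i \<in> C" "fst i \<le> x" "x \<le> snd i" unfolding cb by auto
      then have "\<not> (fst i < x \<and> x < snd i)" using x by (auto simp: split_beta)
      then have "x = fst i \<or> x = snd i" using i by linarith
      then show ?thesis using i(1) by blast
    qed (use x in blast)
  qed
  ultimately have neg: "negligible (T \<inter> U - (\<Union>(u,v)\<in>C. {u<..<v}))"
    using negligible_subset by blast
  have "disjoint_family_on (\<lambda>(u,v). {u..v}) C"
    using C(3) unfolding cb disjoint_family_on_def pairwise_def disjnt_def split_beta by blast
  then show ?thesis
    using that[of C] C(1,2) neg by (auto simp: K_def)
qed

text \<open>Cover \<open>T\<close> by disjoint intervals of slope below \<alpha>, inside an open set
  barely larger than \<open>T\<close>, and then, inside those, cover almost all of \<open>T\<close>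
  again by disjoint intervals of slope above \<beta>. Comparing the total increase of
  \<open>g\<close> over the two families gives \<beta> |T| \<le> \<alpha> (|T| + \<eta>) for every
  \<eta> > 0, which forces |T| = 0.\<close>

lemma mono_slope_gap_negligible:
  fixes g :: "real \<Rightarrow> real" and T :: "real set"
  assumes mono: "\<And>x y. x \<le> y \<Longrightarrow> g x \<le> g y" and cont: "continuous_on UNIV g"
    and ab: "0 \<le> \<alpha>" "\<alpha> < \<beta>"
    and low: "\<And>x d. x \<in> T \<Longrightarrow> 0 < d \<Longrightarrow>
       \<exists>u v. u < v \<and> v - u < d \<and> u \<le> x \<and> x \<le> v \<and> g v - g u < \<alpha> * (v - u)"
    and high: "\<And>x d. x \<in> T \<Longrightarrow> 0 < d \<Longrightarrow>
       \<exists>u v. u < v \<and> v - u < d \<and> u \<le> x \<and> x \<le> v \<and> \<beta> * (v - u) < g v - g u"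
  shows "negligible T"
proof -
  \<comment> \<open>The Stieltjes measure of \<open>g\<close> turns sums of increments over disjoint
    intervals into measures of unions, so the two families are compared by inclusion. Continuity of
    \<open>g\<close> excludes atoms, so a closed interval has mass \<open>g v - g u\<close>.\<close>
  define \<mu> where "\<mu> = interval_measure g"
  have \<mu>: "emeasure \<mu> {u..v} = g v - g u" if "u \<le> v" for u v
    unfolding \<mu>_def using that mono cont by (rule emeasure_interval_measure_Icc)
  have sets\<mu>: "sets \<mu> = sets borel" by (simp add: \<mu>_def)
  have sums: "emeasure M (\<Union>(u,v)\<in>C. {u..v}) = (\<integral>\<^sup>+ i. emeasure M {fst i..snd i} \<partial>count_space C)"
    if "countable C" "disjoint_family_on (\<lambda>(u,v). {u..v}) C" "sets M = sets borel"
    for M and C :: "(real \<times> real) set"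
  proof -
    have eq: "(\<lambda>(u,v). {u..v}) = (\<lambda>i::real\<times>real. {fst i..snd i})" by auto
    show ?thesis
      using that unfolding eq
      by (intro emeasure_UN_countable) auto
  qed
  have "negligible (T \<inter> cbox a b)" for a b
  proof -
    define T' where "T' = T \<inter> cbox a b"
    \<comment> \<open>\<open>T\<close> need not be measurable; \<open>E\<close> is a measurable hull
      of \<open>T'\<close> with the same outer measure, finite because \<open>T'\<close> is
      bounded.\<close>
    obtain E where E: "E \<in> sets lebesgue" "T' \<subseteq> E" "outer_measure_of lebesgue T' = emeasure lebesgue E"
      using outer_measure_of_attain[of T' lebesgue] by auto
    have "outer_measure_of lebesgue T' \<le> outer_measure_of lebesgue (cbox a b)"
      by (rule outer_measure_of_mono) (simp add: T'_def)
    also have "\<dots> = emeasure lebesgue (cbox a b)" by simp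
    also have "\<dots> < \<infinity>" using emeasure_compact_finite[of "cbox a b"] by (simp add: less_top)
    finally have fin: "emeasure lebesgue E < \<infinity>" using E(3) by simp
    define m where "m = measure lebesgue E"
    have m: "emeasure lebesgue E = ennreal m"
      unfolding m_def using fin by (simp add: emeasure_eq_ennreal_measure)
    have key: "\<beta> * m \<le> \<alpha> * (m + \<eta>)" if "\<eta> > 0" for \<eta>
    proof -
      obtain U where U: "open U" "E \<subseteq> U" "(U - E) \<in> lmeasurable" "emeasure lebesgue (U - E) < ennreal \<eta>"
        by (rule sets_lebesgue_outer_open[OF E(1) \<open>\<eta> > 0\<close>])
      have Uborel: "U \<in> sets borel" using U(1) by auto
      have "emeasure lborel U = emeasure lebesgue U" using Uborel by simp
      also have "\<dots> \<le> emeasure lebesgue E + emeasure lebesgue (U - E)"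
        using emeasure_subadditive[of E lebesgue "U - E"] E(1) U by (simp add: Un_absorb1 fmeasurableD)
      also have "\<dots> \<le> ennreal m + ennreal \<eta>"
        unfolding m using U(4) by (intro add_mono) auto
      finally have lU: "emeasure lborel U \<le> ennreal (m + \<eta>)"
        using \<open>\<eta> > 0\<close> by (simp add: m_def ennreal_plus)
      obtain C where C: "countable C"
        "\<And>u v. (u,v) \<in> C \<Longrightarrow> u < v \<and> g v - g u < \<alpha> * (v - u) \<and> {u..v} \<subseteq> U"
        "disjoint_family_on (\<lambda>(u,v). {u..v}) C"
        "negligible (T \<inter> U - (\<Union>(u,v)\<in>C. {u<..<v}))"
        using vitali_interval_cover[OF U(1), of T "\<lambda>u v. g v - g u < \<alpha> * (v - u)"] low by metis
      define V where "V = (\<Union>(u,v)\<in>C. {u<..<v})"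
      have "open V" unfolding V_def by (auto intro!: open_UN)
      obtain D where D: "countable D"
        "\<And>u v. (u,v) \<in> D \<Longrightarrow> u < v \<and> \<beta> * (v - u) < g v - g u \<and> {u..v} \<subseteq> V"
        "disjoint_family_on (\<lambda>(u,v). {u..v}) D"
        "negligible (T \<inter> V - (\<Union>(u,v)\<in>D. {u<..<v}))"
        using vitali_interval_cover[OF \<open>open V\<close>, of T "\<lambda>u v. \<beta> * (v - u) < g v - g u"] high by metis
      define C' where "C' = (\<Union>(u,v)\<in>C. {u..v})"
      define D' where "D' = (\<Union>(u,v)\<in>D. {u..v})"
      have meas: "C' \<in> sets borel" "D' \<in> sets borel"
        unfolding C'_def D'_def using C(1) D(1) by (auto intro!: sets.countable_UN'')
      have "V \<subseteq> C'" unfolding V_def C'_def by (intro UN_mono) auto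
      have "D' \<subseteq> V" unfolding D'_def using D(2) by blast
      have neg: "negligible (T' - D')"
      proof (rule negligible_subset)
        show "negligible ((T \<inter> U - V) \<union> (T \<inter> V - (\<Union>(u,v)\<in>D. {u<..<v})))"
          using C(4) D(4) by (simp add: V_def)
        show "T' - D' \<subseteq> (T \<inter> U - V) \<union> (T \<inter> V - (\<Union>(u,v)\<in>D. {u<..<v}))"
          using E(2) U(2) unfolding T'_def D'_def V_def by (auto simp: split_beta intro: less_imp_le)
      qed
      have "ennreal m = outer_measure_of lebesgue T'" using E(3) m by simp
      also have "\<dots> \<le> outer_measure_of lebesgue (D' \<union> (T' - D'))"
        by (rule outer_measure_of_mono) auto
      also have "\<dots> = emeasure lebesgue (D' \<union> (T' - D'))"
        using meas negligible_imp_sets[OF neg] by (intro outer_measure_of_eq sets.Un) auto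
      also have "\<dots> \<le> emeasure lebesgue D' + emeasure lebesgue (T' - D')"
        using meas neg by (intro emeasure_subadditive) (auto intro: negligible_imp_sets)
      also have "emeasure lebesgue (T' - D') = 0"
        using neg negligible_iff_emeasure0 negligible_imp_sets by blast
      finally have mD: "ennreal m \<le> emeasure lborel D'" using meas by simp
      have "ennreal \<beta> * emeasure lborel D' = (\<integral>\<^sup>+ i. ennreal \<beta> * emeasure lborel {fst i..snd i} \<partial>count_space D)"
        unfolding D'_def by (subst sums[OF D(1,3)]) (auto simp: nn_integral_cmult)
      also have "\<dots> \<le> (\<integral>\<^sup>+ i. emeasure \<mu> {fst i..snd i} \<partial>count_space D)"
      proof (rule nn_integral_mono)
        fix i assume "i \<in> space (count_space D)"
        then have i: "fst i < snd i" "\<beta> * (snd i - fst i) < g (snd i) - g (fst i)"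
          using D(2)[of "fst i" "snd i"] by auto
        then show "ennreal \<beta> * emeasure lborel {fst i..snd i} \<le> emeasure \<mu> {fst i..snd i}"
          using ab by (simp add: \<mu> ennreal_mult[symmetric] ennreal_leI)
      qed
      also have "\<dots> = emeasure \<mu> D'"
        unfolding D'_def by (subst sums[OF D(1,3)]) (auto simp: sets\<mu>)
      also have "\<dots> \<le> emeasure \<mu> C'"
        using \<open>D' \<subseteq> V\<close> \<open>V \<subseteq> C'\<close> meas by (intro emeasure_mono) (auto simp: sets\<mu>)
      also have "\<dots> = (\<integral>\<^sup>+ i. emeasure \<mu> {fst i..snd i} \<partial>count_space C)"
        unfolding C'_def by (subst sums[OF C(1,3)]) (auto simp: sets\<mu>)
      also have "\<dots> \<le> (\<integral>\<^sup>+ i. ennreal \<alpha> * emeasure lborel {fst i..snd i} \<partial>count_space C)"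
      proof (rule nn_integral_mono)
        fix i assume "i \<in> space (count_space C)"
        then have i: "fst i < snd i" "g (snd i) - g (fst i) < \<alpha> * (snd i - fst i)"
          using C(2)[of "fst i" "snd i"] by auto
        then show "emeasure \<mu> {fst i..snd i} \<le> ennreal \<alpha> * emeasure lborel {fst i..snd i}"
          using ab by (simp add: \<mu> ennreal_mult[symmetric] ennreal_leI)
      qed
      also have "\<dots> = ennreal \<alpha> * emeasure lborel C'"
        unfolding C'_def by (subst sums[OF C(1,3)]) (auto simp: nn_integral_cmult)
      also have "\<dots> \<le> ennreal \<alpha> * emeasure lborel U"
      proof -
        have "C' \<subseteq> U" unfolding C'_def using C(2) by blast
        then show ?thesis using Uborel by (intro mult_left_mono emeasure_mono) auto
      qed
      also have "\<dots> \<le> ennreal \<alpha> * ennreal (m + \<eta>)" by (intro mult_left_mono lU) auto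
      finally have "ennreal \<beta> * ennreal m \<le> ennreal \<alpha> * ennreal (m + \<eta>)"
        using mD by (meson mult_left_mono order_trans zero_le)
      then have "ennreal (\<beta> * m) \<le> ennreal (\<alpha> * (m + \<eta>))"
        using ab \<open>\<eta> > 0\<close> by (simp add: ennreal_mult[symmetric] m_def del: ennreal_plus)
      then show ?thesis
        using ab \<open>\<eta> > 0\<close> by (subst (asm) ennreal_le_iff) (auto simp: m_def)
    qed
    have "m = 0"
    proof (rule ccontr)
      assume "m \<noteq> 0"
      then have "m > 0" by (simp add: m_def less_le)
      show False
      proof (cases "\<alpha> = 0")
        case True
        then show False using key[of 1] \<open>m > 0\<close> ab by (simp add: mult_le_0_iff)
      next
        case False
        \<comment> \<open>This makes \<open>\<alpha> * \<eta>\<close> half of the gap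
          \<open>(\<beta> - \<alpha>) * m\<close>, which contradicts \<open>key\<close>; the case
          \<open>\<alpha> = 0\<close> is separated because of the division.\<close>
        define \<eta> where "\<eta> = (\<beta> - \<alpha>) * m / (2 * \<alpha>)"
        have "\<eta> > 0" using False ab \<open>m > 0\<close> by (simp add: \<eta>_def)
        have "\<alpha> * \<eta> = (\<beta> - \<alpha>) * m / 2" using False by (simp add: \<eta>_def)
        then have "\<beta> * m \<le> \<alpha> * m + (\<beta> - \<alpha>) * m / 2"
          using key[OF \<open>\<eta> > 0\<close>] by (simp add: distrib_left)
        then have "(\<beta> - \<alpha>) * m \<le> 0" by (simp add: field_simps)
        then show False using ab \<open>m > 0\<close> by (simp add: mult_le_0_iff)
      qed
    qed
    then have "negligible E" using E(1) m by (simp add: negligible_iff_emeasure0)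
    then show ?thesis using E(2) negligible_subset unfolding T'_def by blast
  qed
  then show ?thesis using negligible_on_intervals by blast
qed


text \<open>Adding \<open>L * x\<close> makes the function monotone, with difference quotients in
  [0, 2 L]. Their lower and upper limits are therefore finite, and where these differ two rationals
  fit strictly between them; each such pair contributes a null set.\<close>

lemma lipschitz_real_deriv_ae:
  fixes g :: "real \<Rightarrow> real"
  assumes "L-lipschitz_on UNIV g"
  obtains N where "negligible N" "\<And>x. x \<notin> N \<Longrightarrow> \<exists>l. (g has_real_derivative l) (at x)"
proof -
  have L: "0 \<le> L" "\<bar>g y - g x\<bar> \<le> L * \<bar>y - x\<bar>" for x y
    using assms lipschitz_onD[OF assms, of y x] lipschitz_on_nonneg[OF assms] by (auto simp: dist_real_def)
  define h where "h = (\<lambda>x. g x + L * x)"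
  have mono: "h x \<le> h y" if "x \<le> y" for x y
    using L(2)[of y x] that by (simp add: h_def algebra_simps abs_if split: if_splits)
  have cont: "continuous_on UNIV h"
    unfolding h_def using assms by (intro continuous_intros lipschitz_on_continuous_on)
  define low where "low = (\<lambda>\<alpha> x. \<forall>d>0. \<exists>u v. u < v \<and> v - u < d \<and> u \<le> x \<and> x \<le> v \<and> h v - h u < \<alpha> * (v - u))"
  define high where "high = (\<lambda>\<beta> x. \<forall>d>0. \<exists>u v. u < v \<and> v - u < d \<and> u \<le> x \<and> x \<le> v \<and> \<beta> * (v - u) < h v - h u)"
  define N where "N = (\<Union>(\<alpha>,\<beta>)\<in>{(\<alpha>,\<beta>). \<alpha> \<in> \<rat> \<and> \<beta> \<in> \<rat> \<and> 0 \<le> \<alpha> \<and> \<alpha> < \<beta>}. {x. low \<alpha> x \<and> high \<beta> x})"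
  have "negligible N"
    unfolding N_def
  proof (rule negligible_countable_Union)
    have "countable (\<rat> \<times> \<rat> :: (real \<times> real) set)" by (intro countable_SIGMA countable_rat)
    then have "countable {(\<alpha>::real,\<beta>::real). \<alpha> \<in> \<rat> \<and> \<beta> \<in> \<rat> \<and> 0 \<le> \<alpha> \<and> \<alpha> < \<beta>}"
      by (rule countable_subset[rotated]) auto
    then show "countable ((\<lambda>(\<alpha>,\<beta>). {x. low \<alpha> x \<and> high \<beta> x}) ` {(\<alpha>,\<beta>). \<alpha> \<in> \<rat> \<and> \<beta> \<in> \<rat> \<and> 0 \<le> \<alpha> \<and> \<alpha> < \<beta>})"
      by (rule countable_image)
  next
    fix S assume "S \<in> (\<lambda>(\<alpha>,\<beta>). {x. low \<alpha> x \<and> high \<beta> x}) ` {(\<alpha>,\<beta>). \<alpha> \<in> \<rat> \<and> \<beta> \<in> \<rat> \<and> 0 \<le> \<alpha> \<and> \<alpha> < \<beta>}"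
    then obtain \<alpha> \<beta> where "0 \<le> \<alpha>" "\<alpha> < \<beta>" and S: "S = {x. low \<alpha> x \<and> high \<beta> x}" by auto
    show "negligible S"
      by (rule mono_slope_gap_negligible[OF mono cont \<open>0 \<le> \<alpha>\<close> \<open>\<alpha> < \<beta>\<close>])
         (use S low_def high_def in blast)+
  qed
  moreover have "\<exists>l. (g has_real_derivative l) (at x)" if "x \<notin> N" for x
  proof -
    define \<phi> where "\<phi> = (\<lambda>y. (h y - h x) / (y - x))"
    have bnd: "0 \<le> \<phi> y" "\<phi> y \<le> 2 * L" if "y \<noteq> x" for y
    proof -
      have eq: "\<phi> y = (g y - g x) / (y - x) + L" using that by (simp add: \<phi>_def h_def field_simps)
      have "\<bar>(g y - g x) / (y - x)\<bar> \<le> L" using L(2)[of y x] that by (simp add: abs_divide pos_divide_le_eq)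
      then show "0 \<le> \<phi> y" "\<phi> y \<le> 2 * L" unfolding eq by linarith+
    qed
    \<comment> \<open>A difference quotient at \<open>x\<close> is the slope over an interval that
      has \<open>x\<close> as an endpoint, on one side or the other; \<open>low\<close> and
      \<open>high\<close> are phrased so as to admit both.\<close>
    have frq: "\<exists>u v. u < v \<and> v - u < d \<and> u \<le> x \<and> x \<le> v \<and> Q ((h v - h u) / (v - u))"
      if "\<exists>\<^sub>F y in at x. Q (\<phi> y)" "d > 0" for Q d
    proof -
      have "\<exists>y. y \<noteq> x \<and> dist y x < d \<and> Q (\<phi> y)"
        using that unfolding frequently_def eventually_at by blast
      then obtain y where y: "y \<noteq> x" "\<bar>y - x\<bar> < d" "Q (\<phi> y)" by (auto simp: dist_real_def)
      show ?thesis
      proof (cases "y < x")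
        case True
        have "(h x - h y) / (x - y) = \<phi> y"
          unfolding \<phi>_def by (metis minus_diff_eq minus_divide_divide)
        then show ?thesis using y True by (intro exI[of _ y] exI[of _ x]) auto
      next
        case False
        then show ?thesis using y by (intro exI[of _ x] exI[of _ y]) (auto simp: \<phi>_def)
      qed
    qed
    define lo where "lo = Liminf (at x) (\<lambda>y. ereal (\<phi> y))"
    define hi where "hi = Limsup (at x) (\<lambda>y. ereal (\<phi> y))"
    have ev: "\<forall>\<^sub>F y in at x. y \<noteq> x" by (simp add: eventually_at_filter)
    have "0 \<le> lo" unfolding lo_def
      by (rule Liminf_bounded) (use ev bnd in \<open>auto elim!: eventually_mono\<close>)
    have "hi \<le> ereal (2 * L)" unfolding hi_def
      by (rule Limsup_bounded) (use ev bnd in \<open>auto elim!: eventually_mono\<close>)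
    have "lo \<le> hi" unfolding lo_def hi_def by (rule Liminf_le_Limsup) simp
    have "\<not> lo < hi"
    proof
      assume "lo < hi"
      then obtain r where r: "lo < ereal r" "ereal r < hi" using ereal_dense2 by blast
      then obtain s where s: "ereal r < ereal s" "ereal s < hi" using ereal_dense2 by blast
      obtain \<alpha> where \<alpha>: "\<alpha> \<in> \<rat>" "r < \<alpha>" "\<alpha> < s" using s Rats_dense_in_real by auto
      obtain \<beta> where \<beta>: "\<beta> \<in> \<rat>" "\<alpha> < \<beta>" "\<beta> < s" using \<alpha> Rats_dense_in_real by auto
      have "0 \<le> \<alpha>" using r \<open>0 \<le> lo\<close> \<alpha> by (metis ereal_less_eq(5) less_eq_real_def order_less_le_trans order_le_less_trans ereal_less(2) less_trans)
      have "\<exists>\<^sub>F y in at x. \<phi> y < \<alpha>"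
      proof (rule ccontr)
        assume "\<not> ?thesis"
        then have "\<forall>\<^sub>F y in at x. ereal \<alpha> \<le> ereal (\<phi> y)" by (simp add: frequently_def not_less)
        then have "ereal \<alpha> \<le> lo" unfolding lo_def by (rule Liminf_bounded)
        then have "ereal \<alpha> < ereal r" using r(1) by (rule order_le_less_trans)
        then show False using \<alpha> by simp
      qed
      have lowx: "low \<alpha> x" unfolding low_def
      proof (intro allI impI)
        fix d :: real assume "d > 0"
        obtain u v where "u < v \<and> v - u < d \<and> u \<le> x \<and> x \<le> v \<and> (h v - h u) / (v - u) < \<alpha>"
          using frq[OF \<open>\<exists>\<^sub>F y in at x. \<phi> y < \<alpha>\<close> \<open>d > 0\<close>] by blast
        then show "\<exists>u v. u < v \<and> v - u < d \<and> u \<le> x \<and> x \<le> v \<and> h v - h u < \<alpha> * (v - u)"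
          by (intro exI[of _ u] exI[of _ v]) (auto simp: pos_divide_less_eq)
      qed
      have "\<exists>\<^sub>F y in at x. \<beta> < \<phi> y"
      proof (rule ccontr)
        assume "\<not> ?thesis"
        then have "\<forall>\<^sub>F y in at x. ereal (\<phi> y) \<le> ereal \<beta>" by (simp add: frequently_def not_less)
        then have "hi \<le> ereal \<beta>" unfolding hi_def by (rule Limsup_bounded)
        then have "ereal s < ereal \<beta>" using s(2) by (rule order_less_le_trans[rotated])
        then show False using \<beta> by simp
      qed
      have highx: "high \<beta> x" unfolding high_def
      proof (intro allI impI)
        fix d :: real assume "d > 0"
        obtain u v where "u < v \<and> v - u < d \<and> u \<le> x \<and> x \<le> v \<and> \<beta> < (h v - h u) / (v - u)"
          using frq[OF \<open>\<exists>\<^sub>F y in at x. \<beta> < \<phi> y\<close> \<open>d > 0\<close>] by blast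
        then show "\<exists>u v. u < v \<and> v - u < d \<and> u \<le> x \<and> x \<le> v \<and> \<beta> * (v - u) < h v - h u"
          by (intro exI[of _ u] exI[of _ v]) (auto simp: pos_less_divide_eq)
      qed
      have "x \<in> N" unfolding N_def using \<alpha> \<beta> \<open>0 \<le> \<alpha>\<close> lowx highx by blast
      then show False using that by simp
    qed
    then have "lo = hi" using \<open>lo \<le> hi\<close> by simp
    obtain l where l: "lo = ereal l"
      using \<open>0 \<le> lo\<close> \<open>hi \<le> ereal (2 * L)\<close> \<open>lo = hi\<close> by (cases lo) auto
    have "((\<lambda>y. ereal (\<phi> y)) \<longlongrightarrow> ereal l) (at x)"
      using \<open>lo = hi\<close> l by (intro Liminf_eq_Limsup) (auto simp: lo_def hi_def)
    then have "(\<phi> \<longlongrightarrow> l) (at x)" by simp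
    then have "(h has_real_derivative l) (at x)"
      unfolding has_field_derivative_iff \<phi>_def .
    then have "((\<lambda>y. h y - L * y) has_real_derivative (l - L)) (at x)"
      by (auto intro!: derivative_eq_intros)
    then show ?thesis by (auto simp: h_def)
  qed
  ultimately show ?thesis using that by blast
qed

lemma lipschitz_complex_deriv_ae:
  fixes \<phi> :: "real \<Rightarrow> complex"
  assumes "L-lipschitz_on UNIV \<phi>"
  obtains N where "negligible N" "\<And>t. t \<notin> N \<Longrightarrow> \<exists>d. (\<phi> has_vector_derivative d) (at t)"
proof -
  have *: "L-lipschitz_on UNIV (\<lambda>t. Re (\<phi> t))" "L-lipschitz_on UNIV (\<lambda>t. Im (\<phi> t))"
  proof -
    have le: "norm (\<phi> x - \<phi> y) \<le> L * norm (x - y)" for x y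
      using lipschitz_onD[OF assms, of x y] by (simp add: dist_norm)
    show "L-lipschitz_on UNIV (\<lambda>t. Re (\<phi> t))" "L-lipschitz_on UNIV (\<lambda>t. Im (\<phi> t))"
      using le lipschitz_on_nonneg[OF assms] abs_Re_le_cmod abs_Im_le_cmod
      by (auto intro!: lipschitz_onI simp: dist_norm simp flip: minus_complex.simps; meson order_trans)+
  qed
  obtain N1 where N1: "negligible N1" "\<And>t. t \<notin> N1 \<Longrightarrow> \<exists>l. ((\<lambda>t. Re (\<phi> t)) has_real_derivative l) (at t)"
    using lipschitz_real_deriv_ae[OF *(1)] by metis
  obtain N2 where N2: "negligible N2" "\<And>t. t \<notin> N2 \<Longrightarrow> \<exists>l. ((\<lambda>t. Im (\<phi> t)) has_real_derivative l) (at t)"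
    using lipschitz_real_deriv_ae[OF *(2)] by metis
  have "\<exists>d. (\<phi> has_vector_derivative d) (at t)" if t: "t \<notin> N1 \<union> N2" for t
  proof -
    obtain l1 l2 where "((\<lambda>t. Re (\<phi> t)) has_real_derivative l1) (at t)" "((\<lambda>t. Im (\<phi> t)) has_real_derivative l2) (at t)"
      using N1(2)[of t] N2(2)[of t] t by blast
    then have "(\<phi> has_vector_derivative (Complex l1 l2)) (at t)"
      by (simp add: has_vector_derivative_complex_iff)
    then show ?thesis by blast
  qed
  then show ?thesis using that[of "N1 \<union> N2"] N1(1) N2(1) by (simp add: negligible_Un_eq)
qed

lemma has_vector_derivative_complex_quotient:
  fixes \<phi> :: "real \<Rightarrow> complex"
  assumes "(\<phi> has_vector_derivative d) (at t)"
  shows "((\<lambda>s. (\<phi> s - \<phi> t) / of_real (s - t)) \<longlongrightarrow> d) (at t)"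
  using assms
  by (auto simp: has_vector_derivative_complex_iff has_field_derivative_iff tendsto_complex_iff
        simp flip: of_real_diff)

subsection \<open>Fatou's theorem on the unit disc\<close>

lemma power_le_imp_le_of_const:
  fixes a b K :: real
  assumes "0 \<le> b" "\<And>n. a ^ n \<le> K * b ^ n"
  shows "a \<le> b"
proof (rule ccontr)
  assume "\<not> a \<le> b"
  then have "b < a" by simp
  show False
  proof (cases "b = 0")
    case True
    then show False using assms(2)[of 1] \<open>b < a\<close> by simp
  next
    case False
    then have "1 < a / b" "0 < b" using \<open>b < a\<close> assms(1) by (auto simp: less_le)
    then obtain n where "K < (a / b) ^ n" using real_arch_pow by blast
    then have "K * b ^ n < a ^ n" using \<open>0 < b\<close> by (simp add: power_divide pos_less_divide_eq)
    then show False using assms(2)[of n] by simp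
  qed
qed

lemma norm_le_one_minus_cnj_mult:
  assumes "cmod p = 1" "cmod z \<le> 1"
  shows "cmod ((1 - cnj p * z) / 2) \<le> 1"
proof -
  have "cmod (1 - cnj p * z) \<le> 1 + cmod (cnj p * z)" using norm_triangle_ineq4[of 1 "cnj p * z"] by simp
  also have "\<dots> \<le> 2" using assms by (simp add: norm_mult)
  finally show ?thesis by (simp add: norm_divide)
qed

lemma one_minus_cnj_mult_eq:
  assumes "cmod p = 1" shows "1 - cnj p * z = cnj p * (p - z)"
proof -
  have "cnj p * p = 1" using assms by (metis complex_norm_square mult.commute of_real_1 power_one)
  then show ?thesis by (simp add: algebra_simps)
qed

text \<open>The factor \<open>(1 - cnj p * w) / 2\<close> of modulus at most 1 kills the exceptional point \<open>p\<close>;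
  its influence disappears after taking \<open>n\<close>-th roots.\<close>

lemma disc_maximum_modulus_except_point:
  assumes holo: "g holomorphic_on ball 0 1" and cont: "continuous_on (cball 0 1 - {p}) g"
    and p: "cmod p = 1"
    and bnd: "\<And>z. z \<in> cball 0 1 - {p} \<Longrightarrow> cmod (g z) \<le> M"
    and sph: "\<And>z. cmod z = 1 \<Longrightarrow> z \<noteq> p \<Longrightarrow> cmod (g z) \<le> \<eta>"
    and "z \<in> ball 0 1"
  shows "cmod (g z) \<le> \<eta>"
proof -
  define b where "b = (\<lambda>w. (1 - cnj p * w) / 2)"
  have bz: "cmod (b w) \<le> 1" if "cmod w \<le> 1" for w
    unfolding b_def using norm_le_one_minus_cnj_mult[OF p that] .
  \<comment> \<open>The bound on the circle is assumed away from \<open>p\<close> only, so another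
    point of the circle is needed to read off \<open>0 \<le> \<eta>\<close>.\<close>
  have "- p \<noteq> p" using p by auto
  then have "0 \<le> \<eta>" using sph[of "-p"] p norm_ge_zero order_trans by (metis norm_minus_cancel)
  have "0 \<in> cball 0 1 - {p}" using p by auto
  then have "0 \<le> M" by (rule order_trans[OF norm_ge_zero bnd])
  have "p \<noteq> z" using p assms(6) by auto
  then have "b z \<noteq> 0" unfolding b_def one_minus_cnj_mult_eq[OF p] using p by auto
  have key: "cmod (g z) ^ n * cmod (b z) \<le> \<eta> ^ n" for n
  proof -
    \<comment> \<open>The value 0 at \<open>p\<close> is the continuous one, because
      \<open>g\<close> is bounded and \<open>b\<close> vanishes at \<open>p\<close>. The ordinary
      maximum principle then applies on the closed disc.\<close>
    define G where "G = (\<lambda>w. if w = p then 0 else (g w)^n * b w)"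
    have "G holomorphic_on ball 0 1"
    proof (rule holomorphic_transform)
      show "(\<lambda>w. (g w)^n * b w) holomorphic_on ball 0 1"
        unfolding b_def using holo by (intro holomorphic_intros) auto
    qed (use p in \<open>auto simp: G_def\<close>)
    moreover have "continuous_on (cball 0 1) G"
      unfolding continuous_on_def
    proof
      fix w :: complex assume w: "w \<in> cball 0 1"
      show "(G \<longlongrightarrow> G w) (at w within cball 0 1)"
      proof (cases "w = p")
        case True
        have "(b \<longlongrightarrow> b p) (at p within cball 0 1)" unfolding b_def by (intro tendsto_intros) auto
        moreover have "b p = 0" unfolding b_def one_minus_cnj_mult_eq[OF p] by simp
        ultimately have "(b \<longlongrightarrow> 0) (at p within cball 0 1)" by simp
        then have "((\<lambda>w. M^n * cmod (b w)) \<longlongrightarrow> M^n * cmod 0) (at p within cball 0 1)" by (intro tendsto_intros)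
        then have lim: "((\<lambda>w. M^n * cmod (b w)) \<longlongrightarrow> 0) (at p within cball 0 1)" by simp
        have "(G \<longlongrightarrow> 0) (at p within cball 0 1)"
        proof (rule Lim_null_comparison[OF _ lim])
          show "\<forall>\<^sub>F w in at p within cball 0 1. cmod (G w) \<le> M ^ n * cmod (b w)"
            unfolding eventually_at_filter
            by (rule always_eventually)
               (use bnd \<open>0 \<le> M\<close> in \<open>auto simp: G_def norm_mult norm_power intro!: mult_right_mono power_mono\<close>)
        qed
        then show ?thesis using True by (simp add: G_def)
      next
        case False
        have "continuous_on (cball 0 1 - {p}) (\<lambda>w. (g w)^n * b w)"
          unfolding b_def using cont by (intro continuous_intros) auto
        then have "((\<lambda>w. (g w)^n * b w) \<longlongrightarrow> (g w)^n * b w) (at w within cball 0 1 - {p})"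
          using w False by (auto simp: continuous_on_def)
        moreover have "at w within cball 0 1 - {p} = at w within cball 0 1"
          using False by (intro at_within_nhd[of _ "- {p}"]) auto
        ultimately have "((\<lambda>w. (g w)^n * b w) \<longlongrightarrow> G w) (at w within cball 0 1)"
          using False by (simp add: G_def)
        moreover have "\<forall>\<^sub>F u in at w within cball 0 1. (g u)^n * b u = G u"
        proof -
          have "\<forall>\<^sub>F u in at w. u \<noteq> p" using False by (simp add: eventually_neq_at_within)
          then have "\<forall>\<^sub>F u in at w within cball 0 1. u \<noteq> p"
            by (rule filter_leD[OF at_le[OF subset_UNIV]])
          then show ?thesis by eventually_elim (simp add: G_def)
        qed
        ultimately show ?thesis by (rule Lim_transform_eventually)
      qed
    qed
    ultimately have GG: "G holomorphic_on interior (cball 0 1)" "continuous_on (closure (cball 0 1)) G"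
      by simp_all
    have "cmod (G z) \<le> \<eta> ^ n"
    proof (rule maximum_modulus_frontier[OF GG])
      fix w assume "w \<in> frontier (cball (0::complex) 1)"
      then have w: "cmod w = 1" by simp
      show "cmod (G w) \<le> \<eta> ^ n"
      proof (cases "w = p")
        case False
        have "cmod (g w) ^ n * cmod (b w) \<le> \<eta> ^ n * 1"
          using sph[OF w False] bz[of w] w \<open>0 \<le> \<eta>\<close> by (intro mult_mono power_mono) auto
        then show ?thesis using False by (simp add: G_def norm_mult norm_power)
      qed (simp add: G_def \<open>0 \<le> \<eta>\<close>)
    qed (use assms(6) in auto)
    then show ?thesis using \<open>p \<noteq> z\<close> by (simp add: G_def norm_mult norm_power)
  qed
  show ?thesis
  proof (rule power_le_imp_le_of_const[OF \<open>0 \<le> \<eta>\<close>])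
    fix n show "cmod (g z) ^ n \<le> 1 / cmod (b z) * \<eta> ^ n"
      using key[of n] \<open>b z \<noteq> 0\<close> by (simp add: pos_le_divide_eq)
  qed
qed

text \<open>Multiply \<open>g\<close> by exp (- A (1 - cnj p z)), whose modulus is at most 1 on the
  disc and equals exp (- A |z - p|^2 / 2) on the circle. There \<open>g\<close> is small near
  \<open>p\<close> and the exponential is small away from \<open>p\<close>. The maximum principle
  carries the bound inwards, and dividing by the exponential costs little near
  \<open>p\<close>.\<close>

lemma disc_tendsto_zero_from_circle:
  assumes holo: "g holomorphic_on ball 0 1" and cont: "continuous_on (cball 0 1 - {p}) g"
    and p: "cmod p = 1"
    and bnd: "\<And>z. z \<in> cball 0 1 - {p} \<Longrightarrow> cmod (g z) \<le> M"
    and sph: "(g \<longlongrightarrow> 0) (at p within sphere 0 1)"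
  shows "(g \<longlongrightarrow> 0) (at p within ball 0 1)"
proof (rule tendstoI)
  fix \<epsilon> :: real assume "\<epsilon> > 0"
  have "0 \<in> cball 0 1 - {p}" using p by auto
  then have "0 \<le> M" by (rule order_trans[OF norm_ge_zero bnd])
  have "\<forall>\<^sub>F z in at p within sphere 0 1. dist (g z) 0 < \<epsilon> / 2"
    by (rule tendstoD[OF sph]) (use \<open>\<epsilon> > 0\<close> in simp)
  then obtain \<delta> where \<delta>: "\<delta> > 0" "\<And>z. cmod z = 1 \<Longrightarrow> z \<noteq> p \<Longrightarrow> dist z p < \<delta> \<Longrightarrow> cmod (g z) < \<epsilon> / 2"
    unfolding eventually_at by (auto simp: dist_norm)
  \<comment> \<open>\<open>x\<close> is chosen so that M exp (- x) \<le> \<epsilon> / 2, by 1 + x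
    \<le> exp x, and \<open>A\<close> so that A \<delta>^2 / 2 = x, the exponent reached on the
    circle at distance \<delta> from \<open>p\<close>.\<close>
  define x where "x = 2 * M / \<epsilon>"
  define A where "A = 2 * x / \<delta>\<^sup>2"
  have "0 \<le> x" "0 \<le> A" using \<open>0 \<le> M\<close> \<open>\<epsilon> > 0\<close> \<open>\<delta> > 0\<close> by (auto simp: A_def x_def)
  define e where "e = (\<lambda>z. exp (- of_real A * (1 - cnj p * z)))"
  have ne: "cmod (e z) = exp (- A * Re (1 - cnj p * z))" for z
    by (simp add: e_def)
  have Re_nonneg: "0 \<le> Re (1 - cnj p * z)" if "cmod z \<le> 1" for z
  proof -
    have "Re (cnj p * z) \<le> cmod (cnj p * z)" by (rule complex_Re_le_cmod)
    also have "\<dots> \<le> 1" using that p by (simp add: norm_mult)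
    finally show ?thesis by simp
  qed
  have Mx: "M * exp (- x) \<le> \<epsilon> / 2"
  proof -
    have "M \<le> \<epsilon> / 2 * (1 + x)" using \<open>\<epsilon> > 0\<close> by (simp add: x_def field_simps)
    also have "\<dots> \<le> \<epsilon> / 2 * exp x" using \<open>\<epsilon> > 0\<close> by (intro mult_left_mono exp_ge_add_one_self) auto
    finally show ?thesis by (simp add: exp_minus field_simps)
  qed
  have main: "cmod (g z) \<le> \<epsilon> / 2 * exp (A * Re (1 - cnj p * z))" if z: "z \<in> ball 0 1" for z
  proof -
    have "cmod (g z * e z) \<le> \<epsilon> / 2"
    proof (rule disc_maximum_modulus_except_point[where g = "\<lambda>z. g z * e z" and p = p and M = M])
      show "(\<lambda>z. g z * e z) holomorphic_on ball 0 1"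
        unfolding e_def using holo by (intro holomorphic_intros)
      show "continuous_on (cball 0 1 - {p}) (\<lambda>z. g z * e z)"
        unfolding e_def using cont by (intro continuous_intros)
      fix w assume w: "w \<in> cball 0 1 - {p}"
      have "cmod (e w) \<le> 1" unfolding ne using Re_nonneg[of w] w \<open>0 \<le> A\<close> by simp
      then have "cmod (g w) * cmod (e w) \<le> M * 1"
        using bnd[OF w] \<open>0 \<le> M\<close> by (intro mult_mono) auto
      then show "cmod (g w * e w) \<le> M" by (simp add: norm_mult)
    next
      fix w assume w: "cmod w = 1" "w \<noteq> p"
      have sq: "(cmod (w - p))\<^sup>2 = 2 * Re (1 - cnj p * w)"
      proof -
        have "(cmod (w - p))\<^sup>2 = (cmod w)\<^sup>2 + (cmod p)\<^sup>2 - 2 * Re (cnj p * w)"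
          unfolding cmod_power2 by (simp add: power2_eq_square algebra_simps)
        then show ?thesis using w p by simp
      qed
      have "cmod (g w) * cmod (e w) \<le> \<epsilon> / 2"
      proof (cases "dist w p < \<delta>")
        case True
        have "cmod (e w) \<le> 1" unfolding ne using Re_nonneg[of w] w \<open>0 \<le> A\<close> by simp
        then have "cmod (g w) * cmod (e w) \<le> (\<epsilon> / 2) * 1"
          using \<delta>(2)[OF w True] \<open>\<epsilon> > 0\<close> by (intro mult_mono) auto
        then show ?thesis by simp
      next
        case False
        then have "\<delta>\<^sup>2 \<le> 2 * Re (1 - cnj p * w)"
          using \<open>\<delta> > 0\<close> sq by (smt (verit) dist_norm power_mono)
        then have "x * \<delta>\<^sup>2 \<le> x * (2 * Re (1 - cnj p * w))" using \<open>0 \<le> x\<close> by (rule mult_left_mono)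
        also have "\<dots> = A * Re (1 - cnj p * w) * \<delta>\<^sup>2" using \<open>\<delta> > 0\<close> by (simp add: A_def)
        finally have "x \<le> A * Re (1 - cnj p * w)" using \<open>\<delta> > 0\<close> by simp
        then have "cmod (e w) \<le> exp (- x)" unfolding ne by simp
        then have "cmod (g w) * cmod (e w) \<le> M * exp (- x)"
          using bnd[of w] w \<open>0 \<le> M\<close> by (intro mult_mono) auto
        then show ?thesis using Mx by simp
      qed
      then show "cmod (g w * e w) \<le> \<epsilon> / 2" by (simp add: norm_mult)
    qed (use p z in auto)
    then have "cmod (g z) * inverse (exp (A * Re (1 - cnj p * z))) \<le> \<epsilon> / 2"
      unfolding norm_mult ne by (simp only: mult_minus_left exp_minus)
    then show ?thesis by (simp only: divide_inverse[symmetric] pos_divide_le_eq[OF exp_gt_zero])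
  qed
  \<comment> \<open>Within this distance of \<open>p\<close> the exponential factor in
    \<open>main\<close> stays below 2; \<open>A + 1\<close> instead of \<open>A\<close> covers the
    case \<open>A = 0\<close>.\<close>
  define \<rho> where "\<rho> = ln 2 / (A + 1)"
  have "\<rho> > 0" using \<open>0 \<le> A\<close> by (simp add: \<rho>_def)
  show "\<forall>\<^sub>F z in at p within ball 0 1. dist (g z) 0 < \<epsilon>"
    unfolding eventually_at
  proof (intro exI[of _ \<rho>] conjI ballI impI \<open>\<rho> > 0\<close>)
    fix z assume z: "z \<in> ball 0 1" "z \<noteq> p \<and> dist z p < \<rho>"
    have "Re (1 - cnj p * z) \<le> cmod (1 - cnj p * z)" by (rule complex_Re_le_cmod)
    also have "\<dots> = dist z p" unfolding one_minus_cnj_mult_eq[OF p] using p by (simp add: norm_mult dist_norm norm_minus_commute)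
    finally have "A * Re (1 - cnj p * z) \<le> A * dist z p" using \<open>0 \<le> A\<close> by (rule mult_left_mono)
    also have "\<dots> \<le> (A + 1) * dist z p" by (simp add: mult_right_mono)
    also have "\<dots> < ln 2" using z \<open>0 \<le> A\<close> by (simp add: \<rho>_def pos_less_divide_eq mult.commute)
    finally have "exp (A * Re (1 - cnj p * z)) < 2" by (metis exp_less_mono exp_ln zero_less_numeral)
    then have "\<epsilon> / 2 * exp (A * Re (1 - cnj p * z)) < \<epsilon> / 2 * 2"
      using \<open>\<epsilon> > 0\<close> by (intro mult_strict_left_mono) auto
    then show "dist (g z) 0 < \<epsilon>" using main[OF z(1)] by simp
  qed
qed

section \<open>From angular derivatives to nontangential limits in the disc\<close>

lemma cis_lipschitz: "cmod (cis s - cis t) \<le> \<bar>s - t\<bar>"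
proof -
  have "norm (cis s - cis t) \<le> 1 * norm (s - t)"
  proof (rule differentiable_bound[of UNIV cis "\<lambda>t h. h *\<^sub>R (\<i> * cis t)"])
    show "(cis has_derivative (\<lambda>h. h *\<^sub>R (\<i> * cis x))) (at x within UNIV)" for x
      by (auto intro!: derivative_eq_intros simp: fun_eq_iff)
    show "onorm (\<lambda>h. h *\<^sub>R (\<i> * cis x)) \<le> 1" for x
      by (rule onorm_le) (simp add: norm_mult)
  qed auto
  then show ?thesis by simp
qed

text \<open>Divide both increments by the change of angle: the quotient is the angular quotient of
  \<open>H\<close> over that of \<open>cis\<close>, and the latter has the nonzero limit \<i> cis
  t.\<close>

lemma tendsto_circle_quotient:
  fixes H :: "complex \<Rightarrow> complex"
  assumes "((\<lambda>s. H (cis s)) has_vector_derivative d) (at t)"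
  shows "((\<lambda>z. (H z - H (cis t)) / (z - cis t)) \<longlongrightarrow> d / (\<i> * cis t)) (at (cis t) within sphere 0 1)"
proof -
  define p where "p = cis t"
  have p: "cmod p = 1" "p \<noteq> 0" by (auto simp: p_def)
  \<comment> \<open>A local inverse of \<open>cis\<close> with values near \<open>t\<close>. Taking
    \<open>Arg\<close> of the ratio keeps its branch cut away from the point, whatever
    \<open>t\<close> is.\<close>
  define \<theta> where "\<theta> = (\<lambda>z. t + Arg (z / p))"
  have \<theta>: "cis (\<theta> z) = z" if "cmod z = 1" for z
  proof -
    have "cis (Arg (z / p)) = z / p"
      using that p by (subst cis_Arg) (auto simp: sgn_div_norm norm_divide)
    then show ?thesis using p by (simp add: \<theta>_def p_def flip: cis_mult)
  qed
  have "((\<lambda>z. z / p) \<longlongrightarrow> p / p) (at p within sphere 0 1)" using p by (intro tendsto_intros) auto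
  then have "((\<lambda>z. z / p) \<longlongrightarrow> 1) (at p within sphere 0 1)" using p by simp
  then have "((\<lambda>z. Arg (z / p)) \<longlongrightarrow> Arg 1) (at p within sphere 0 1)"
    by (rule tendsto_Arg) simp
  then have "(\<theta> \<longlongrightarrow> t + Arg 1) (at p within sphere 0 1)"
    unfolding \<theta>_def by (rule tendsto_add[OF tendsto_const])
  then have lim: "(\<theta> \<longlongrightarrow> t) (at p within sphere 0 1)" by simp
  have ev: "\<forall>\<^sub>F z in at p within sphere 0 1. cmod z = 1 \<and> z \<noteq> p"
    by (auto simp: eventually_at_filter)
  have flim: "filterlim \<theta> (at t) (at p within sphere 0 1)"
    unfolding filterlim_at
  proof (intro conjI lim)
    show "\<forall>\<^sub>F z in at p within sphere 0 1. \<theta> z \<in> UNIV \<and> \<theta> z \<noteq> t"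
      using ev
    proof eventually_elim
      case (elim z)
      then show ?case using \<theta>[of z] by (auto simp: p_def)
    qed
  qed
  have q1: "((\<lambda>s. (H (cis s) - H (cis t)) / of_real (s - t)) \<longlongrightarrow> d) (at t)"
    by (rule has_vector_derivative_complex_quotient[OF assms])
  have "(cis has_vector_derivative (\<i> * cis t)) (at t)"
    unfolding has_vector_derivative_def by (auto intro!: derivative_eq_intros simp: fun_eq_iff)
  then have q2: "((\<lambda>s. (cis s - cis t) / of_real (s - t)) \<longlongrightarrow> \<i> * cis t) (at t)"
    by (rule has_vector_derivative_complex_quotient)
  have "((\<lambda>s. ((H (cis s) - H (cis t)) / of_real (s - t)) / ((cis s - cis t) / of_real (s - t)))
          \<longlongrightarrow> d / (\<i> * cis t)) (at t)"
    by (intro tendsto_divide q1 q2) auto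
  from filterlim_compose[OF this flim]
  have "((\<lambda>z. ((H (cis (\<theta> z)) - H (cis t)) / of_real (\<theta> z - t)) / ((cis (\<theta> z) - cis t) / of_real (\<theta> z - t)))
          \<longlongrightarrow> d / (\<i> * cis t)) (at p within sphere 0 1)" .
  moreover have "\<forall>\<^sub>F z in at p within sphere 0 1.
      ((H (cis (\<theta> z)) - H (cis t)) / of_real (\<theta> z - t)) / ((cis (\<theta> z) - cis t) / of_real (\<theta> z - t))
       = (H z - H (cis t)) / (z - cis t)"
    using ev
  proof eventually_elim
    case (elim z)
    then have "\<theta> z \<noteq> t" using \<theta>[of z] by (auto simp: p_def)
    then have "complex_of_real (\<theta> z - t) \<noteq> 0" by (simp del: of_real_diff)
    then show ?case using \<theta>[of z] elim by (simp add: divide_simps del: of_real_diff)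
  qed
  ultimately show ?thesis unfolding p_def[symmetric] by (rule Lim_transform_eventually)
qed

text \<open>With \<open>k z = H z - H p - c * (z - p)\<close> of size \<open>o(\<bar>z - p\<bar>)\<close> in the whole disc, Cauchy's
  estimate on a circle of radius comparable to \<open>\<bar>z - p\<bar>\<close> controls \<open>k' = f - c\<close> in a Stolz angle.\<close>

lemma fatou_disc_at:
  fixes f H :: "complex \<Rightarrow> complex"
  assumes H: "B-lipschitz_on (cball 0 1) H"
    and der: "\<And>z. z \<in> ball 0 1 \<Longrightarrow> (H has_field_derivative f z) (at z)"
    and p: "cmod p = 1"
    and lim: "((\<lambda>z. (H z - H p) / (z - p)) \<longlongrightarrow> c) (at p within sphere 0 1)"
  shows "(f \<longlongrightarrow> c) (at p within {z. cmod z < 1 \<and> cmod (z - p) < M * (1 - cmod z)})"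
proof -
  define g where "g = (\<lambda>z. (H z - H p) / (z - p) - c)"
  define k where "k = (\<lambda>z. H z - H p - c * (z - p))"
  have Hhol: "H holomorphic_on ball 0 1" unfolding holomorphic_on_open[OF open_ball] using der by blast
  have pb: "p \<notin> ball 0 1" "p \<in> cball 0 1" using p by auto
  have "(g \<longlongrightarrow> 0) (at p within ball 0 1)"
  proof (rule disc_tendsto_zero_from_circle[OF _ _ p])
    show "g holomorphic_on ball 0 1"
      unfolding g_def using Hhol pb by (intro holomorphic_intros) auto
    show "continuous_on (cball 0 1 - {p}) g"
      unfolding g_def using lipschitz_on_continuous_on[OF H]
      by (intro continuous_intros) (auto intro: continuous_on_subset)
    show "cmod (g z) \<le> B + cmod c" if z: "z \<in> cball 0 1 - {p}" for z
    proof -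
      have "cmod (H z - H p) \<le> B * cmod (z - p)"
        using lipschitz_onD[OF H, of z p] z pb by (simp add: dist_norm)
      then have "cmod ((H z - H p) / (z - p)) \<le> B"
        using z by (simp add: norm_divide pos_divide_le_eq)
      then show ?thesis unfolding g_def by (meson add_right_mono norm_triangle_ineq4 order_trans)
    qed
    have "(g \<longlongrightarrow> c - c) (at p within sphere 0 1)" unfolding g_def by (intro tendsto_intros lim)
    then show "(g \<longlongrightarrow> 0) (at p within sphere 0 1)" by simp
  qed
  show ?thesis
  proof (rule tendstoI)
    fix \<epsilon> :: real assume "\<epsilon> > 0"
    \<comment> \<open>On the Cauchy circle used below, points lie within (2 |M| + 1) \<rho> of
      \<open>p\<close>; this \<eta> turns that factor into \<epsilon> / 2.\<close>
    define \<eta> where "\<eta> = \<epsilon> / (2 * (2 * \<bar>M\<bar> + 1))"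
    have "\<eta> > 0" using \<open>\<epsilon> > 0\<close> by (simp add: \<eta>_def)
    obtain \<delta> where \<delta>: "\<delta> > 0" "\<And>z. z \<in> ball 0 1 \<Longrightarrow> dist z p < \<delta> \<Longrightarrow> cmod (g z) < \<eta>"
      using tendstoD[OF \<open>(g \<longlongrightarrow> 0) (at p within ball 0 1)\<close> \<open>\<eta> > 0\<close>] pb(1)
      unfolding eventually_at dist_0_norm dist_norm diff_0_right by metis
    show "\<forall>\<^sub>F z in at p within {z. cmod z < 1 \<and> cmod (z - p) < M * (1 - cmod z)}. dist (f z) c < \<epsilon>"
      unfolding eventually_at
    proof (intro exI[of _ "\<delta> / 2"] conjI ballI impI)
      show "0 < \<delta> / 2" using \<delta> by simp
    next
      fix z assume "z \<in> {z. cmod z < 1 \<and> cmod (z - p) < M * (1 - cmod z)}" and z2: "z \<noteq> p \<and> dist z p < \<delta> / 2"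
      then have z: "cmod z < 1" "cmod (z - p) < M * (1 - cmod z)" by auto
      \<comment> \<open>Half the distance to the unit circle: the closed disc of this radius around
        \<open>z\<close> stays inside the unit disc, and \<open>\<rho> \<le> dist z p\<close> keeps
        it within \<delta> of \<open>p\<close>.\<close>
      define \<rho> where "\<rho> = (1 - cmod z) / 2"
      have "\<rho> > 0" using z by (simp add: \<rho>_def)
      have near: "\<rho> \<le> dist z p"
      proof -
        have "1 - cmod z \<le> cmod (z - p)" using norm_triangle_ineq2[of p z] p by (simp add: norm_minus_commute)
        then show ?thesis using z by (simp add: \<rho>_def dist_norm)
      qed
      have sub: "cball z \<rho> \<subseteq> ball 0 1"
      proof
        fix w assume "w \<in> cball z \<rho>"
        then have "cmod (w - z) \<le> \<rho>" by (simp add: dist_norm norm_minus_commute)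
        then have "cmod w \<le> cmod z + \<rho>" using norm_triangle_ineq2[of w z] by simp
        also have "\<dots> < 1" using z by (simp add: \<rho>_def field_simps)
        finally show "w \<in> ball 0 1" by simp
      qed
      have khol: "k holomorphic_on ball 0 1" unfolding k_def using Hhol by (intro holomorphic_intros)
      have "cmod ((deriv ^^ 1) k z) \<le> fact 1 * ((2 * \<bar>M\<bar> + 1) * \<rho> * \<eta>) / \<rho> ^ 1"
      proof (rule Cauchy_inequality)
        show "k holomorphic_on ball z \<rho>" using khol sub by (rule holomorphic_on_subset[OF _ order_trans[OF ball_subset_cball]])
        show "continuous_on (cball z \<rho>) k"
          using holomorphic_on_imp_continuous_on[OF khol] sub continuous_on_subset by blast
        fix w assume w: "cmod (z - w) = \<rho>"
        then have wb: "w \<in> ball 0 1" using sub by (auto simp: dist_norm)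
        have "w \<noteq> p" using wb pb by auto
        have wp: "dist w p \<le> \<rho> + dist z p"
          using dist_triangle[of w p z] w by (simp add: dist_norm norm_minus_commute)
        have "cmod (g w) < \<eta>" using \<delta>(2)[OF wb] wp near z2 by simp
        moreover have "cmod (w - p) \<le> (2 * \<bar>M\<bar> + 1) * \<rho>"
        proof -
          have "M * (1 - cmod z) \<le> \<bar>M\<bar> * (1 - cmod z)" using z by (intro mult_right_mono) auto
          then have "dist z p \<le> 2 * \<bar>M\<bar> * \<rho>" using z(2) by (simp add: dist_norm \<rho>_def)
          then show ?thesis using wp by (simp add: dist_norm algebra_simps)
        qed
        ultimately have "cmod (w - p) * cmod (g w) \<le> (2 * \<bar>M\<bar> + 1) * \<rho> * \<eta>"
          using \<open>\<rho> > 0\<close> by (intro mult_mono) auto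
        moreover have "k w = (w - p) * g w" using \<open>w \<noteq> p\<close> by (simp add: k_def g_def field_simps)
        ultimately show "cmod (k w) \<le> (2 * \<bar>M\<bar> + 1) * \<rho> * \<eta>" by (simp add: norm_mult)
      qed (rule \<open>\<rho> > 0\<close>)
      moreover have "deriv k z = f z - c"
        unfolding k_def using der[of z] z
        by (intro DERIV_imp_deriv) (auto intro!: derivative_eq_intros)
      ultimately have "cmod (f z - c) \<le> (2 * \<bar>M\<bar> + 1) * \<eta>" using \<open>\<rho> > 0\<close> by simp
      also have "\<dots> = \<epsilon> / 2"
      proof -
        have "2 * \<bar>M\<bar> + 1 \<noteq> 0" by linarith
        then show ?thesis unfolding \<eta>_def by (simp only: times_divide_eq_right divide_divide_eq_left' mult_divide_mult_cancel_left_if) (simp add: field_simps)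
      qed
      finally show "dist (f z) c < \<epsilon>" using \<open>\<epsilon> > 0\<close> by (simp add: dist_norm)
    qed
  qed
qed

text \<open>The exceptional set is a set of angles on the real line, so that null sets never have to
  be measured on the circle. It does not depend on the aperture \<open>M\<close>, and neither does
  the limit.\<close>

lemma fatou_disc:
  assumes holo: "f holomorphic_on ball 0 1" and bnd: "\<And>z. z \<in> ball 0 1 \<Longrightarrow> cmod (f z) \<le> B"
  shows "\<exists>N. negligible N \<and> (\<forall>t. t \<notin> N \<longrightarrow>
    (\<exists>c. \<forall>M. (f \<longlongrightarrow> c) (at (cis t) within {z. cmod z < 1 \<and> cmod (z - cis t) < M * (1 - cmod z)})))"
proof -
  have "0 \<le> B" using order_trans[OF norm_ge_zero bnd[of 0]] by simp
  obtain F where F: "\<And>x. x \<in> ball 0 1 \<Longrightarrow> (F has_field_derivative f x) (at x within ball 0 1)"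
    using holomorphic_convex_primitive'[OF convex_ball open_ball holo] by blast
  have "B-lipschitz_on (ball 0 1) F"
    using field_differentiable_bound[OF convex_ball F bnd] \<open>0 \<le> B\<close>
    by (intro lipschitz_onI) (auto simp: dist_norm)
  then obtain H where H: "B-lipschitz_on (cball 0 1) H" "\<And>x. x \<in> ball 0 1 \<Longrightarrow> H x = F x"
    using lipschitz_extend_closure[of B "ball 0 1" F] by auto
  have der: "(H has_field_derivative f z) (at z)" if z: "z \<in> ball 0 1" for z
  proof (rule has_field_derivative_transform_within_open[OF _ open_ball z])
    show "(F has_field_derivative f z) (at z)"
      using F[OF z] at_within_open[OF z open_ball] by simp
    show "F w = H w" if "w \<in> ball 0 1" for w using H(2)[OF that] by simp
  qed
  have "B-lipschitz_on UNIV (\<lambda>t. H (cis t))"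
  proof (rule lipschitz_onI)
    fix s t :: real
    have "dist (H (cis s)) (H (cis t)) \<le> B * dist (cis s) (cis t)"
      by (rule lipschitz_onD[OF H(1)]) auto
    also have "\<dots> \<le> B * dist s t"
      using cis_lipschitz[of s t] \<open>0 \<le> B\<close> by (intro mult_left_mono) (auto simp: dist_norm)
    finally show "dist (H (cis s)) (H (cis t)) \<le> B * dist s t" .
  qed (rule \<open>0 \<le> B\<close>)
  from lipschitz_complex_deriv_ae[OF this] show ?thesis
  proof cases
    case (1 N)
    note N = 1
    show ?thesis
    proof (intro exI[of _ N] conjI allI impI N(1))
    fix t assume "t \<notin> N"
    then obtain d where d: "((\<lambda>t. H (cis t)) has_vector_derivative d) (at t)" using N(2) by blast
    show "\<exists>c. \<forall>M. (f \<longlongrightarrow> c) (at (cis t) within {z. cmod z < 1 \<and> cmod (z - cis t) < M * (1 - cmod z)})"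
      using fatou_disc_at[OF H(1) der _ tendsto_circle_quotient[OF d]] by auto
    qed
  qed
qed

subsection \<open>Boundary limits on the exterior of the disc\<close>

lemma negligible_scaleR_image:
  fixes N :: "real set"
  assumes "negligible N"
  shows "negligible ((\<lambda>x. c * x) ` N)"
  by (rule negligible_differentiable_image_negligible[OF _ assms])
     (auto simp: differentiable_on_def intro!: derivative_intros)

text \<open>Cauchy's formula for \<open>f ^ k\<close> gives \<open>\<bar>f w\<bar>\<^sup>k \<le> C\<^sup>k / (1 - \<bar>w\<bar>)\<close>; then take \<open>k\<close>-th roots.\<close>

lemma disc_norm_le_of_radial_limits:
  assumes holo: "f holomorphic_on ball 0 1" and bnd: "\<And>z. z \<in> ball 0 1 \<Longrightarrow> cmod (f z) \<le> B"
    and N: "negligible N" and C: "0 \<le> C"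
    and lim: "\<And>t. t \<notin> N \<Longrightarrow> \<exists>l. ((\<lambda>r. f (of_real r * cis t)) \<longlongrightarrow> l) (at_left 1) \<and> cmod l \<le> C"
    and w: "w \<in> ball 0 1"
  shows "cmod (f w) \<le> C"
proof (rule power_le_imp_le_of_const[OF C])
  fix k
  define e where "e = (\<lambda>s::real. cis (2 * pi * s))"
  have ne: "cmod (e s) = 1" for s by (simp add: e_def)
  \<comment> \<open>Radii that increase to 1 from (1 + |w|) / 2, so that the Cauchy kernel at
    \<open>w\<close> is bounded uniformly in \<open>n\<close>.\<close>
  define r where "r = (\<lambda>n::nat. 1 - (1 - cmod w) / (real n + 2))"
  have "0 < 1 - cmod w" using w by simp
  have r1: "r n < 1" for n using \<open>0 < 1 - cmod w\<close> by (simp add: r_def)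
  have rw: "(1 - cmod w) / 2 \<le> r n - cmod w" for n
  proof -
    have "(1 - cmod w) / (real n + 2) \<le> (1 - cmod w) / 2"
      using \<open>0 < 1 - cmod w\<close> by (intro divide_left_mono) auto
    moreover have "(1 - cmod w) / 2 + (1 - cmod w) / 2 = 1 - cmod w" by simp
    ultimately show ?thesis unfolding r_def by linarith
  qed
  have r0: "0 < r n" for n
  proof -
    have "0 < (1 - cmod w) / 2" using \<open>0 < 1 - cmod w\<close> by simp
    then show ?thesis using rw[of n] norm_ge_zero[of w] by linarith
  qed
  have rlim: "r \<longlonglongrightarrow> 1"
  proof -
    have "(\<lambda>n. (1 - cmod w) / (real n + 2)) \<longlonglongrightarrow> 0"
      by (rule real_tendsto_divide_at_top[OF tendsto_const])
         (intro filterlim_tendsto_add_at_top[OF _ filterlim_real_sequentially, of "\<lambda>_. 2" 2, simplified add.commute] tendsto_const)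
    from tendsto_diff[OF tendsto_const[of 1] this] show ?thesis by (simp add: r_def[abs_def])
  qed
  \<comment> \<open>\<open>N\<close> consists of angles, whereas \<open>circlepath\<close> is
    parametrised by turns in [0,1].\<close>
  define N' where "N' = (\<lambda>t. 1 / (2 * pi) * t) ` N"
  have N': "negligible N'" unfolding N'_def by (rule negligible_scaleR_image[OF N])
  have notN: "2 * pi * s \<notin> N" if "s \<notin> N'" for s
  proof
    assume "2 * pi * s \<in> N"
    then have "1 / (2 * pi) * (2 * pi * s) \<in> N'" unfolding N'_def by blast
    then show False using that by simp
  qed
  define l where "l = (\<lambda>s. SOME l. ((\<lambda>r. f (of_real r * e s)) \<longlongrightarrow> l) (at_left 1) \<and> cmod l \<le> C)"
  have l: "((\<lambda>r. f (of_real r * e s)) \<longlongrightarrow> l s) (at_left 1)" "cmod (l s) \<le> C" if "s \<notin> N'" for s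
    using someI_ex[OF lim[OF notN[OF that]]] unfolding l_def e_def by auto
  define h where "h = (\<lambda>n s. f (of_real (r n) * e s) ^ k / (of_real (r n) * e s - w) * (2 * of_real pi * \<i> * of_real (r n) * e s))"
  define L where "L = (\<lambda>s. l s ^ k / (e s - w) * (2 * of_real pi * \<i> * e s))"
  have hint: "(h n has_integral (2 * of_real pi * \<i> * f w ^ k)) {0..1}" for n
  proof -
    have "(\<lambda>u. f u ^ k) holomorphic_on cball 0 (r n)"
      using r1[of n] by (intro holomorphic_intros holomorphic_on_subset[OF holo]) auto
    then have ci: "((\<lambda>u. f u ^ k / (u - w)) has_contour_integral (2 * of_real pi * \<i> * f w ^ k)) (circlepath 0 (r n))"
      using rw[of n] \<open>0 < 1 - cmod w\<close> by (intro Cauchy_integral_circlepath_simple) auto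
    have cp: "circlepath 0 (r n) s = of_real (r n) * e s" for s
      by (simp add: circlepath e_def cis_conv_exp mult_ac)
    have ex: "exp (2 * of_real pi * \<i> * complex_of_real s) = e s" for s
      by (simp add: e_def cis_conv_exp mult_ac)
    show ?thesis
      using ci unfolding has_contour_integral
      by (rule has_integral_eq[rotated])
         (simp only: h_def vector_derivative_circlepath cp ex of_real_mult of_real_numeral)
  qed
  define K where "K = B ^ k / ((1 - cmod w) / 2) * (2 * pi)"
  have "0 \<le> B" using order_trans[OF norm_ge_zero bnd[of 0]] by simp
  have hbnd: "cmod (h n s) \<le> K" for n s
  proof -
    have in_ball: "of_real (r n) * e s \<in> ball 0 1" using r1[of n] r0[of n] ne[of s] by (simp add: norm_mult)
    have "(1 - cmod w) / 2 \<le> cmod (of_real (r n) * e s - w)"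
      using rw[of n] norm_triangle_ineq2[of "of_real (r n) * e s" w] r0[of n] ne[of s] by (simp add: norm_mult)
    then have "cmod (f (of_real (r n) * e s)) ^ k / cmod (of_real (r n) * e s - w) \<le> B ^ k / ((1 - cmod w) / 2)"
      using bnd[OF in_ball] \<open>0 < 1 - cmod w\<close> \<open>0 \<le> B\<close> by (intro frac_le power_mono) auto
    moreover have "cmod (2 * of_real pi * \<i> * of_real (r n) * e s) \<le> 2 * pi"
      using r1[of n] r0[of n] ne[of s] by (simp add: norm_mult)
    ultimately have "cmod (f (of_real (r n) * e s)) ^ k / cmod (of_real (r n) * e s - w) * cmod (2 * of_real pi * \<i> * of_real (r n) * e s) \<le> K"
      unfolding K_def using \<open>0 \<le> B\<close> \<open>0 < 1 - cmod w\<close> by (rule_tac mult_mono) auto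
    then show ?thesis
      unfolding h_def norm_mult[of "_ / _"] norm_divide norm_power .
  qed
  have hlim: "(\<lambda>n. h n s) \<longlonglongrightarrow> L s" if "s \<notin> N'" for s
  proof -
    have "filterlim r (at_left 1) sequentially"
      unfolding filterlim_at using rlim r1 by (auto simp: less_le)
    from filterlim_compose[OF l(1)[OF that] this] have "(\<lambda>n. f (of_real (r n) * e s)) \<longlonglongrightarrow> l s" .
    moreover have "(\<lambda>n. complex_of_real (r n)) \<longlonglongrightarrow> of_real 1" by (intro tendsto_of_real rlim)
    moreover have "e s \<noteq> w" using ne[of s] w by auto
    ultimately have "(\<lambda>n. h n s) \<longlonglongrightarrow> l s ^ k / (of_real 1 * e s - w) * (2 * of_real pi * \<i> * of_real 1 * e s)"
      unfolding h_def by (intro tendsto_intros rlim) auto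
    then show ?thesis by (simp add: L_def)
  qed
  \<comment> \<open>Setting the integrands to 0 on the null set makes them converge at every point,
    as dominated convergence demands. That theorem also supplies the integrability of
    \<open>L'\<close>, whose values come from the arbitrary choice in \<open>l\<close>.\<close>
  define h' where "h' = (\<lambda>n s. if s \<in> N' then 0 else h n s)"
  define L' where "L' = (\<lambda>s. if s \<in> N' then 0 else L s)"
  have h'int: "(h' n has_integral (2 * of_real pi * \<i> * f w ^ k)) {0..1}" for n
    by (rule has_integral_spike[OF N' _ hint[of n]]) (auto simp: h'_def)
  have "0 \<le> K" using order_trans[OF norm_ge_zero hbnd] by blast
  have dc: "L' integrable_on {0..1}" "(\<lambda>n. integral {0..1} (h' n)) \<longlonglongrightarrow> integral {0..1} L'"
  proof -
    have a: "\<And>n. h' n integrable_on {0..1}" using h'int by blast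
    have b: "(\<lambda>_. K) integrable_on {0..1::real}" by (rule integrable_const_ivl)
    have c: "\<And>n s. s \<in> {0..1} \<Longrightarrow> norm (h' n s) \<le> K" using hbnd \<open>0 \<le> K\<close> by (simp add: h'_def)
    have d: "\<And>s. s \<in> {0..1} \<Longrightarrow> (\<lambda>n. h' n s) \<longlonglongrightarrow> L' s" using hlim by (simp add: h'_def L'_def)
    show "L' integrable_on {0..1}" "(\<lambda>n. integral {0..1} (h' n)) \<longlonglongrightarrow> integral {0..1} L'"
      using dominated_convergence[OF a b c d] by auto
  qed
  have "integral {0..1} (h' n) = 2 * of_real pi * \<i> * f w ^ k" for n
    using h'int by (rule integral_unique)
  then have eq: "integral {0..1} L' = 2 * of_real pi * \<i> * f w ^ k"
    using dc(2) LIMSEQ_unique[OF tendsto_const] by fastforce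
  have "norm (integral {0..1} L') \<le> integral {0..1} (\<lambda>_::real. C ^ k / (1 - cmod w) * (2 * pi))"
  proof (rule integral_norm_bound_integral[OF dc(1)])
    fix s :: real
    show "norm (L' s) \<le> C ^ k / (1 - cmod w) * (2 * pi)"
    proof (cases "s \<in> N'")
      case True
      then show ?thesis using C \<open>0 < 1 - cmod w\<close> by (simp add: L'_def)
    next
      case False
      have "1 - cmod w \<le> cmod (e s - w)" using norm_triangle_ineq2[of "e s" w] ne[of s] by simp
      then have "cmod (l s) ^ k / cmod (e s - w) \<le> C ^ k / (1 - cmod w)"
        using l(2)[OF False] \<open>0 < 1 - cmod w\<close> by (intro frac_le power_mono) (auto simp: C)
      then have "cmod (l s) ^ k / cmod (e s - w) * (2 * pi) \<le> C ^ k / (1 - cmod w) * (2 * pi)"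
        by (rule mult_right_mono) simp
      then show ?thesis using False ne[of s] by (simp add: L'_def L_def norm_mult norm_divide norm_power)
    qed
  qed (rule integrable_const_ivl)
  then have "cmod (f w) ^ k * (2 * pi) \<le> C ^ k / (1 - cmod w) * (2 * pi)"
    unfolding eq by (simp add: norm_mult norm_power mult.commute)
  then have "cmod (f w) ^ k \<le> C ^ k / (1 - cmod w)" by (rule mult_right_le_imp_le) simp
  then show "cmod (f w) ^ k \<le> 1 / (1 - cmod w) * C ^ k" by simp
qed

section \<open>Transfer to the exterior of the disc by inversion\<close>

lemma norm_inverse_less_1: "1 < cmod q \<Longrightarrow> cmod (1 / q) < 1"
  by (subst norm_divide) (simp add: divide_less_eq)

text \<open>Under z = 1 / q the point q = \<infinity> becomes an isolated singularity at z = 0,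
  removable because \<open>f\<close> is bounded; the bound at 0 follows by continuity.\<close>

lemma exterior_to_disc:
  assumes holo: "f holomorphic_on outside_disc" and bnd: "\<And>q. q \<in> outside_disc \<Longrightarrow> cmod (f q) \<le> B"
  obtains g where "g holomorphic_on ball 0 1" "\<And>q. q \<in> outside_disc \<Longrightarrow> g (1 / q) = f q"
    "\<And>z. z \<in> ball 0 1 \<Longrightarrow> cmod (g z) \<le> B"
proof -
  have inv: "1 / z \<in> outside_disc" if "z \<in> ball 0 1 - {0}" for z
    using that by (simp add: outside_disc_def norm_divide field_simps)
  have "(f \<circ> (\<lambda>z. 1 / z)) holomorphic_on ball 0 1 - {0}"
  proof (rule holomorphic_on_compose_gen[OF _ holo])
    show "(\<lambda>z. 1 / z) holomorphic_on ball 0 1 - {0}" by (intro holomorphic_intros) auto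
    show "(\<lambda>z. 1 / z) ` (ball 0 1 - {0}) \<subseteq> outside_disc" using inv by blast
  qed
  moreover have "\<forall>\<^sub>F z in at 0. cmod ((f \<circ> (\<lambda>z. 1 / z)) z) \<le> B"
    unfolding eventually_at by (rule exI[of _ 1]) (use bnd[OF inv] in \<open>auto simp: dist_norm\<close>)
  ultimately obtain g where g: "g holomorphic_on ball 0 1" "\<And>z. z \<in> ball 0 1 - {0} \<Longrightarrow> g z = f (1 / z)"
    using holomorphic_on_extend_bounded[of "f \<circ> (\<lambda>z. 1 / z)" "ball 0 1" 0] by auto
  have gb: "cmod (g z) \<le> B" if z: "z \<in> ball 0 1 - {0}" for z using g(2)[OF z] bnd[OF inv[OF z]] by simp
  have "cmod (g 0) \<le> B"
  proof (rule tendsto_upperbound)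
    have "isCont g 0" using holomorphic_on_imp_continuous_on[OF g(1)] by (simp add: continuous_on_eq_continuous_at)
    then show "((\<lambda>z. cmod (g z)) \<longlongrightarrow> cmod (g 0)) (at 0)" by (intro tendsto_norm) (simp add: isCont_def)
    show "\<forall>\<^sub>F z in at 0. cmod (g z) \<le> B"
      unfolding eventually_at by (rule exI[of _ 1]) (use gb in \<open>auto simp: dist_norm\<close>)
  qed simp
  show ?thesis
  proof (rule that[OF g(1)])
    show "g (1 / q) = f q" if "q \<in> outside_disc" for q
    proof -
      have "1 / q \<in> ball 0 1 - {0}" using that norm_inverse_less_1[of q] by (auto simp: outside_disc_def)
      then show ?thesis using g(2) by simp
    qed
    show "cmod (g z) \<le> B" if "z \<in> ball 0 1" for z
      using gb[of z] \<open>cmod (g 0) \<le> B\<close> that by (cases "z = 0") auto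
  qed
qed

text \<open>Inversion preserves the aperture: for |p| = 1 the quantities |1/q - 1/p| and 1 - |1/q|
  are |q - p| and |q| - 1, both divided by |q|. It reverses angles, hence
  \<open>cis (- t)\<close>.\<close>

lemma inverse_maps_stolz:
  assumes "q \<in> stolz (cis t) M"
  shows "cmod (1 / q) < 1" "cmod (1 / q - cis (- t)) < M * (1 - cmod (1 / q))"
proof -
  have q: "1 < cmod q" "cmod (q - cis t) < M * (cmod q - 1)" using assms by (auto simp: stolz_def)
  then show "cmod (1 / q) < 1" by (intro norm_inverse_less_1)
  have "q \<noteq> 0" using q by auto
  have "1 / q - cis (- t) = - (cis (- t) * (q - cis t)) / q"
    using \<open>q \<noteq> 0\<close> by (simp add: field_simps cis_mult)
  then have "cmod (1 / q - cis (- t)) = cmod (q - cis t) / cmod q" by (simp add: norm_divide norm_mult)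
  also have "\<dots> < M * (cmod q - 1) / cmod q" using q by (intro divide_strict_right_mono) auto
  also have "\<dots> = M * (1 - cmod (1 / q))" using \<open>q \<noteq> 0\<close> by (simp add: norm_divide field_simps)
  finally show "cmod (1 / q - cis (- t)) < M * (1 - cmod (1 / q))" .
qed

lemma fatou_exterior:
  assumes holo: "f holomorphic_on outside_disc" and bnd: "\<And>q. q \<in> outside_disc \<Longrightarrow> cmod (f q) \<le> B"
  shows "\<exists>N. negligible N \<and> (\<forall>t. t \<notin> N \<longrightarrow> (\<exists>l. nt_limit f (cis t) l))"
proof -
  obtain g where g: "g holomorphic_on ball 0 1" "\<And>q. q \<in> outside_disc \<Longrightarrow> g (1 / q) = f q"
    "\<And>z. z \<in> ball 0 1 \<Longrightarrow> cmod (g z) \<le> B"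
    by (rule exterior_to_disc[OF holo bnd]) (assumption | rule that)+
  from fatou_disc[OF g(1,3)] obtain N where 1: "negligible N"
    "\<And>t. t \<notin> N \<Longrightarrow> \<exists>c. \<forall>M. (g \<longlongrightarrow> c) (at (cis t) within {z. cmod z < 1 \<and> cmod (z - cis t) < M * (1 - cmod z)})"
    by auto
  show ?thesis
  proof -
    have "\<exists>l. nt_limit f (cis t) l" if t: "t \<notin> (\<lambda>x. - 1 * x) ` N" for t
    proof -
      have "- t \<notin> N" using t by force
      then obtain c where c: "\<And>M. (g \<longlongrightarrow> c) (at (cis (- t)) within {z. cmod z < 1 \<and> cmod (z - cis (- t)) < M * (1 - cmod z)})"
        using 1(2) by blast
      have "nt_limit f (cis t) c"
        unfolding nt_limit_def
      proof (intro allI impI)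
        fix M :: real
        have lim: "((\<lambda>q. 1 / q) \<longlongrightarrow> 1 / cis t) (at (cis t) within stolz (cis t) M)"
          by (intro tendsto_intros) auto
        have ev: "\<forall>\<^sub>F q in at (cis t) within stolz (cis t) M. q \<in> stolz (cis t) M"
          by (simp add: eventually_at_filter)
        have "filterlim (\<lambda>q. 1 / q) (at (cis (- t)) within {z. cmod z < 1 \<and> cmod (z - cis (- t)) < M * (1 - cmod z)})
               (at (cis t) within stolz (cis t) M)"
          unfolding filterlim_at
        proof (intro conjI)
          show "((\<lambda>q. 1 / q) \<longlongrightarrow> cis (- t)) (at (cis t) within stolz (cis t) M)"
            using lim by (simp add: divide_inverse)
          show "\<forall>\<^sub>F q in at (cis t) within stolz (cis t) M.
              1 / q \<in> {z. cmod z < 1 \<and> cmod (z - cis (- t)) < M * (1 - cmod z)} \<and> 1 / q \<noteq> cis (- t)"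
            using ev
          proof eventually_elim
            case (elim q)
            then have "cmod (1 / q) < 1" by (rule inverse_maps_stolz)
            then have "1 / q \<noteq> cis (- t)" by (metis norm_cis less_irrefl)
            then show ?case using inverse_maps_stolz[OF elim] by simp
          qed
        qed
        from filterlim_compose[OF c this]
        have "((\<lambda>q. g (1 / q)) \<longlongrightarrow> c) (at (cis t) within stolz (cis t) M)" .
        moreover have "\<forall>\<^sub>F q in at (cis t) within stolz (cis t) M. g (1 / q) = f q"
          using ev by eventually_elim (auto simp: stolz_def outside_disc_def intro: g(2))
        ultimately show "(f \<longlongrightarrow> c) (at (cis t) within stolz (cis t) M)"
          by (rule Lim_transform_eventually)
      qed
      then show ?thesis by blast
    qed
    then show ?thesis using negligible_scaleR_image[OF 1(1), of "-1"] by blast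
  qed
qed

text \<open>On the ray through p one has |q - p| = |q| - 1, so it lies in every Stolz region of
  aperture above 1; aperture 2 is an arbitrary choice.\<close>

lemma nt_limit_radial:
  assumes "nt_limit f (cis t) l"
  shows "((\<lambda>r. f (1 / (of_real r * cis (- t)))) \<longlongrightarrow> l) (at_left 1)"
proof -
  have f: "(f \<longlongrightarrow> l) (at (cis t) within stolz (cis t) 2)" using assms by (simp add: nt_limit_def)
  have ev: "\<forall>\<^sub>F r in at_left (1::real). 0 < r \<and> r < 1"
    by (rule eventually_at_leftI[of 0]) auto
  have "((\<lambda>r. 1 / (complex_of_real r * cis (- t))) \<longlongrightarrow> 1 / (of_real 1 * cis (- t))) (at_left 1)"
    by (intro tendsto_intros) auto
  then have lim: "((\<lambda>r. 1 / (complex_of_real r * cis (- t))) \<longlongrightarrow> cis t) (at_left 1)"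
    by (simp add: divide_inverse)
  have "filterlim (\<lambda>r. 1 / (complex_of_real r * cis (- t))) (at (cis t) within stolz (cis t) 2) (at_left 1)"
    unfolding filterlim_at
  proof (intro conjI lim)
    show "\<forall>\<^sub>F r in at_left 1. 1 / (complex_of_real r * cis (- t)) \<in> stolz (cis t) 2 \<and> 1 / (complex_of_real r * cis (- t)) \<noteq> cis t"
      using ev
    proof eventually_elim
      case (elim r)
      have eq: "1 / (complex_of_real r * cis (- t)) = of_real (1 / r) * cis t"
        by (simp add: divide_inverse)
      have n: "1 < 1 / r" using elim by simp
      have "of_real (1 / r) * cis t - cis t = of_real (1 / r - 1) * cis t" by (simp add: algebra_simps)
      then have d: "cmod (of_real (1 / r) * cis t - cis t) = 1 / r - 1"
        using n by (simp add: norm_mult del: of_real_diff of_real_divide)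
      have "cmod (of_real (1 / r) * cis t) = 1 / r" using n elim by (simp add: norm_mult norm_divide)
      then show ?case unfolding eq stolz_def using n d by auto
    qed
  qed
  from filterlim_compose[OF f this] show ?thesis .
qed

text \<open>The modulus of exp (- h) is exp (- Re h). This function is bounded and its boundary
  limits have modulus at most 1 almost everywhere, so the modulus bound for radial limits gives Re h
  \<ge> 0 throughout.\<close>

lemma exterior_Re_nonneg:
  assumes holo: "h holomorphic_on outside_disc" and bnd: "\<And>q. q \<in> outside_disc \<Longrightarrow> cmod (h q) \<le> B"
    and N: "negligible N" and lim: "\<And>t. t \<notin> N \<Longrightarrow> \<exists>l. nt_limit h (cis t) l \<and> 0 \<le> Re l"
    and q: "q \<in> outside_disc"
  shows "0 \<le> Re (h q)"
proof -
  have e_bnd: "cmod (exp (- h q)) \<le> exp B" if "q \<in> outside_disc" for q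
    using bnd[OF that] abs_Re_le_cmod[of "h q"] by simp
  obtain g where g: "g holomorphic_on ball 0 1" "\<And>q. q \<in> outside_disc \<Longrightarrow> g (1 / q) = exp (- h q)"
    "\<And>z. z \<in> ball 0 1 \<Longrightarrow> cmod (g z) \<le> exp B"
    by (rule exterior_to_disc[of "\<lambda>q. exp (- h q)" "exp B"]) (use holo e_bnd in \<open>auto intro!: holomorphic_intros\<close>)
  have "cmod (g (1 / q)) \<le> 1"
  proof (rule disc_norm_le_of_radial_limits[OF g(1,3) negligible_scaleR_image[OF N, of "-1"]])
    fix t assume "t \<notin> (\<lambda>x. - 1 * x) ` N"
    then have "- t \<notin> N" by force
    then obtain l where l: "nt_limit h (cis (- t)) l" "0 \<le> Re l" using lim by blast
    have "((\<lambda>r. exp (- h (1 / (of_real r * cis t)))) \<longlongrightarrow> exp (- l)) (at_left 1)"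
      using nt_limit_radial[OF l(1)] by (intro tendsto_intros) simp
    moreover have "\<forall>\<^sub>F r in at_left 1. exp (- h (1 / (of_real r * cis t))) = g (of_real r * cis t)"
    proof (rule eventually_at_leftI[of 0])
      fix r :: real assume "r \<in> {0<..<1}"
      then have "1 / (of_real r * cis t) \<in> outside_disc"
        by (simp add: outside_disc_def norm_divide norm_mult)
      from g(2)[OF this] show "exp (- h (1 / (of_real r * cis t))) = g (of_real r * cis t)" by simp
    qed simp
    ultimately have "((\<lambda>r. g (of_real r * cis t)) \<longlongrightarrow> exp (- l)) (at_left 1)"
      by (rule Lim_transform_eventually)
    moreover have "cmod (exp (- l)) \<le> 1" using l(2) by simp
    ultimately show "\<exists>l. ((\<lambda>r. g (of_real r * cis t)) \<longlongrightarrow> l) (at_left 1) \<and> cmod l \<le> 1" by blast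
  qed (use q norm_inverse_less_1[of q] in \<open>auto simp: outside_disc_def\<close>)
  then show ?thesis using g(2)[OF q] by simp
qed

subsection \<open>Hermitian forms and the Schur complement\<close>

text \<open>The real part of the Hermitian inner product is a symmetric real bilinear form. The
  semidefiniteness conditions below only involve this form, so complex conjugates need not be
  tracked.\<close>

definition rip :: "complex vec \<Rightarrow> complex vec \<Rightarrow> real" where
  "rip u v = Re (u \<bullet>c v)"

lemma rip_sum:
  assumes "v \<in> carrier_vec n"
  shows "rip u v = (\<Sum>i<n. Re (vec_index u i * cnj (vec_index v i)))"
  using assms by (simp add: rip_def scalar_prod_def lessThan_atLeast0)

lemma rip_commute: "u \<in> carrier_vec n \<Longrightarrow> v \<in> carrier_vec n \<Longrightarrow> rip u v = rip v u"
  by (simp add: rip_sum mult.commute)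

lemma rip_add_left: "u \<in> carrier_vec n \<Longrightarrow> v \<in> carrier_vec n \<Longrightarrow> w \<in> carrier_vec n \<Longrightarrow> rip (u + v) w = rip u w + rip v w"
  by (simp add: rip_sum[of w n] distrib_right sum.distrib del: times_complex.sel)

lemma rip_diff_left: "u \<in> carrier_vec n \<Longrightarrow> v \<in> carrier_vec n \<Longrightarrow> w \<in> carrier_vec n \<Longrightarrow> rip (u - v) w = rip u w - rip v w"
  by (simp add: rip_sum[of w n] left_diff_distrib sum_subtractf del: times_complex.sel)

lemma rip_add_right: "u \<in> carrier_vec n \<Longrightarrow> v \<in> carrier_vec n \<Longrightarrow> w \<in> carrier_vec n \<Longrightarrow> rip w (u + v) = rip w u + rip w v"
  using rip_add_left[of u n v w] by (simp add: rip_commute[of _ n])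

lemma rip_diff_right: "u \<in> carrier_vec n \<Longrightarrow> v \<in> carrier_vec n \<Longrightarrow> w \<in> carrier_vec n \<Longrightarrow> rip w (u - v) = rip w u - rip w v"
  using rip_diff_left[of u n v w] by (simp add: rip_commute[of _ n])

lemma Re_complex_of_real_mult: "Re (complex_of_real c * z) = c * Re z"
  by simp

lemma rip_smult_left:
  "u \<in> carrier_vec n \<Longrightarrow> w \<in> carrier_vec n \<Longrightarrow> rip (complex_of_real c \<cdot>\<^sub>v u) w = c * rip u w"
  by (simp add: rip_sum[of w n] sum_distrib_left mult.assoc Re_complex_of_real_mult del: times_complex.sel)

lemma rip_smult_right:
  "u \<in> carrier_vec n \<Longrightarrow> w \<in> carrier_vec n \<Longrightarrow> rip w (complex_of_real c \<cdot>\<^sub>v u) = c * rip w u"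
  using rip_smult_left[of u n w c] by (simp add: rip_commute[of _ n])

lemma rip_self_sum:
  "v \<in> carrier_vec n \<Longrightarrow> rip v v = (\<Sum>i<n. (cmod (vec_index v i))\<^sup>2)"
  unfolding rip_sum by (intro sum.cong refl) (simp only: cmod_power2, simp add: power2_eq_square)

lemma rip_self_nonneg: "0 \<le> rip v v"
  using rip_self_sum[of v "dim_vec v"] by (simp add: sum_nonneg)

lemma norm_index_le_rip: "v \<in> carrier_vec n \<Longrightarrow> i < n \<Longrightarrow> (cmod (vec_index v i))\<^sup>2 \<le> rip v v"
  unfolding rip_self_sum by (rule member_le_sum) auto

lemma rip_self_eq_0: "v \<in> carrier_vec n \<Longrightarrow> rip v v \<le> 0 \<Longrightarrow> v = 0\<^sub>v n"
proof (rule eq_vecI)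
  assume v: "v \<in> carrier_vec n" "rip v v \<le> 0"
  show "dim_vec v = dim_vec (0\<^sub>v n)" using v by simp
  fix i assume "i < dim_vec (0\<^sub>v n :: complex vec)"
  then have i: "i < n" by simp
  from norm_index_le_rip[OF v(1) i] v(2) have "(cmod (vec_index v i))\<^sup>2 \<le> 0" by (rule order_trans)
  then show "vec_index v i = vec_index (0\<^sub>v n) i" using i by simp
qed

lemma rip_self_unit: "j < n \<Longrightarrow> rip (unit_vec n j) (unit_vec n j) = 1"
  by (subst rip_self_sum[of _ n]) (auto simp: if_distrib[of cmod] if_distrib[of "\<lambda>x. x\<^sup>2"] cong: if_cong)

text \<open>Expand the square of \<open>u - k v\<close> and divide by \<open>k\<close>. The free
  weight \<open>k\<close> is what later yields the bounds 2 / \<epsilon> for \<open>K\<close> and 1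
  / \<delta> for the inverse of \<open>Q + \<delta> I\<close>.\<close>

lemma rip_young:
  assumes "u \<in> carrier_vec n" "v \<in> carrier_vec n" "0 < k"
  shows "2 * rip u v \<le> rip u u / k + k * rip v v"
proof -
  have "0 \<le> rip (u - complex_of_real k \<cdot>\<^sub>v v) (u - complex_of_real k \<cdot>\<^sub>v v)" by (rule rip_self_nonneg)
  also have "\<dots> = rip u u - 2 * k * rip u v + k * k * rip v v"
    using assms by (simp add: rip_diff_left[of _ n] rip_diff_right[of _ n] rip_smult_left[of _ n]
        rip_smult_right[of _ n] rip_commute[of v n u] algebra_simps)
  finally have "2 * rip u v \<le> (rip u u + k * k * rip v v) / k"
    using assms by (simp add: pos_le_divide_eq algebra_simps)
  then show ?thesis using assms by (simp add: add_divide_distrib)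
qed

section \<open>Adjoints and quadratic forms\<close>

lemma square_mult_mat_vec_carrier [simp]:
  "A \<in> carrier_mat n n \<Longrightarrow> v \<in> carrier_vec n \<Longrightarrow> A *\<^sub>v v \<in> carrier_vec n"
  by simp

lemma square_mult_mat_carrier [simp]:
  "A \<in> carrier_mat n n \<Longrightarrow> B \<in> carrier_mat n n \<Longrightarrow> A * B \<in> carrier_mat n n"
  by simp

lemma dim_mat_adjoint [simp]: "dim_row (mat_adjoint A) = dim_col A" "dim_col (mat_adjoint A) = dim_row A"
  by (auto simp: mat_adjoint_def mat_of_rows_def)

lemma index_mat_adjoint [simp]:
  fixes A :: "complex mat"
  shows "i < dim_col A \<Longrightarrow> j < dim_row A \<Longrightarrow> mat_adjoint A $$ (i,j) = cnj (A $$ (j,i))"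
  by (auto simp: mat_adjoint_def mat_of_rows_def)

lemma mat_adjoint_carrier [simp]: "A \<in> carrier_mat nr nc \<Longrightarrow> mat_adjoint A \<in> carrier_mat nc nr"
  by (auto simp: mat_adjoint_def mat_of_rows_def)

lemma mat_adjoint_adjoint: "A \<in> carrier_mat nr nc \<Longrightarrow> mat_adjoint (mat_adjoint A) = A"
  for A :: "complex mat"
  by (rule eq_matI) auto

lemma mult_mat_vec_index_sum:
  "A \<in> carrier_mat nr nc \<Longrightarrow> v \<in> carrier_vec nc \<Longrightarrow> i < nr \<Longrightarrow>
     vec_index (A *\<^sub>v v) i = (\<Sum>j<nc. A $$ (i,j) * vec_index v j)"
  by (simp add: scalar_prod_def lessThan_atLeast0)

lemma cscalar_adjoint:
  fixes A :: "complex mat" and v w :: "complex vec"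
  assumes A: "A \<in> carrier_mat nr nc" and v: "v \<in> carrier_vec nc" and w: "w \<in> carrier_vec nr"
  shows "(A *\<^sub>v v) \<bullet>c w = v \<bullet>c (mat_adjoint A *\<^sub>v w)"
proof -
  have "(A *\<^sub>v v) \<bullet>c w = (\<Sum>i<nr. (\<Sum>j<nc. A $$ (i,j) * vec_index v j) * cnj (vec_index w i))"
    using w by (simp add: scalar_prod_def lessThan_atLeast0 mult_mat_vec_index_sum[OF A v, unfolded lessThan_atLeast0] del: index_mult_mat_vec)
  also have "\<dots> = (\<Sum>j<nc. \<Sum>i<nr. A $$ (i,j) * vec_index v j * cnj (vec_index w i))"
    unfolding sum_distrib_right by (rule sum.swap)
  also have "\<dots> = (\<Sum>j<nc. vec_index v j * cnj (vec_index (mat_adjoint A *\<^sub>v w) j))"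
    using A w by (intro sum.cong refl)
      (simp add: mult_mat_vec_index_sum[OF mat_adjoint_carrier[OF A] w] sum_distrib_left mult_ac del: index_mult_mat_vec)
  also have "\<dots> = v \<bullet>c (mat_adjoint A *\<^sub>v w)"
    using A by (simp add: scalar_prod_def lessThan_atLeast0 del: index_mult_mat_vec)
  finally show ?thesis .
qed

lemma rip_adjoint:
  assumes "A \<in> carrier_mat nr nc" "v \<in> carrier_vec nc" "w \<in> carrier_vec nr"
  shows "rip (A *\<^sub>v v) w = rip v (mat_adjoint A *\<^sub>v w)"
  using cscalar_adjoint[OF assms] by (simp add: rip_def)

lemma rip_adjoint':
  assumes "A \<in> carrier_mat nr nc" "v \<in> carrier_vec nc" "w \<in> carrier_vec nr"
  shows "rip (mat_adjoint A *\<^sub>v w) v = rip w (A *\<^sub>v v)"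
  using rip_adjoint[OF assms] assms mult_mat_vec_carrier[OF assms(1,2)]
    mult_mat_vec_carrier[OF mat_adjoint_carrier[OF assms(1)] assms(3)]
  by (metis rip_commute)

lemma smult_mat_mult_vec:
  "A \<in> carrier_mat nr nc \<Longrightarrow> v \<in> carrier_vec nc \<Longrightarrow> (c \<cdot>\<^sub>m A) *\<^sub>v v = (c :: complex) \<cdot>\<^sub>v (A *\<^sub>v v)"
  by (rule eq_vecI) auto

lemma mat_adjoint_add:
  "A \<in> carrier_mat nr nc \<Longrightarrow> B \<in> carrier_mat nr nc \<Longrightarrow> mat_adjoint (A + B) = mat_adjoint A + mat_adjoint B"
  for A :: "complex mat"
  by (rule eq_matI) auto

lemma mat_adjoint_smult:
  "A \<in> carrier_mat nr nc \<Longrightarrow> mat_adjoint (c \<cdot>\<^sub>m A) = cnj c \<cdot>\<^sub>m mat_adjoint A"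
  for A :: "complex mat"
  by (rule eq_matI) auto

lemma mat_adjoint_diff:
  "A \<in> carrier_mat nr nc \<Longrightarrow> B \<in> carrier_mat nr nc \<Longrightarrow> mat_adjoint (A - B) = mat_adjoint A - mat_adjoint B"
  for A :: "complex mat"
  by (rule eq_matI) auto

lemma mat_adjoint_mult:
  fixes A B :: "complex mat"
  assumes "A \<in> carrier_mat nr n" "B \<in> carrier_mat n nc"
  shows "mat_adjoint (A * B) = mat_adjoint B * mat_adjoint A"
  using assms by (intro eq_matI) (auto simp: scalar_prod_def mult.commute)

text \<open>A matrix plus its adjoint is automatically Hermitian, and both summands have the same
  real quadratic form.\<close>

lemma psd_herm_sum:
  assumes A: "A \<in> carrier_mat n n"
  shows "psd (A + mat_adjoint A) \<longleftrightarrow> (\<forall>v\<in>carrier_vec n. 0 \<le> rip (A *\<^sub>v v) v)"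
proof -
  have c: "mat_adjoint A \<in> carrier_mat n n" using A by simp
  have herm: "mat_adjoint (A + mat_adjoint A) = A + mat_adjoint A"
    using A c by (simp add: mat_adjoint_add[of _ n n] mat_adjoint_adjoint[of _ n n] comm_add_mat[of _ n n])
  have "Re (((A + mat_adjoint A) *\<^sub>v v) \<bullet>c v) = 2 * rip (A *\<^sub>v v) v" if v: "v \<in> carrier_vec n" for v
  proof -
    have "rip ((A + mat_adjoint A) *\<^sub>v v) v = rip (A *\<^sub>v v) v + rip (mat_adjoint A *\<^sub>v v) v"
      using v A c by (simp add: add_mult_distrib_mat_vec[of _ n n] rip_add_left[of _ n])
    also have "rip (mat_adjoint A *\<^sub>v v) v = rip (A *\<^sub>v v) v"
      using rip_adjoint'[OF A v v] v A by (simp add: rip_commute[of v n])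
    finally show ?thesis by (simp add: rip_def)
  qed
  then show ?thesis using A c herm unfolding psd_def by auto
qed

lemma psd_osp:
  assumes K: "K \<in> carrier_mat n n"
  shows "psd (mat_adjoint K + K - complex_of_real \<epsilon> \<cdot>\<^sub>m (mat_adjoint K * K)) \<longleftrightarrow>
    (\<forall>v\<in>carrier_vec n. \<epsilon> * rip (K *\<^sub>v v) (K *\<^sub>v v) \<le> 2 * rip (K *\<^sub>v v) v)"
proof -
  have c: "mat_adjoint K \<in> carrier_mat n n" using K by simp
  define X where "X = mat_adjoint K + K - complex_of_real \<epsilon> \<cdot>\<^sub>m (mat_adjoint K * K)"
  have X: "X \<in> carrier_mat n n" using K c by (auto simp: X_def)
  have herm: "mat_adjoint X = X"
    unfolding X_def using K c
    by (simp add: mat_adjoint_diff[of _ n n] mat_adjoint_add[of _ n n] mat_adjoint_smult[of _ n n]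
        mat_adjoint_mult[of _ n n _ n] mat_adjoint_adjoint[of _ n n] comm_add_mat[of _ n n])
  have "Re ((X *\<^sub>v v) \<bullet>c v) = 2 * rip (K *\<^sub>v v) v - \<epsilon> * rip (K *\<^sub>v v) (K *\<^sub>v v)" if v: "v \<in> carrier_vec n" for v
  proof -
    have "X *\<^sub>v v = (mat_adjoint K *\<^sub>v v + K *\<^sub>v v) - complex_of_real \<epsilon> \<cdot>\<^sub>v (mat_adjoint K *\<^sub>v (K *\<^sub>v v))"
      unfolding X_def using v K c
      by (subst minus_mult_distrib_mat_vec[of _ n n]) (auto simp: add_mult_distrib_mat_vec[of _ n n] smult_mat_mult_vec[of _ n n] assoc_mult_mat_vec[of _ n n _ n])
    then have "rip (X *\<^sub>v v) v = rip (mat_adjoint K *\<^sub>v v) v + rip (K *\<^sub>v v) v - \<epsilon> * rip (mat_adjoint K *\<^sub>v (K *\<^sub>v v)) v"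
      using v K c by (simp add: rip_diff_left[of _ n] rip_add_left[of _ n] rip_smult_left[of _ n])
    also have "rip (mat_adjoint K *\<^sub>v v) v = rip (K *\<^sub>v v) v"
      using rip_adjoint'[OF K v v] v K by (simp add: rip_commute[of v n])
    also have "rip (mat_adjoint K *\<^sub>v (K *\<^sub>v v)) v = rip (K *\<^sub>v v) (K *\<^sub>v v)"
      using rip_adjoint'[OF K v, of "K *\<^sub>v v"] v K by simp
    finally show ?thesis by (simp add: rip_def)
  qed
  then show ?thesis using X herm unfolding psd_def X_def[symmetric] by auto
qed

text \<open>The last claim, Cramer's rule, is what makes the inverse of an analytic or meromorphic
  matrix function analytic or meromorphic.\<close>

lemma mat_inv_det:
  assumes A: "A \<in> carrier_mat n n" and "Determinant.det A \<noteq> 0"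
  shows "mat_inv A \<in> carrier_mat n n" "A * mat_inv A = 1\<^sub>m n" "mat_inv A * A = 1\<^sub>m n"
    "mat_inv A = (1 / Determinant.det A) \<cdot>\<^sub>m adj_mat A"
proof -
  have "A \<in> Units (ring_mat TYPE(complex) n ())" using det_non_zero_imp_unit[OF assms] .
  then obtain B where "mat_inverse A = Some B" using mat_inverse(1)[OF A, where b = "()"] by (cases "mat_inverse A") auto
  with mat_inverse(2)[OF A this] show I: "mat_inv A \<in> carrier_mat n n" "A * mat_inv A = 1\<^sub>m n" "mat_inv A * A = 1\<^sub>m n"
    by (auto simp: mat_inv_def)
  define C where "C = (1 / Determinant.det A) \<cdot>\<^sub>m adj_mat A"
  have C: "C \<in> carrier_mat n n" using adj_mat(1)[OF A] by (simp add: C_def)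
  have AC: "A * C = 1\<^sub>m n"
    unfolding C_def using assms adj_mat[OF A]
    by (simp add: mult_smult_distrib[of _ n n _ n]) (rule eq_matI, auto)
  have "mat_inv A = mat_inv A * (A * C)" using AC I by simp
  also have "\<dots> = C" using I C A by (simp flip: assoc_mult_mat[of _ n n _ n _ n])
  finally show "mat_inv A = (1 / Determinant.det A) \<cdot>\<^sub>m adj_mat A" by (simp add: C_def)
qed

lemma mat_inv_vec:
  assumes A: "A \<in> carrier_mat n n" and "Determinant.det A \<noteq> 0" and v: "v \<in> carrier_vec n"
  shows "mat_inv A *\<^sub>v v \<in> carrier_vec n" "A *\<^sub>v (mat_inv A *\<^sub>v v) = v" "mat_inv A *\<^sub>v (A *\<^sub>v v) = v"
  using mat_inv_det[OF assms(1,2)] v A by (auto simp flip: assoc_mult_mat_vec[of _ n n _ n])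

lemma det_nonzeroI:
  fixes A :: "complex mat"
  assumes "A \<in> carrier_mat n n" "\<And>v. v \<in> carrier_vec n \<Longrightarrow> A *\<^sub>v v = 0\<^sub>v n \<Longrightarrow> v = 0\<^sub>v n"
  shows "Determinant.det A \<noteq> 0"
  using det_0_iff_vec_prod_zero_field[OF assms(1)] assms(2) by blast

text \<open>In the inner product \<open>[x,y] = \<langle>R x, y\<rangle>\<close> the hypothesis says that \<open>T = I - Q R\<close> is a contraction,
  and the conclusion that its adjoint \<open>I - Q\<^sup>H R\<close> is one; expand \<open>[x - T T\<^sup>* x, x - T T\<^sup>* x] \<ge> 0\<close>.\<close>

lemma adjoint_contraction:
  assumes Q: "Q \<in> carrier_mat n n" and R: "R \<in> carrier_mat n n" and S: "S \<in> carrier_mat n n"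
    and RS: "\<And>v. v \<in> carrier_vec n \<Longrightarrow> R *\<^sub>v (S *\<^sub>v v) = v"
    and sym: "\<And>x y. x \<in> carrier_vec n \<Longrightarrow> y \<in> carrier_vec n \<Longrightarrow> rip (R *\<^sub>v x) y = rip x (R *\<^sub>v y)"
    and pos: "\<And>x. x \<in> carrier_vec n \<Longrightarrow> 0 \<le> rip (R *\<^sub>v x) x"
    and H: "\<And>v. v \<in> carrier_vec n \<Longrightarrow> rip (R *\<^sub>v (Q *\<^sub>v v)) (Q *\<^sub>v v) \<le> 2 * rip (Q *\<^sub>v v) v"
    and v: "v \<in> carrier_vec n"
  shows "rip (R *\<^sub>v (mat_adjoint Q *\<^sub>v v)) (mat_adjoint Q *\<^sub>v v) \<le> 2 * rip (mat_adjoint Q *\<^sub>v v) v"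
proof -
  have c: "A *\<^sub>v x \<in> carrier_vec n" if "A \<in> carrier_mat n n" "x \<in> carrier_vec n" for A and x :: "complex vec"
    using that by simp
  \<comment> \<open>With \<open>T = I - Q R\<close> as above: \<open>R x = v\<close>, the vector
    \<open>y\<close> is the adjoint of \<open>T\<close> applied to \<open>x\<close>, and
    \<open>z = T y\<close>.\<close>
  define x where "x = S *\<^sub>v v"
  define a where "a = mat_adjoint Q *\<^sub>v v"
  define y where "y = x - a"
  define b where "b = Q *\<^sub>v (R *\<^sub>v y)"
  define z where "z = y - b"
  have cs: "x \<in> carrier_vec n" "a \<in> carrier_vec n" "y \<in> carrier_vec n" "b \<in> carrier_vec n" "z \<in> carrier_vec n"
    "R *\<^sub>v x \<in> carrier_vec n" "R *\<^sub>v a \<in> carrier_vec n" "R *\<^sub>v y \<in> carrier_vec n" "R *\<^sub>v b \<in> carrier_vec n" "R *\<^sub>v z \<in> carrier_vec n"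
    using Q R S v by (auto simp: x_def a_def y_def b_def z_def)
  have Rx: "R *\<^sub>v x = v" using RS[OF v] by (simp add: x_def)
  note bil = rip_diff_left[of _ n] rip_diff_right[of _ n] mult_minus_distrib_mat_vec[OF R]
  have zz: "rip (R *\<^sub>v z) z = rip (R *\<^sub>v y) y - 2 * rip b (R *\<^sub>v y) + rip (R *\<^sub>v b) b"
    using cs sym[of b y] rip_commute[of "R *\<^sub>v y" n b] by (simp add: z_def bil)
  have "rip (R *\<^sub>v b) b \<le> 2 * rip b (R *\<^sub>v y)" using H[of "R *\<^sub>v y"] cs by (simp add: b_def)
  then have zy: "rip (R *\<^sub>v z) z \<le> rip (R *\<^sub>v y) y" using zz by simp
  have bv: "rip b v = rip (R *\<^sub>v y) a" using rip_adjoint[OF Q cs(8) v] by (simp add: b_def a_def)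
  \<comment> \<open>Adjointness in [.,.]: pairing \<open>T y\<close> with \<open>x\<close> is the
    same as pairing \<open>y\<close> with itself.\<close>
  have zx: "rip (R *\<^sub>v z) x = rip (R *\<^sub>v y) y"
  proof -
    have "rip (R *\<^sub>v z) x = rip z v" using sym[of z x] cs Rx by simp
    also have "\<dots> = rip y v - rip b v" using cs v by (simp add: z_def bil)
    also have "rip y v = rip (R *\<^sub>v y) x" using sym[of y x] cs Rx by simp
    also have "rip (R *\<^sub>v y) x - rip b v = rip (R *\<^sub>v y) (x - a)" using bv cs by (simp add: bil)
    finally show ?thesis by (simp add: y_def)
  qed
  have "0 \<le> rip (R *\<^sub>v (x - z)) (x - z)" using cs by (intro pos) auto
  also have "\<dots> = rip (R *\<^sub>v x) x - 2 * rip (R *\<^sub>v z) x + rip (R *\<^sub>v z) z"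
    using cs sym[of x z] rip_commute[of x n "R *\<^sub>v z"] by (simp add: bil)
  finally have "rip (R *\<^sub>v y) y \<le> rip (R *\<^sub>v x) x" using zx zy by simp
  moreover have "rip (R *\<^sub>v y) y = rip (R *\<^sub>v x) x - 2 * rip a v + rip (R *\<^sub>v a) a"
    using cs sym[of a x] rip_commute[of "R *\<^sub>v x" n a] Rx by (simp add: y_def bil)
  ultimately show ?thesis by (simp add: a_def)
qed

lemma youla_block_iff:
  assumes P: "P \<in> carrier_mat n n" and Q: "Q \<in> carrier_mat n n" and F: "F \<in> carrier_mat n n"
    and Ppos: "\<And>v. v \<in> carrier_vec n \<Longrightarrow> 0 \<le> rip (P *\<^sub>v v) v" and \<epsilon>: "0 < \<epsilon>"
    and inv: "mat_inv (P + mat_adjoint P + complex_of_real \<epsilon> \<cdot>\<^sub>m 1\<^sub>m n) = F + mat_adjoint F"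
  shows "(\<forall>v1\<in>carrier_vec n. \<forall>v2\<in>carrier_vec n. 0 \<le> rip (Q *\<^sub>v v1) v1 + rip (Q *\<^sub>v v2) v1 + rip (F *\<^sub>v v2) v2)
    \<longleftrightarrow> (\<forall>v\<in>carrier_vec n. 2 * rip (P *\<^sub>v (Q *\<^sub>v v)) (Q *\<^sub>v v) + \<epsilon> * rip (Q *\<^sub>v v) (Q *\<^sub>v v) \<le> 2 * rip (Q *\<^sub>v v) v)"
proof -
  define R where "R = P + mat_adjoint P + complex_of_real \<epsilon> \<cdot>\<^sub>m 1\<^sub>m n"
  define S where "S = F + mat_adjoint F"
  have Pa: "mat_adjoint P \<in> carrier_mat n n" and Fa: "mat_adjoint F \<in> carrier_mat n n" and Qa: "mat_adjoint Q \<in> carrier_mat n n"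
    using P F Q by auto
  have R: "R \<in> carrier_mat n n" and S: "S \<in> carrier_mat n n" using P Pa F Fa by (auto simp: R_def S_def)
  have Rv: "R *\<^sub>v x = P *\<^sub>v x + mat_adjoint P *\<^sub>v x + complex_of_real \<epsilon> \<cdot>\<^sub>v x" if x: "x \<in> carrier_vec n" for x
    unfolding R_def using x P Pa
    by (subst add_mult_distrib_mat_vec[of _ n n]) (auto simp: add_mult_distrib_mat_vec[of _ n n] smult_mat_mult_vec[of _ n n])
  have Rip: "rip (R *\<^sub>v x) y = rip (P *\<^sub>v x) y + rip x (P *\<^sub>v y) + \<epsilon> * rip x y"
    if x: "x \<in> carrier_vec n" and y: "y \<in> carrier_vec n" for x y
    using Rv[OF x] rip_adjoint'[OF P y x] x y P Pa
    by (simp add: rip_add_left[of _ n] rip_smult_left[of _ n])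
  have sym: "rip (R *\<^sub>v x) y = rip x (R *\<^sub>v y)" if x: "x \<in> carrier_vec n" and y: "y \<in> carrier_vec n" for x y
    using Rip[OF x y] Rip[OF y x] x y P R
      rip_commute[of x n "R *\<^sub>v y"] rip_commute[of x n y] rip_commute[of x n "P *\<^sub>v y"] rip_commute[of y n "P *\<^sub>v x"] by simp
  have Rself: "rip (R *\<^sub>v x) x = 2 * rip (P *\<^sub>v x) x + \<epsilon> * rip x x" if x: "x \<in> carrier_vec n" for x
    using Rip[OF x x] rip_commute[of x n "P *\<^sub>v x"] x P by simp
  have pos: "0 \<le> rip (R *\<^sub>v x) x" if x: "x \<in> carrier_vec n" for x
    using Rself[OF x] Ppos[OF x] rip_self_nonneg[of x] \<epsilon> by simp
  \<comment> \<open>Positivity of \<open>P\<close> gives \<open>R \<ge> \<epsilon> I\<close>, so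
    that \<open>mat_inv R\<close> is a genuine inverse and not an unspecified value.\<close>
  have det: "Determinant.det R \<noteq> 0"
  proof (rule det_nonzeroI[OF R])
    fix v assume v: "v \<in> carrier_vec n" and "R *\<^sub>v v = 0\<^sub>v n"
    then have "2 * rip (P *\<^sub>v v) v + \<epsilon> * rip v v = 0"
      using Rself[OF v] by (simp add: rip_def)
    then have "\<epsilon> * rip v v \<le> 0" using Ppos[OF v] by linarith
    then have "rip v v \<le> 0" using \<epsilon> by (simp add: mult_le_0_iff)
    then show "v = 0\<^sub>v n" by (rule rip_self_eq_0[OF v])
  qed
  have "S = mat_inv R" using inv by (simp add: S_def R_def)
  then have RS: "R *\<^sub>v (S *\<^sub>v v) = v" and SR: "S *\<^sub>v (R *\<^sub>v v) = v" if "v \<in> carrier_vec n" for v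
    using mat_inv_vec[OF R det that] by auto
  have Sself: "rip (S *\<^sub>v v) v = 2 * rip (F *\<^sub>v v) v" if v: "v \<in> carrier_vec n" for v
  proof -
    have "rip (S *\<^sub>v v) v = rip (F *\<^sub>v v) v + rip (mat_adjoint F *\<^sub>v v) v"
      unfolding S_def using v F Fa by (simp add: add_mult_distrib_mat_vec[of _ n n] rip_add_left[of _ n])
    then show ?thesis using rip_adjoint'[OF F v v] rip_commute[of v n "F *\<^sub>v v"] v F by simp
  qed
  have two: "(\<forall>v\<in>carrier_vec n. 2 * rip (P *\<^sub>v (Q *\<^sub>v v)) (Q *\<^sub>v v) + \<epsilon> * rip (Q *\<^sub>v v) (Q *\<^sub>v v) \<le> 2 * rip (Q *\<^sub>v v) v)
     \<longleftrightarrow> (\<forall>v\<in>carrier_vec n. rip (R *\<^sub>v (Q *\<^sub>v v)) (Q *\<^sub>v v) \<le> 2 * rip (Q *\<^sub>v v) v)"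
    using Rself Q by simp
  also have "\<dots> \<longleftrightarrow> (\<forall>v\<in>carrier_vec n. rip (R *\<^sub>v (mat_adjoint Q *\<^sub>v v)) (mat_adjoint Q *\<^sub>v v) \<le> 2 * rip (mat_adjoint Q *\<^sub>v v) v)"
    (is "?H \<longleftrightarrow> ?H'")
  proof
    assume ?H then show ?H' using adjoint_contraction[OF Q R S RS sym pos] by blast
  next
    assume ?H'
    then show ?H using adjoint_contraction[OF Qa R S RS sym pos] unfolding mat_adjoint_adjoint[OF Q] by blast
  qed
  also have "\<dots> \<longleftrightarrow> (\<forall>v1\<in>carrier_vec n. \<forall>v2\<in>carrier_vec n. 0 \<le> rip (Q *\<^sub>v v1) v1 + rip (Q *\<^sub>v v2) v1 + rip (F *\<^sub>v v2) v2)"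
  proof (intro iffI ballI)
    fix v1 v2 :: "complex vec" assume H': ?H' and v1: "v1 \<in> carrier_vec n" and v2: "v2 \<in> carrier_vec n"
    define a where "a = mat_adjoint Q *\<^sub>v v1"
    define x where "x = S *\<^sub>v v2"
    have cs: "a \<in> carrier_vec n" "x \<in> carrier_vec n" "R *\<^sub>v a \<in> carrier_vec n" "R *\<^sub>v x \<in> carrier_vec n"
      using Qa S R v1 v2 by (auto simp: a_def x_def)
    have Rx: "R *\<^sub>v x = v2" using RS[OF v2] by (simp add: x_def)
    \<comment> \<open>Completing the square: with \<open>a = Q^H v1\<close> and
      \<open>R x = v2\<close>, the cross term \<open>rip (Q v2) v1\<close> of the block form is
      [a, x].\<close>
    have "0 \<le> rip (R *\<^sub>v (a + x)) (a + x)" using cs by (intro pos) auto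
    also have "\<dots> = rip (R *\<^sub>v a) a + 2 * rip v2 a + rip v2 x"
      using cs sym[of a x] rip_commute[of a n v2] Rx v2
      by (simp add: mult_add_distrib_mat_vec[OF R] rip_add_left[of _ n] rip_add_right[of _ n])
    also have "rip (R *\<^sub>v a) a \<le> 2 * rip a v1" using H' v1 by (simp add: a_def)
    finally have "0 \<le> 2 * rip a v1 + 2 * rip v2 a + rip v2 x" by simp
    moreover have "rip a v1 = rip (Q *\<^sub>v v1) v1" "rip v2 a = rip (Q *\<^sub>v v2) v1"
      using rip_adjoint[OF Q v1 v1] rip_adjoint[OF Q v2 v1] rip_commute[OF v1 cs(1)] by (simp_all add: a_def)
    moreover have "rip v2 x = 2 * rip (F *\<^sub>v v2) v2" using Sself[OF v2] rip_commute[OF v2 cs(2)] by (simp add: x_def)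
    ultimately show "0 \<le> rip (Q *\<^sub>v v1) v1 + rip (Q *\<^sub>v v2) v1 + rip (F *\<^sub>v v2) v2" by simp
  next
    fix v :: "complex vec"
    assume B: "\<forall>v1\<in>carrier_vec n. \<forall>v2\<in>carrier_vec n. 0 \<le> rip (Q *\<^sub>v v1) v1 + rip (Q *\<^sub>v v2) v1 + rip (F *\<^sub>v v2) v2"
      and v: "v \<in> carrier_vec n"
    define a where "a = mat_adjoint Q *\<^sub>v v"
    have cs: "a \<in> carrier_vec n" "R *\<^sub>v a \<in> carrier_vec n" using Qa R v by (auto simp: a_def)
    \<comment> \<open>The minimiser of the block form over its second argument when the first is
      \<open>v\<close>. It corresponds to \<open>x = - a\<close>, where the square completed above
      vanishes.\<close>
    define w where "w = complex_of_real (-1) \<cdot>\<^sub>v (R *\<^sub>v a)"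
    have w: "w \<in> carrier_vec n" using cs by (simp add: w_def)
    have "S *\<^sub>v w = complex_of_real (-1) \<cdot>\<^sub>v a"
      unfolding w_def using SR[OF cs(1)] cs by (simp only: mult_mat_vec[OF S cs(2)])
    then have "rip (S *\<^sub>v w) w = rip (R *\<^sub>v a) a"
      using cs rip_commute[OF cs] unfolding w_def
      by (simp only: rip_smult_left[of _ n] rip_smult_right[of _ n] smult_carrier_vec)
    then have "2 * rip (F *\<^sub>v w) w = rip (R *\<^sub>v a) a" using Sself[OF w] by simp
    moreover have "rip (Q *\<^sub>v w) v = - rip (R *\<^sub>v a) a"
      using rip_adjoint[OF Q w v] cs unfolding a_def[symmetric] by (simp add: w_def rip_smult_left[of _ n] del: of_real_minus of_real_1)
    moreover have "rip (Q *\<^sub>v v) v = rip a v"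
      using rip_adjoint[OF Q v v] rip_commute[OF v cs(1)] by (simp add: a_def)
    moreover have "0 \<le> rip (Q *\<^sub>v v) v + rip (Q *\<^sub>v w) v + rip (F *\<^sub>v w) w" using B v w by blast
    ultimately show "rip (R *\<^sub>v (mat_adjoint Q *\<^sub>v v)) (mat_adjoint Q *\<^sub>v v) \<le> 2 * rip (mat_adjoint Q *\<^sub>v v) v"
      unfolding a_def[symmetric] by linarith
  qed
  finally show ?thesis by blast
qed

subsection \<open>Entrywise limits and boundary values of matrix functions\<close>

text \<open>Here and in \<open>mat_tendsto\<close> the dimension is demanded only eventually,
  because the functions concerned are known to have size \<open>n\<close> on
  \<open>outside_disc\<close> or \<open>right_half_plane\<close> but perhaps not elsewhere.\<close>

definition vec_tendsto :: "nat \<Rightarrow> ('a \<Rightarrow> complex vec) \<Rightarrow> complex vec \<Rightarrow> 'a filter \<Rightarrow> bool" where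
  "vec_tendsto n u l F \<longleftrightarrow> l \<in> carrier_vec n \<and> (\<forall>\<^sub>F q in F. u q \<in> carrier_vec n) \<and>
     (\<forall>i<n. ((\<lambda>q. vec_index (u q) i) \<longlongrightarrow> vec_index l i) F)"

definition mat_tendsto :: "nat \<Rightarrow> ('a \<Rightarrow> complex mat) \<Rightarrow> complex mat \<Rightarrow> 'a filter \<Rightarrow> bool" where
  "mat_tendsto n A L F \<longleftrightarrow> L \<in> carrier_mat n n \<and> (\<forall>\<^sub>F q in F. A q \<in> carrier_mat n n) \<and>
     (\<forall>i<n. \<forall>j<n. ((\<lambda>q. A q $$ (i,j)) \<longlongrightarrow> L $$ (i,j)) F)"

lemma vec_tendsto_const: "v \<in> carrier_vec n \<Longrightarrow> vec_tendsto n (\<lambda>_. v) v F"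
  by (simp add: vec_tendsto_def)

lemma mat_tendsto_const: "A \<in> carrier_mat n n \<Longrightarrow> mat_tendsto n (\<lambda>_. A) A F"
  by (simp add: mat_tendsto_def)

lemma vec_tendsto_mult:
  assumes A: "mat_tendsto n A L F" and u: "vec_tendsto n u l F"
  shows "vec_tendsto n (\<lambda>q. A q *\<^sub>v u q) (L *\<^sub>v l) F"
  unfolding vec_tendsto_def
proof (intro conjI allI impI)
  have ev: "\<forall>\<^sub>F q in F. A q \<in> carrier_mat n n \<and> u q \<in> carrier_vec n"
    using A u unfolding mat_tendsto_def vec_tendsto_def by (auto intro: eventually_conj)
  have c: "L \<in> carrier_mat n n" "l \<in> carrier_vec n" using A u by (auto simp: mat_tendsto_def vec_tendsto_def)
  show "L *\<^sub>v l \<in> carrier_vec n" using c by simp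
  show "\<forall>\<^sub>F q in F. A q *\<^sub>v u q \<in> carrier_vec n" using ev by eventually_elim simp
  fix i assume i: "i < n"
  have "((\<lambda>q. \<Sum>j<n. A q $$ (i,j) * vec_index (u q) j) \<longlongrightarrow> (\<Sum>j<n. L $$ (i,j) * vec_index l j)) F"
    using A u i by (intro tendsto_sum tendsto_mult) (auto simp: mat_tendsto_def vec_tendsto_def)
  moreover have "\<forall>\<^sub>F q in F. (\<Sum>j<n. A q $$ (i,j) * vec_index (u q) j) = vec_index (A q *\<^sub>v u q) i"
    using ev by eventually_elim (rule mult_mat_vec_index_sum[symmetric], use i in auto)
  ultimately show "((\<lambda>q. vec_index (A q *\<^sub>v u q) i) \<longlongrightarrow> vec_index (L *\<^sub>v l) i) F"
    unfolding mult_mat_vec_index_sum[OF c i] by (rule Lim_transform_eventually)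
qed

lemma tendsto_rip:
  assumes u: "vec_tendsto n u l F" and w: "vec_tendsto n w k F"
  shows "((\<lambda>q. rip (u q) (w q)) \<longlongrightarrow> rip l k) F"
proof -
  have "((\<lambda>q. \<Sum>i<n. Re (vec_index (u q) i * cnj (vec_index (w q) i))) \<longlongrightarrow> (\<Sum>i<n. Re (vec_index l i * cnj (vec_index k i)))) F"
    using u w by (intro tendsto_sum tendsto_Re tendsto_mult tendsto_cnj) (auto simp: vec_tendsto_def)
  moreover have "\<forall>\<^sub>F q in F. (\<Sum>i<n. Re (vec_index (u q) i * cnj (vec_index (w q) i))) = rip (u q) (w q)"
  proof -
    have "\<forall>\<^sub>F q in F. w q \<in> carrier_vec n" using w by (simp add: vec_tendsto_def)
    then show ?thesis by eventually_elim (simp only: rip_sum)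
  qed
  ultimately have "((\<lambda>q. rip (u q) (w q)) \<longlongrightarrow> (\<Sum>i<n. Re (vec_index l i * cnj (vec_index k i)))) F"
    by (rule Lim_transform_eventually)
  moreover have "rip l k = (\<Sum>i<n. Re (vec_index l i * cnj (vec_index k i)))"
    using w by (intro rip_sum) (simp add: vec_tendsto_def)
  ultimately show ?thesis by simp
qed

text \<open>The determinant is a polynomial in the entries, so it belongs to every class of
  functions that contains the constants and is closed under sums and products. The predicate
  \<open>X\<close> is later instantiated with holomorphy and with meromorphy.\<close>

lemma det_closed:
  fixes X :: "(complex \<Rightarrow> complex) \<Rightarrow> bool"
  assumes const: "\<And>c. X (\<lambda>_. c)" and add: "\<And>f g. X f \<Longrightarrow> X g \<Longrightarrow> X (\<lambda>z. f z + g z)"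
    and mult: "\<And>f g. X f \<Longrightarrow> X g \<Longrightarrow> X (\<lambda>z. f z * g z)"
    and A: "\<And>z. A z \<in> carrier_mat n n" and ent: "\<And>i j. i < n \<Longrightarrow> j < n \<Longrightarrow> X (\<lambda>z. A z $$ (i,j))"
  shows "X (\<lambda>z. Determinant.det (A z))"
proof -
  have sum: "X (\<lambda>z. \<Sum>i\<in>I. f i z)" if "finite I" "\<And>i. i \<in> I \<Longrightarrow> X (f i)" for I :: "(nat \<Rightarrow> nat) set" and f
    using that by (induction I rule: finite_induct) (auto intro: const add)
  have prod: "X (\<lambda>z. \<Prod>i\<in>I. f i z)" if "finite I" "\<And>i. i \<in> I \<Longrightarrow> X (f i)" for I :: "nat set" and f
    using that by (induction I rule: finite_induct) (auto intro: const mult)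
  have "X (\<lambda>z. \<Sum>p\<in>{p. p permutes {0..<n}}. signof p * (\<Prod>i=0..<n. A z $$ (i, p i)))"
    by (intro sum mult const prod finite_permutations ent) (auto dest: permutes_in_image)
  then show ?thesis by (simp only: det_def'[OF A])
qed

lemma adj_mat_closed:
  fixes X :: "(complex \<Rightarrow> complex) \<Rightarrow> bool"
  assumes const: "\<And>c. X (\<lambda>_. c)" and add: "\<And>f g. X f \<Longrightarrow> X g \<Longrightarrow> X (\<lambda>z. f z + g z)"
    and mult: "\<And>f g. X f \<Longrightarrow> X g \<Longrightarrow> X (\<lambda>z. f z * g z)"
    and A: "\<And>z. A z \<in> carrier_mat n n" and ent: "\<And>i j. i < n \<Longrightarrow> j < n \<Longrightarrow> X (\<lambda>z. A z $$ (i,j))"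
    and ij: "i < n" "j < n"
  shows "X (\<lambda>z. adj_mat (A z) $$ (i,j))"
proof -
  have "X (\<lambda>z. Determinant.det (mat_delete (A z) j i))"
  proof (rule det_closed[OF const add mult])
    show "mat_delete (A z) j i \<in> carrier_mat (n - 1) (n - 1)" for z
      using A[of z] by (simp add: mat_delete_def)
    fix k l assume kl: "k < n - 1" "l < n - 1"
    have dims: "dim_row (A z) = n" "dim_col (A z) = n" for z using A[of z] by auto
    have "(\<lambda>z. mat_delete (A z) j i $$ (k,l)) = (\<lambda>z. A z $$ (if k < j then k else Suc k, if l < i then l else Suc l))"
      using kl by (simp add: mat_delete_def dims)
    then show "X (\<lambda>z. mat_delete (A z) j i $$ (k,l))" using kl by (auto intro!: ent)
  qed
  then have "X (\<lambda>z. (-1) ^ (j + i) * Determinant.det (mat_delete (A z) j i))" by (intro mult const)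
  moreover have "adj_mat (A z) $$ (i,j) = (-1) ^ (j + i) * Determinant.det (mat_delete (A z) j i)" for z
    using A[of z] ij by (simp add: adj_mat_def cofactor_def)
  ultimately show ?thesis by simp
qed

lemma holomorphic_mat_inv:
  fixes A :: "complex \<Rightarrow> complex mat"
  assumes A: "\<And>z. z \<in> S \<Longrightarrow> A z \<in> carrier_mat n n"
    and ent: "\<And>i j. i < n \<Longrightarrow> j < n \<Longrightarrow> (\<lambda>z. A z $$ (i,j)) holomorphic_on S"
    and det: "\<And>z. z \<in> S \<Longrightarrow> Determinant.det (A z) \<noteq> 0" and ij: "i < n" "j < n"
  shows "(\<lambda>z. mat_inv (A z) $$ (i,j)) holomorphic_on S"
proof -
  \<comment> \<open>\<open>det_closed\<close> and \<open>adj_mat_closed\<close> want a matrix of the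
    right size at every argument, also outside \<open>S\<close>.\<close>
  define A' where "A' = (\<lambda>z. Matrix.mat n n (\<lambda>ij. A z $$ ij))"
  have A': "A' z \<in> carrier_mat n n" for z by (simp add: A'_def)
  have eq: "A' z = A z" if "z \<in> S" for z using A[OF that] by (auto simp: A'_def)
  have ent': "(\<lambda>z. A' z $$ (i,j)) holomorphic_on S" if "i < n" "j < n" for i j
    using ent[OF that] that by (simp add: A'_def)
  have h1: "(\<lambda>z. Determinant.det (A' z)) holomorphic_on S"
    by (rule det_closed[where X = "\<lambda>f. f holomorphic_on S"]) (auto intro: holomorphic_intros A' ent')
  have h2: "(\<lambda>z. adj_mat (A' z) $$ (i,j)) holomorphic_on S"
    by (rule adj_mat_closed[where X = "\<lambda>f. f holomorphic_on S", OF _ _ _ A' ent' ij]) (auto intro: holomorphic_intros)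
  have "(\<lambda>z. 1 / Determinant.det (A' z) * adj_mat (A' z) $$ (i,j)) holomorphic_on S"
    using det eq by (intro holomorphic_intros h1 h2) auto
  moreover have "1 / Determinant.det (A' z) * adj_mat (A' z) $$ (i,j) = mat_inv (A z) $$ (i,j)" if "z \<in> S" for z
    using mat_inv_det(4)[OF A[OF that] det[OF that]] adj_mat(1)[OF A[OF that]] ij eq[OF that] by simp
  ultimately show ?thesis by (simp cong: holomorphic_cong)
qed

lemma index_mult_sum:
  assumes "A \<in> carrier_mat n m" "B \<in> carrier_mat m k" "i < n" "j < k"
  shows "(A * B) $$ (i,j) = (\<Sum>l<m. A $$ (i,l) * B $$ (l,j))"
  using assms by (simp add: scalar_prod_def lessThan_atLeast0)

lemma mult_index_holomorphic:
  fixes A B :: "complex \<Rightarrow> complex mat"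
  assumes "\<And>z. z \<in> S \<Longrightarrow> A z \<in> carrier_mat n n" "\<And>z. z \<in> S \<Longrightarrow> B z \<in> carrier_mat n n"
    and "\<And>i j. i < n \<Longrightarrow> j < n \<Longrightarrow> (\<lambda>z. A z $$ (i,j)) holomorphic_on S"
    and "\<And>i j. i < n \<Longrightarrow> j < n \<Longrightarrow> (\<lambda>z. B z $$ (i,j)) holomorphic_on S"
    and ij: "i < n" "j < n"
  shows "(\<lambda>z. (A z * B z) $$ (i,j)) holomorphic_on S"
proof -
  have "(\<lambda>z. \<Sum>l<n. A z $$ (i,l) * B z $$ (l,j)) holomorphic_on S"
    using ij by (intro holomorphic_on_sum holomorphic_on_mult assms(3,4)) auto
  moreover have "(\<Sum>l<n. A z $$ (i,l) * B z $$ (l,j)) = (A z * B z) $$ (i,j)" if "z \<in> S" for z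
    by (rule index_mult_sum[OF assms(1,2)[OF that] ij, symmetric])
  ultimately show ?thesis by (simp cong: holomorphic_cong)
qed

text \<open>Each of the \<open>n\<close> entries of the product is at most \<open>n * B\<close>
  times the length of \<open>u\<close>, and summing the squares gives \<open>n ^ 3\<close>. The
  bound is crude; later only the existence of some constant matters.\<close>

lemma rip_mult_le_of_entries:
  assumes A: "A \<in> carrier_mat n n" and B: "\<And>i j. i < n \<Longrightarrow> j < n \<Longrightarrow> cmod (A $$ (i,j)) \<le> B"
    and u: "u \<in> carrier_vec n" and "0 \<le> B"
  shows "rip (A *\<^sub>v u) (A *\<^sub>v u) \<le> real n ^ 3 * B\<^sup>2 * rip u u"
proof -
  define r where "r = sqrt (rip u u)"
  have r: "0 \<le> r" "r\<^sup>2 = rip u u" using rip_self_nonneg[of u] by (auto simp: r_def)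
  have uj: "cmod (vec_index u j) \<le> r" if "j < n" for j
    by (rule power2_le_imp_le) (simp_all only: r norm_index_le_rip[OF u that])
  have "(cmod (vec_index (A *\<^sub>v u) i))\<^sup>2 \<le> (real n * (B * r))\<^sup>2" if i: "i < n" for i
  proof (rule power_mono)
    have "cmod (\<Sum>j<n. A $$ (i,j) * vec_index u j) \<le> (\<Sum>j<n. B * r)"
      using B i uj \<open>0 \<le> B\<close> by (intro sum_norm_le) (auto simp: norm_mult intro!: mult_mono)
    then show "cmod (vec_index (A *\<^sub>v u) i) \<le> real n * (B * r)"
      unfolding mult_mat_vec_index_sum[OF A u i] by simp
  qed simp
  then have "rip (A *\<^sub>v u) (A *\<^sub>v u) \<le> (\<Sum>i<n. (real n * (B * r))\<^sup>2)"
    unfolding rip_self_sum[OF square_mult_mat_vec_carrier[OF A u]] by (rule sum_mono) simp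
  also have "\<dots> = real n ^ 3 * B\<^sup>2 * rip u u"
    unfolding r(2)[symmetric] by (simp add: power_mult_distrib power3_eq_cube power2_eq_square)
  finally show ?thesis .
qed

lemma entries_le_of_rip:
  assumes A: "A \<in> carrier_mat n n" and c: "0 \<le> c" and le: "\<And>v. v \<in> carrier_vec n \<Longrightarrow> rip (A *\<^sub>v v) (A *\<^sub>v v) \<le> c\<^sup>2 * rip v v"
    and ij: "i < n" "j < n"
  shows "cmod (A $$ (i,j)) \<le> c"
proof (rule power2_le_imp_le[OF _ c])
  have "vec_index (A *\<^sub>v unit_vec n j) i = A $$ (i,j)" using A ij by simp
  then have "(cmod (A $$ (i,j)))\<^sup>2 \<le> rip (A *\<^sub>v unit_vec n j) (A *\<^sub>v unit_vec n j)"
    using norm_index_le_rip[of "A *\<^sub>v unit_vec n j" n i] A ij by simp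
  also have "\<dots> \<le> c\<^sup>2" using le[of "unit_vec n j"] rip_self_unit[OF ij(2)] by simp
  finally show "(cmod (A $$ (i,j)))\<^sup>2 \<le> c\<^sup>2" .
qed

section \<open>Stolz regions and boundary values\<close>

lemma at_within_stolz_neq_bot:
  assumes p: "cmod p = 1" and M: "1 < M"
  shows "at p within stolz p M \<noteq> bot"
proof -
  have "p islimpt stolz p M"
    unfolding islimpt_approachable
  proof (intro allI impI)
    fix e :: real assume "0 < e"
    define q where "q = of_real (1 + e / 2) * p"
    have qp: "q - p = of_real (e / 2) * p" by (simp add: q_def algebra_simps)
    have "cmod (q - p) = e / 2" unfolding qp norm_mult norm_of_real using p \<open>0 < e\<close> by simp
    moreover have "cmod q = 1 + e / 2" unfolding q_def norm_mult norm_of_real using p \<open>0 < e\<close> by simp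
    ultimately show "\<exists>x'\<in>stolz p M. x' \<noteq> p \<and> dist x' p < e"
      using \<open>0 < e\<close> M p by (intro bexI[of _ q]) (auto simp: stolz_def dist_norm)
  qed
  then show ?thesis by (simp add: trivial_limit_within)
qed

lemma stolz_subset: "stolz p M \<subseteq> outside_disc"
  by (auto simp: stolz_def outside_disc_def)

lemma eventually_in_stolz: "\<forall>\<^sub>F q in at p within stolz p M. q \<in> outside_disc"
  unfolding eventually_at_filter by (rule always_eventually) (use stolz_subset in blast)

lemma nt_limit_unique:
  assumes "cmod p = 1" "nt_limit f p l" "nt_limit f p l'"
  shows "l = l'"
proof (rule tendsto_unique)
  show "at p within stolz p 2 \<noteq> bot" using assms(1) by (rule at_within_stolz_neq_bot) simp
  show "(f \<longlongrightarrow> l) (at p within stolz p 2)" "(f \<longlongrightarrow> l') (at p within stolz p 2)"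
    using assms by (auto simp: nt_limit_def)
qed

lemma nt_limit_cong:
  assumes "\<And>q. q \<in> outside_disc \<Longrightarrow> f q = g q"
  shows "nt_limit f p l \<longleftrightarrow> nt_limit g p l"
  unfolding nt_limit_def
  by (intro all_cong Lim_cong_within refl) (use assms stolz_subset in blast)

lemma bdry_value_index:
  assumes "cmod p = 1" "has_bdry_value nr nc G p" "i < nr" "j < nc"
  shows "nt_limit (\<lambda>q. G q $$ (i,j)) p (bdry_value nr nc G p $$ (i,j))"
proof -
  obtain l where l: "nt_limit (\<lambda>q. G q $$ (i,j)) p l" using assms by (auto simp: has_bdry_value_def)
  have "(THE l. nt_limit (\<lambda>q. G q $$ (i,j)) p l) = l"
    using l nt_limit_unique[OF assms(1)] by blast
  then show ?thesis using l assms by (simp add: bdry_value_def)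
qed

lemma bdry_value_index_eqI:
  assumes "cmod p = 1" "nt_limit (\<lambda>q. G q $$ (i,j)) p l" "i < nr" "j < nc"
  shows "bdry_value nr nc G p $$ (i,j) = l"
proof -
  have "(THE l. nt_limit (\<lambda>q. G q $$ (i,j)) p l) = l"
    using assms(2) nt_limit_unique[OF assms(1)] by blast
  then show ?thesis using assms by (simp add: bdry_value_def)
qed

lemma bdry_value_carrier [simp]: "bdry_value nr nc G p \<in> carrier_mat nr nc"
  by (simp add: bdry_value_def)

lemma bdry_value_mat_tendsto:
  assumes "cmod p = 1" "has_bdry_value n n G p" "\<And>q. q \<in> outside_disc \<Longrightarrow> G q \<in> carrier_mat n n"
  shows "mat_tendsto n G (bdry_value n n G p) (at p within stolz p 2)"
  unfolding mat_tendsto_def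
proof (intro conjI allI impI)
  show "\<forall>\<^sub>F q in at p within stolz p 2. G q \<in> carrier_mat n n"
    using eventually_in_stolz by (rule eventually_mono) (rule assms(3))
  show "((\<lambda>q. G q $$ (i,j)) \<longlongrightarrow> bdry_value n n G p $$ (i,j)) (at p within stolz p 2)" if "i < n" "j < n" for i j
    using bdry_value_index[OF assms(1,2) that] by (simp add: nt_limit_def)
qed simp

lemma HinfE:
  assumes "Hinf S nr nc G"
  obtains B where "0 \<le> B" "\<And>q i j. q \<in> S \<Longrightarrow> i < nr \<Longrightarrow> j < nc \<Longrightarrow> cmod (G q $$ (i,j)) \<le> B"
    "\<And>q. q \<in> S \<Longrightarrow> G q \<in> carrier_mat nr nc"
    "\<And>i j. i < nr \<Longrightarrow> j < nc \<Longrightarrow> (\<lambda>q. G q $$ (i,j)) holomorphic_on S"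
proof -
  obtain M where M: "\<forall>z\<in>S. \<forall>i<nr. \<forall>j<nc. cmod (G z $$ (i,j)) \<le> M" using assms unfolding Hinf_def by blast
  show ?thesis
  proof (rule that[of "max 0 M"])
    fix q i j assume "q \<in> S" "i < nr" "j < nc"
    then have "cmod (G q $$ (i,j)) \<le> M" using M by blast
    then show "cmod (G q $$ (i,j)) \<le> max 0 M" by simp
  qed (use assms in \<open>simp_all add: Hinf_def\<close>)
qed

lemma Hinf_has_bdry_value_ae:
  assumes "Hinf outside_disc n n G"
  shows "\<exists>N. negligible N \<and> (\<forall>t. t \<notin> N \<longrightarrow> has_bdry_value n n G (cis t))"
proof -
  obtain B where B: "\<And>q i j. q \<in> outside_disc \<Longrightarrow> i < n \<Longrightarrow> j < n \<Longrightarrow> cmod (G q $$ (i,j)) \<le> B"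
    using HinfE[OF assms] by metis
  have "\<exists>N. negligible N \<and> (\<forall>t. t \<notin> N \<longrightarrow> (\<exists>l. nt_limit (\<lambda>q. G q $$ (i,j)) (cis t) l))" if "i < n" "j < n" for i j
    by (rule fatou_exterior[where B = B]) (use assms B that in \<open>auto simp: Hinf_def\<close>)
  then obtain N where N: "\<And>i j. i < n \<Longrightarrow> j < n \<Longrightarrow> negligible (N i j)"
      "\<And>i j t. i < n \<Longrightarrow> j < n \<Longrightarrow> t \<notin> N i j \<Longrightarrow> \<exists>l. nt_limit (\<lambda>q. G q $$ (i,j)) (cis t) l"
    by metis
  have "negligible (\<Union>(i,j)\<in>{..<n}\<times>{..<n}. N i j)"
    by (rule negligible_Union) (use N in auto)
  moreover have "has_bdry_value n n G (cis t)" if "t \<notin> (\<Union>(i,j)\<in>{..<n}\<times>{..<n}. N i j)" for t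
    unfolding has_bdry_value_def using N(2) that by blast
  ultimately show ?thesis by blast
qed

lemma cscalar_sum:
  fixes A :: "complex mat"
  assumes "A \<in> carrier_mat n n" "x \<in> carrier_vec n" "y \<in> carrier_vec n"
  shows "(A *\<^sub>v x) \<bullet>c y = (\<Sum>i<n. (\<Sum>j<n. A $$ (i,j) * vec_index x j) * cnj (vec_index y i))"
  using assms by (simp add: scalar_prod_def lessThan_atLeast0 mult_mat_vec_index_sum[OF assms(1,2), unfolded lessThan_atLeast0] del: index_mult_mat_vec)

text \<open>For fixed \<open>x\<close> the quadratic form is linear in the entries of
  \<open>G q\<close>, hence a scalar bounded analytic function, and its boundary limits are the
  quadratic form of the boundary value.\<close>

lemma Hinf_positive_real:
  assumes G: "Hinf outside_disc n n G" and N: "negligible N"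
    and pos: "\<And>t x. t \<notin> N \<Longrightarrow> has_bdry_value n n G (cis t) \<Longrightarrow> x \<in> carrier_vec n \<Longrightarrow> 0 \<le> rip (bdry_value n n G (cis t) *\<^sub>v x) x"
    and q: "q \<in> outside_disc" and x: "x \<in> carrier_vec n"
  shows "0 \<le> rip (G q *\<^sub>v x) x"
proof -
  obtain N2 where N2: "negligible N2" "\<And>t. t \<notin> N2 \<Longrightarrow> has_bdry_value n n G (cis t)"
    using Hinf_has_bdry_value_ae[OF G] by blast
  obtain B where B: "\<And>q i j. q \<in> outside_disc \<Longrightarrow> i < n \<Longrightarrow> j < n \<Longrightarrow> cmod (G q $$ (i,j)) \<le> B"
    using HinfE[OF G] by metis
  have carr: "\<And>q. q \<in> outside_disc \<Longrightarrow> G q \<in> carrier_mat n n"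
    and hol: "\<And>i j. i < n \<Longrightarrow> j < n \<Longrightarrow> (\<lambda>q. G q $$ (i,j)) holomorphic_on outside_disc"
    using G by (auto simp: Hinf_def)
  define h where "h = (\<lambda>q. \<Sum>i<n. (\<Sum>j<n. G q $$ (i,j) * vec_index x j) * cnj (vec_index x i))"
  have "0 \<le> Re (h q)"
  proof (rule exterior_Re_nonneg[OF _ _ _ _ q])
    show "h holomorphic_on outside_disc"
      unfolding h_def using hol by (intro holomorphic_intros) auto
    show "cmod (h q) \<le> (\<Sum>i<n. (\<Sum>j<n. B * cmod (vec_index x j)) * cmod (vec_index x i))" if "q \<in> outside_disc" for q
      unfolding h_def
    proof (rule sum_norm_le)
      fix i assume "i \<in> {..<n}"
      then have "cmod (\<Sum>j<n. G q $$ (i,j) * vec_index x j) \<le> (\<Sum>j<n. B * cmod (vec_index x j))"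
        using B[OF that] by (intro sum_norm_le) (auto simp: norm_mult intro!: mult_right_mono)
      then show "cmod ((\<Sum>j<n. G q $$ (i,j) * vec_index x j) * cnj (vec_index x i)) \<le> (\<Sum>j<n. B * cmod (vec_index x j)) * cmod (vec_index x i)"
        by (simp add: norm_mult mult_right_mono)
    qed
    show "negligible (N \<union> N2)" using N N2(1) by simp
    fix t assume t: "t \<notin> N \<union> N2"
    then have hb: "has_bdry_value n n G (cis t)" using N2 by auto
    define L where "L = bdry_value n n G (cis t)"
    have "nt_limit h (cis t) (\<Sum>i<n. (\<Sum>j<n. L $$ (i,j) * vec_index x j) * cnj (vec_index x i))"
      unfolding nt_limit_def h_def L_def
    proof (intro allI impI)
      fix M :: real assume "1 < M"
      then have "((\<lambda>q. G q $$ (i,j)) \<longlongrightarrow> bdry_value n n G (cis t) $$ (i,j)) (at (cis t) within stolz (cis t) M)" if "i < n" "j < n" for i j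
        using bdry_value_index[OF _ hb that] by (simp add: nt_limit_def)
      then show "((\<lambda>q. \<Sum>i<n. (\<Sum>j<n. G q $$ (i,j) * vec_index x j) * cnj (vec_index x i)) \<longlongrightarrow>
           (\<Sum>i<n. (\<Sum>j<n. bdry_value n n G (cis t) $$ (i,j) * vec_index x j) * cnj (vec_index x i))) (at (cis t) within stolz (cis t) M)"
        by (intro tendsto_intros) auto
    qed
    moreover have "0 \<le> Re (\<Sum>i<n. (\<Sum>j<n. L $$ (i,j) * vec_index x j) * cnj (vec_index x i))"
    proof -
      have "0 \<le> Re ((L *\<^sub>v x) \<bullet>c x)" using pos[OF _ hb x] t by (simp add: rip_def L_def)
      then show ?thesis unfolding cscalar_sum[of L n, OF _ x x, unfolded L_def, OF bdry_value_carrier] L_def .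
    qed
    ultimately show "\<exists>l. nt_limit h (cis t) l \<and> 0 \<le> Re l" by blast
  qed
  then show ?thesis unfolding rip_def h_def cscalar_sum[OF carr[OF q] x x] .
qed

text \<open>A pole of \<open>g\<close> at \<open>p\<close> would force \<open>f\<close> to blow up
  inside a Stolz region. Hence \<open>g\<close> has a full limit at \<open>p\<close>. For rational
  functions this gives boundary values at every point of the circle instead of almost every
  point.\<close>

lemma meromorphic_bounded_nt_limit:
  assumes mero: "g meromorphic_on {p}" and p: "cmod p = 1"
    and eq: "\<forall>\<^sub>F q in at p. q \<in> outside_disc \<longrightarrow> f q = g q"
    and bnd: "\<And>q. q \<in> outside_disc \<Longrightarrow> cmod (f q) \<le> B"
  shows "\<exists>l. nt_limit f p l"
proof -
  have "not_essential g p" using mero by (simp add: meromorphic_at_iff)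
  moreover have "\<not> is_pole g p"
  proof
    assume "is_pole g p"
    then have "filterlim g at_infinity (at p within stolz p 2)"
      unfolding is_pole_def by (rule filterlim_mono[OF _ order_refl at_le]) simp
    then have "\<forall>\<^sub>F q in at p within stolz p 2. \<bar>B\<bar> + 1 \<le> cmod (g q)"
      by (subst (asm) filterlim_at_infinity[of 0]) auto
    moreover have "\<forall>\<^sub>F q in at p within stolz p 2. q \<in> outside_disc \<longrightarrow> f q = g q"
      using eq by (rule filter_leD[OF at_le[OF subset_UNIV]])
    ultimately have "\<forall>\<^sub>F q in at p within stolz p 2. False"
      using eventually_in_stolz
    proof eventually_elim
      case (elim q)
      then show ?case using bnd[of q] by auto
    qed
    then show False using at_within_stolz_neq_bot[OF p, of 2] by (simp add: trivial_limit_def)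
  qed
  ultimately obtain l where l: "g \<midarrow>p\<rightarrow> l" by (auto simp: not_essential_def)
  have "nt_limit f p l"
    unfolding nt_limit_def
  proof (intro allI impI)
    fix M :: real
    have "(g \<longlongrightarrow> l) (at p within stolz p M)" using l by (rule tendsto_within_subset) simp
    moreover have "\<forall>\<^sub>F q in at p within stolz p M. q \<in> outside_disc \<longrightarrow> f q = g q"
      using eq by (rule filter_leD[OF at_le[OF subset_UNIV]])
    then have "\<forall>\<^sub>F q in at p within stolz p M. g q = f q"
      using eventually_in_stolz by eventually_elim simp
    ultimately show "(f \<longlongrightarrow> l) (at p within stolz p M)" by (rule Lim_transform_eventually)
  qed
  then show ?thesis by blast
qed

lemma meromorphic_on_poly [meromorphic_intros]:
  "f meromorphic_on A \<Longrightarrow> (\<lambda>z. poly a (f z)) meromorphic_on A"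
  by (induction a) (auto intro!: meromorphic_intros)

lemma eventually_poly_nonzero_at:
  fixes b :: "complex poly"
  assumes "b \<noteq> 0" shows "\<forall>\<^sub>F q in at p. poly b q \<noteq> 0"
proof -
  have "finite {q. poly b q = 0}" using assms by (rule poly_roots_finite)
  then have "\<not> p islimpt {q. poly b q = 0}" by (rule islimpt_finite)
  then show ?thesis by (simp add: islimpt_iff_eventually)
qed

lemma rational_has_bdry_value:
  assumes rat: "rational_mat n n G" and H: "Hinf outside_disc n n G" and p: "cmod p = 1"
  shows "has_bdry_value n n G p"
  unfolding has_bdry_value_def
proof (intro allI impI)
  fix i j assume ij: "i < n" "j < n"
  obtain a b :: "complex poly" where ab: "b \<noteq> 0" "\<And>q. poly b q \<noteq> 0 \<Longrightarrow> G q $$ (i,j) = poly a q / poly b q"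
    using rat[unfolded rational_mat_def, rule_format, OF ij] by blast
  obtain B where B: "\<And>q. q \<in> outside_disc \<Longrightarrow> cmod (G q $$ (i,j)) \<le> B"
    using HinfE[OF H] ij by metis
  have m: "(\<lambda>q. poly a q / poly b q) meromorphic_on {p}" by (intro meromorphic_intros)
  have "\<forall>\<^sub>F q in at p. q \<in> outside_disc \<longrightarrow> G q $$ (i,j) = poly a q / poly b q"
    using eventually_poly_nonzero_at[OF ab(1)] by eventually_elim (simp add: ab(2))
  from meromorphic_bounded_nt_limit[OF m p this B]
  show "\<exists>l. nt_limit (\<lambda>q. G q $$ (i,j)) p l" by blast
qed

subsection \<open>Passivity of the Youla parameter\<close>

text \<open>Output strict passivity of the matrix \<open>K\<close>, and the same condition for \<open>K = Q (I - P Q)\<^sup>-\<^sup>1\<close>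
  in terms of \<open>Q\<close>.\<close>

definition osp :: "nat \<Rightarrow> real \<Rightarrow> complex mat \<Rightarrow> bool" where
  "osp n \<epsilon> K \<longleftrightarrow> (\<forall>v\<in>carrier_vec n. \<epsilon> * rip (K *\<^sub>v v) (K *\<^sub>v v) \<le> 2 * rip (K *\<^sub>v v) v)"

definition youla_passive :: "nat \<Rightarrow> real \<Rightarrow> complex mat \<Rightarrow> complex mat \<Rightarrow> bool" where
  "youla_passive n \<epsilon> P Q \<longleftrightarrow> (\<forall>v\<in>carrier_vec n.
     2 * rip (P *\<^sub>v (Q *\<^sub>v v)) (Q *\<^sub>v v) + \<epsilon> * rip (Q *\<^sub>v v) (Q *\<^sub>v v) \<le> 2 * rip (Q *\<^sub>v v) v)"

lemma mult_mat_zero_vec: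
  fixes A :: "complex mat"
  shows "A \<in> carrier_mat n n \<Longrightarrow> A *\<^sub>v 0\<^sub>v n = 0\<^sub>v n"
  by (rule eq_vecI) auto

text \<open>Young's inequality with weight 2 / \<epsilon> bounds 2 <K v, v> by (\<epsilon> / 2) |K
  v|^2 + (2 / \<epsilon>) |v|^2. Absorbing the first term leaves |K v| \<le> (2 / \<epsilon>)
  |v|.\<close>

lemma osp_entry_le:
  assumes K: "K \<in> carrier_mat n n" and "osp n \<epsilon> K" "0 < \<epsilon>" "i < n" "j < n"
  shows "cmod (K $$ (i,j)) \<le> 2 / \<epsilon>"
proof (rule entries_le_of_rip[OF K])
  fix v :: "complex vec" assume v: "v \<in> carrier_vec n"
  define X Y where "X = \<epsilon> / 2 * rip (K *\<^sub>v v) (K *\<^sub>v v)" and "Y = 2 / \<epsilon> * rip v v"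
  have "2 * rip (K *\<^sub>v v) v \<le> rip (K *\<^sub>v v) (K *\<^sub>v v) / (2 / \<epsilon>) + 2 / \<epsilon> * rip v v"
    using K v assms(3) by (intro rip_young[of _ n]) auto
  then have "2 * rip (K *\<^sub>v v) v \<le> X + Y" by (simp add: X_def Y_def mult.commute)
  moreover have "2 * X \<le> 2 * rip (K *\<^sub>v v) v" using assms(2) v by (simp add: osp_def X_def)
  ultimately have "X \<le> Y" by simp
  then have "\<epsilon> / 2 * rip (K *\<^sub>v v) (K *\<^sub>v v) \<le> 2 / \<epsilon> * rip v v" by (simp only: X_def Y_def)
  then have "2 / \<epsilon> * (\<epsilon> / 2 * rip (K *\<^sub>v v) (K *\<^sub>v v)) \<le> 2 / \<epsilon> * (2 / \<epsilon> * rip v v)"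
    using assms(3) by (intro mult_left_mono) auto
  then show "rip (K *\<^sub>v v) (K *\<^sub>v v) \<le> (2 / \<epsilon>)\<^sup>2 * rip v v"
    using assms(3) by (simp add: power2_eq_square)
qed (use assms in auto)

lemma youla_passive_imp_osp:
  assumes "P \<in> carrier_mat n n" "Q \<in> carrier_mat n n" "youla_passive n \<epsilon> P Q"
    and pos: "\<And>v. v \<in> carrier_vec n \<Longrightarrow> 0 \<le> rip (P *\<^sub>v v) v"
  shows "osp n \<epsilon> Q"
  unfolding osp_def
proof
  fix v :: "complex vec" assume v: "v \<in> carrier_vec n"
  have "0 \<le> rip (P *\<^sub>v (Q *\<^sub>v v)) (Q *\<^sub>v v)" using assms v by (intro pos) simp
  then show "\<epsilon> * rip (Q *\<^sub>v v) (Q *\<^sub>v v) \<le> 2 * rip (Q *\<^sub>v v) v"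
    using assms(3) v unfolding youla_passive_def by fastforce
qed

lemma id_plus_mult_vec:
  fixes P K :: "complex mat"
  assumes "P \<in> carrier_mat n n" "K \<in> carrier_mat n n" "v \<in> carrier_vec n"
  shows "(1\<^sub>m n + P * K) *\<^sub>v v = v + P *\<^sub>v (K *\<^sub>v v)" "(1\<^sub>m n - P * K) *\<^sub>v v = v - P *\<^sub>v (K *\<^sub>v v)"
  using assms
  by (simp_all add: add_mult_distrib_mat_vec[of _ n n] minus_mult_distrib_mat_vec[of _ n n] assoc_mult_mat_vec[of _ n n _ n])

lemma youla_of_osp:
  assumes P: "P \<in> carrier_mat n n" and K: "K \<in> carrier_mat n n" and "osp n \<epsilon> K" "0 < \<epsilon>"
    and pos: "\<And>v. v \<in> carrier_vec n \<Longrightarrow> 0 \<le> rip (P *\<^sub>v v) v"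
  shows "Determinant.det (1\<^sub>m n + P * K) \<noteq> 0" "youla_passive n \<epsilon> P (K * mat_inv (1\<^sub>m n + P * K))"
proof -
  have M: "1\<^sub>m n + P * K \<in> carrier_mat n n" using P K by simp
  have key: "\<epsilon> * rip (K *\<^sub>v x) (K *\<^sub>v x) \<le> 2 * rip (K *\<^sub>v x) x" if "x \<in> carrier_vec n" for x
    using assms(3) that by (simp add: osp_def)
  show det: "Determinant.det (1\<^sub>m n + P * K) \<noteq> 0"
  proof (rule det_nonzeroI[OF M])
    fix v assume v: "v \<in> carrier_vec n" and "(1\<^sub>m n + P * K) *\<^sub>v v = 0\<^sub>v n"
    then have v0: "v + P *\<^sub>v (K *\<^sub>v v) = 0\<^sub>v n" by (simp add: id_plus_mult_vec(1)[OF P K v])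
    define w where "w = K *\<^sub>v v"
    have w: "w \<in> carrier_vec n" "P *\<^sub>v w \<in> carrier_vec n" using K P v by (auto simp: w_def)
    have "rip (v + P *\<^sub>v w) w = 0" using v0 w by (simp add: w_def rip_def)
    then have "rip v w + rip (P *\<^sub>v w) w = 0" using v w by (simp add: rip_add_left[of _ n])
    \<comment> \<open>On a kernel vector \<open>v = - P w\<close>, so the passivity of
      \<open>P\<close> opposes that of \<open>K\<close>, and \<open>w = K v\<close> must
      vanish.\<close>
    then have "rip w v \<le> 0" using pos[OF w(1)] rip_commute[OF v w(1)] by simp
    then have "\<epsilon> * rip w w \<le> 0" using key[OF v] by (simp add: w_def)
    then have "rip w w \<le> 0" using assms(4) by (simp add: mult_le_0_iff)
    then have "w = 0\<^sub>v n" by (rule rip_self_eq_0[OF w(1)])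
    then show "v = 0\<^sub>v n" using v0 v mult_mat_zero_vec[OF P] by (simp add: w_def)
  qed
  show "youla_passive n \<epsilon> P (K * mat_inv (1\<^sub>m n + P * K))"
    unfolding youla_passive_def
  proof
    fix v :: "complex vec" assume v: "v \<in> carrier_vec n"
    define x where "x = mat_inv (1\<^sub>m n + P * K) *\<^sub>v v"
    have x: "x \<in> carrier_vec n" "(1\<^sub>m n + P * K) *\<^sub>v x = v" using mat_inv_vec[OF M det v] by (auto simp: x_def)
    define w where "w = K *\<^sub>v x"
    have w: "w \<in> carrier_vec n" "P *\<^sub>v w \<in> carrier_vec n" using K P x by (auto simp: w_def)
    have Qv: "(K * mat_inv (1\<^sub>m n + P * K)) *\<^sub>v v = w"
      using K v mat_inv_det(1)[OF M det] by (simp add: w_def x_def assoc_mult_mat_vec[of _ n n _ n])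
    \<comment> \<open>The output is common to both descriptions, \<open>w = K x = Q v\<close>, so
      \<open>rip w w\<close> is unchanged, and \<open>v - x = P w\<close> accounts for the term in
      \<open>P\<close>.\<close>
    have "v = x + P *\<^sub>v w" using x id_plus_mult_vec(1)[OF P K x(1)] by (simp add: w_def)
    then have "rip w v = rip w x + rip (P *\<^sub>v w) w"
      using w x rip_commute[OF w] by (simp add: rip_add_right[of _ n])
    then show "2 * rip (P *\<^sub>v ((K * mat_inv (1\<^sub>m n + P * K)) *\<^sub>v v)) ((K * mat_inv (1\<^sub>m n + P * K)) *\<^sub>v v)
        + \<epsilon> * rip ((K * mat_inv (1\<^sub>m n + P * K)) *\<^sub>v v) ((K * mat_inv (1\<^sub>m n + P * K)) *\<^sub>v v)
        \<le> 2 * rip ((K * mat_inv (1\<^sub>m n + P * K)) *\<^sub>v v) v"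
      unfolding Qv using key[OF x(1)] by (simp add: w_def)
  qed
qed

lemma osp_of_youla:
  assumes P: "P \<in> carrier_mat n n" and Q: "Q \<in> carrier_mat n n" and "youla_passive n \<epsilon> P Q" "0 < \<epsilon>"
  shows "Determinant.det (1\<^sub>m n - P * Q) \<noteq> 0" "osp n \<epsilon> (Q * mat_inv (1\<^sub>m n - P * Q))"
proof -
  have M: "1\<^sub>m n - P * Q \<in> carrier_mat n n" using P Q by auto
  have key: "2 * rip (P *\<^sub>v (Q *\<^sub>v v)) (Q *\<^sub>v v) + \<epsilon> * rip (Q *\<^sub>v v) (Q *\<^sub>v v) \<le> 2 * rip (Q *\<^sub>v v) v"
    if "v \<in> carrier_vec n" for v
    using assms(3) that by (simp add: youla_passive_def)
  show det: "Determinant.det (1\<^sub>m n - P * Q) \<noteq> 0"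
  proof (rule det_nonzeroI[OF M])
    fix v assume v: "v \<in> carrier_vec n" and "(1\<^sub>m n - P * Q) *\<^sub>v v = 0\<^sub>v n"
    then have v0: "v - P *\<^sub>v (Q *\<^sub>v v) = 0\<^sub>v n" by (simp add: id_plus_mult_vec(2)[OF P Q v])
    define w where "w = Q *\<^sub>v v"
    have w: "w \<in> carrier_vec n" "P *\<^sub>v w \<in> carrier_vec n" using Q P v by (auto simp: w_def)
    have "rip (v - P *\<^sub>v w) w = 0" using v0 w by (simp add: w_def rip_def)
    then have "rip w v = rip (P *\<^sub>v w) w" using v w rip_commute[OF v w(1)] by (simp add: rip_diff_left[of _ n])
    \<comment> \<open>On a kernel vector \<open>v = P w\<close>, so the terms in \<open>P\<close>
      cancel and only \<open>\<epsilon> * rip w w\<close> is left.\<close>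
    then have "\<epsilon> * rip w w \<le> 0" using key[OF v] by (simp add: w_def)
    then have "rip w w \<le> 0" using assms(4) by (simp add: mult_le_0_iff)
    then have "w = 0\<^sub>v n" by (rule rip_self_eq_0[OF w(1)])
    then have "P *\<^sub>v w = 0\<^sub>v n" using mult_mat_zero_vec[OF P] by simp
    then show "v = 0\<^sub>v n" using v0 v by (simp add: w_def)
  qed
  show "osp n \<epsilon> (Q * mat_inv (1\<^sub>m n - P * Q))"
    unfolding osp_def
  proof
    fix v :: "complex vec" assume v: "v \<in> carrier_vec n"
    define x where "x = mat_inv (1\<^sub>m n - P * Q) *\<^sub>v v"
    have x: "x \<in> carrier_vec n" "(1\<^sub>m n - P * Q) *\<^sub>v x = v" using mat_inv_vec[OF M det v] by (auto simp: x_def)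
    define w where "w = Q *\<^sub>v x"
    have w: "w \<in> carrier_vec n" "P *\<^sub>v w \<in> carrier_vec n" using Q P x by (auto simp: w_def)
    have Kv: "(Q * mat_inv (1\<^sub>m n - P * Q)) *\<^sub>v v = w"
      using Q v mat_inv_det(1)[OF M det] by (simp add: w_def x_def assoc_mult_mat_vec[of _ n n _ n])
    have "v = x - P *\<^sub>v w" using x id_plus_mult_vec(2)[OF P Q x(1)] by (simp add: w_def)
    then have "rip w v = rip w x - rip (P *\<^sub>v w) w"
      using w x rip_commute[OF w] by (simp add: rip_diff_right[of _ n])
    then show "\<epsilon> * rip ((Q * mat_inv (1\<^sub>m n - P * Q)) *\<^sub>v v) ((Q * mat_inv (1\<^sub>m n - P * Q)) *\<^sub>v v)
        \<le> 2 * rip ((Q * mat_inv (1\<^sub>m n - P * Q)) *\<^sub>v v) v"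
      unfolding Kv using key[OF x(1)] by (simp add: w_def)
  qed
qed

text \<open>From \<open>Q (I + P K) = K\<close> follows \<open>(I - P Q) (I + P K) = I\<close>. So
  \<open>I + P K\<close> is the inverse of \<open>I - P Q\<close>, and \<open>Q\<close> times it is
  \<open>K\<close>.\<close>

lemma feedback_of_youla:
  fixes P K :: "complex mat"
  assumes P: "P \<in> carrier_mat n n" and K: "K \<in> carrier_mat n n" and det: "Determinant.det (1\<^sub>m n + P * K) \<noteq> 0"
    and Q: "Q = K * mat_inv (1\<^sub>m n + P * K)" and det': "Determinant.det (1\<^sub>m n - P * Q) \<noteq> 0"
  shows "K = Q * mat_inv (1\<^sub>m n - P * Q)"
proof -
  define M where "M = 1\<^sub>m n + P * K"
  have M: "M \<in> carrier_mat n n" using P K by (simp add: M_def)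
  have I: "mat_inv M \<in> carrier_mat n n" "mat_inv M * M = 1\<^sub>m n"
    using mat_inv_det[OF M] det by (auto simp: M_def)
  have Qc: "Q \<in> carrier_mat n n" using K I by (simp add: Q M_def[symmetric])
  have QM: "Q * M = K" using K I M by (simp add: Q M_def[symmetric] assoc_mult_mat[of _ n n _ n _ n])
  define T where "T = 1\<^sub>m n - P * Q"
  have T: "T \<in> carrier_mat n n" using P Qc by (auto simp: T_def)
  have "T * M = M - P * K"
    using P Qc M QM by (simp add: T_def minus_mult_distrib_mat[of _ n n _ _ n] assoc_mult_mat[of _ n n _ n _ n])
  also have "\<dots> = 1\<^sub>m n" using P K by (auto simp: M_def)
  finally have TM: "T * M = 1\<^sub>m n" .
  have iT: "mat_inv T \<in> carrier_mat n n" "mat_inv T * T = 1\<^sub>m n" using mat_inv_det[OF T] det' by (auto simp: T_def)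
  have "mat_inv T = mat_inv T * (T * M)" using TM iT by simp
  also have "\<dots> = M" using iT T M by (simp flip: assoc_mult_mat[of _ n n _ n _ n])
  finally show ?thesis using QM by (simp add: T_def)
qed

text \<open>Consider twice the inequality, with \<open>a = Q y\<close> and
  \<open>x = a + \<delta> y\<close>. The terms of first order in \<delta> on the left cost at most
  \<delta> C^2 |a|^2 + \<delta> |y|^2, those of second order at most \<delta>^2 C |y|^2. The slack
  (\<epsilon> - \<epsilon>') |a|^2 pays for the term in |a|^2, and 2 \<delta> |y|^2 from the
  right-hand side pays for the terms in |y|^2. The two smallness conditions on \<delta> say just
  this.\<close>

lemma youla_shift_estimate:
  assumes P: "P \<in> carrier_mat n n" and Q: "Q \<in> carrier_mat n n" and y: "y \<in> carrier_vec n"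
    and yp: "youla_passive n \<epsilon> P Q"
    and D: "\<And>u. u \<in> carrier_vec n \<Longrightarrow> rip (P *\<^sub>v u) (P *\<^sub>v u) \<le> D * rip u u" "0 \<le> D"
    and C: "C = D + 1 + \<epsilon>'" and "0 < \<epsilon>'" "0 < \<delta>" "\<delta> * C \<le> 1" "\<delta> * C\<^sup>2 \<le> \<epsilon> - \<epsilon>'"
    and x: "x = Q *\<^sub>v y + complex_of_real \<delta> \<cdot>\<^sub>v y"
  shows "rip (P *\<^sub>v x) x + \<epsilon>' / 2 * rip x x \<le> rip y x"
proof -
  define a where "a = Q *\<^sub>v y"
  have cs: "a \<in> carrier_vec n" "P *\<^sub>v a \<in> carrier_vec n" "P *\<^sub>v y \<in> carrier_vec n" "complex_of_real \<delta> \<cdot>\<^sub>v y \<in> carrier_vec n"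
     "complex_of_real \<delta> \<cdot>\<^sub>v (P *\<^sub>v y) \<in> carrier_vec n"
    using P Q y by (auto simp: a_def)
  define A Y s t1 t2 t3 pa where "A = rip a a" and "Y = rip y y" and "s = rip a y" and "t1 = rip (P *\<^sub>v a) y"
    and "t2 = rip (P *\<^sub>v y) a" and "t3 = rip (P *\<^sub>v y) y" and "pa = rip (P *\<^sub>v a) a"
  have "0 < C" using C D(2) \<open>0 < \<epsilon>'\<close> by simp
  have pos: "0 \<le> A" "0 \<le> Y" by (auto simp: A_def Y_def rip_self_nonneg)
  have e1: "rip (P *\<^sub>v x) x = pa + \<delta> * t1 + \<delta> * t2 + \<delta>\<^sup>2 * t3"
    using cs y P unfolding x a_def[symmetric]
    by (simp add: mult_add_distrib_mat_vec[of _ n n] mult_mat_vec[of _ n n] rip_add_left[of _ n] rip_add_right[of _ n]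
        rip_smult_left[of _ n] rip_smult_right[of _ n] t1_def t2_def t3_def pa_def power2_eq_square algebra_simps)
  have e2: "rip x x = A + 2 * \<delta> * s + \<delta>\<^sup>2 * Y"
    using cs y rip_commute[OF y cs(1)] unfolding x a_def[symmetric]
    by (simp add: rip_add_left[of _ n] rip_add_right[of _ n]
        rip_smult_left[of _ n] rip_smult_right[of _ n] A_def Y_def s_def power2_eq_square algebra_simps)
  have e3: "rip y x = s + \<delta> * Y"
    using cs y rip_commute[OF y cs(1)] unfolding x a_def[symmetric]
    by (simp add: rip_add_right[of _ n] rip_smult_right[of _ n] Y_def s_def)
  \<comment> \<open>Young's inequality is used with weight 1 / C: the coefficients D, 1 and
    \<epsilon>' of the cross terms add up to \<open>C\<close>, so in \<open>S1\<close> the |y|^2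
    terms sum to exactly |y|^2.\<close>
  have kk: "rip u u / (1 / C) = rip u u * C" "1 / C * rip v v = rip v v / C" for u v :: "complex vec" by simp_all
  have y1: "2 * t1 \<le> D * A * C + Y / C"
  proof -
    have "2 * t1 \<le> rip (P *\<^sub>v a) (P *\<^sub>v a) * C + Y / C"
      using rip_young[OF cs(2) y, of "1 / C"] \<open>0 < C\<close> unfolding kk by (simp add: t1_def Y_def)
    also have "\<dots> \<le> D * A * C + Y / C" using D(1)[OF cs(1)] \<open>0 < C\<close> by (simp add: A_def)
    finally show ?thesis .
  qed
  have y2: "2 * t2 \<le> A * C + D * Y / C"
  proof -
    have "2 * t2 \<le> A * C + rip (P *\<^sub>v y) (P *\<^sub>v y) / C"
      using rip_young[OF cs(1) cs(3), of "1 / C"] \<open>0 < C\<close> rip_commute[OF cs(1) cs(3)] unfolding kk by (simp add: t2_def A_def)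
    also have "\<dots> \<le> A * C + D * Y / C" using D(1)[OF y] \<open>0 < C\<close> by (simp add: Y_def divide_right_mono)
    finally show ?thesis .
  qed
  have y3: "2 * s \<le> A * C + Y / C"
    using rip_young[OF cs(1) y, of "1 / C"] \<open>0 < C\<close> unfolding kk by (simp add: s_def A_def Y_def)
  have y4: "2 * t3 \<le> D * Y + Y"
    using rip_young[OF cs(3) y, of 1] D(1)[OF y] by (simp add: t3_def Y_def)
  have S1: "2 * (t1 + t2 + \<epsilon>' * s) \<le> C\<^sup>2 * A + Y"
  proof -
    have "\<epsilon>' * (2 * s) \<le> \<epsilon>' * (A * C + Y / C)" using y3 \<open>0 < \<epsilon>'\<close> by (intro mult_left_mono) auto
    then have "2 * (t1 + t2 + \<epsilon>' * s) \<le> (D * A * C + Y / C) + (A * C + D * Y / C) + \<epsilon>' * (A * C + Y / C)"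
      using y1 y2 by (simp add: algebra_simps)
    also have "\<dots> = C * (A * C) + C * (Y / C)" by (simp add: C algebra_simps add_divide_distrib)
    also have "\<dots> = C\<^sup>2 * A + Y" using \<open>0 < C\<close> by (simp add: power2_eq_square)
    finally show ?thesis .
  qed
  have S2: "2 * t3 + \<epsilon>' * Y \<le> C * Y" using y4 by (simp add: C algebra_simps)
  have S0: "2 * pa + \<epsilon> * A \<le> 2 * s" using yp y by (simp add: youla_passive_def pa_def A_def s_def a_def)
  have m1: "\<delta> * (2 * (t1 + t2 + \<epsilon>' * s)) \<le> \<delta> * (C\<^sup>2 * A + Y)" using S1 \<open>0 < \<delta>\<close> by (intro mult_left_mono) auto
  have m2: "\<delta>\<^sup>2 * (2 * t3 + \<epsilon>' * Y) \<le> \<delta>\<^sup>2 * (C * Y)" using S2 by (intro mult_left_mono) auto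
  have m3: "\<delta> * C\<^sup>2 * A \<le> (\<epsilon> - \<epsilon>') * A" using assms(11) pos by (intro mult_right_mono) auto
  have m4: "\<delta> * (\<delta> * C * Y) \<le> \<delta> * (1 * Y)" using assms(10) pos \<open>0 < \<delta>\<close> by (intro mult_left_mono mult_right_mono) auto
  have "2 * (rip (P *\<^sub>v x) x + \<epsilon>' / 2 * rip x x) = 2 * pa + \<epsilon>' * A + \<delta> * (2 * (t1 + t2 + \<epsilon>' * s)) + \<delta>\<^sup>2 * (2 * t3 + \<epsilon>' * Y)"
    unfolding e1 e2 by (simp add: algebra_simps)
  also have "\<dots> \<le> 2 * pa + \<epsilon>' * A + \<delta> * (C\<^sup>2 * A + Y) + \<delta>\<^sup>2 * (C * Y)" using m1 m2 by linarith
  also have "\<dots> = 2 * pa + \<epsilon>' * A + \<delta> * C\<^sup>2 * A + \<delta> * Y + \<delta> * (\<delta> * C * Y)"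
    by (simp add: algebra_simps power2_eq_square)
  also have "\<dots> \<le> 2 * pa + \<epsilon>' * A + (\<epsilon> - \<epsilon>') * A + \<delta> * Y + \<delta> * (1 * Y)" using m3 m4 by linarith
  also have "\<dots> \<le> 2 * rip y x" unfolding e3 using S0 by (simp add: algebra_simps)
  finally show ?thesis by simp
qed

section \<open>Passing identities and inequalities to boundary values\<close>

lemma vec_tendsto_unique:
  assumes "F \<noteq> bot" "vec_tendsto n u l F" "vec_tendsto n u k F"
  shows "l = k"
proof (rule eq_vecI)
  show "dim_vec l = dim_vec k" using assms by (auto simp: vec_tendsto_def)
  fix i assume "i < dim_vec k"
  then have "i < n" using assms by (auto simp: vec_tendsto_def)
  then show "vec_index l i = vec_index k i"
    using assms tendsto_unique[OF assms(1), of "\<lambda>q. vec_index (u q) i"] by (simp add: vec_tendsto_def)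
qed

lemma vec_tendsto_add_smult:
  assumes u: "vec_tendsto n u l F" and w: "vec_tendsto n w k F" and c: "(c \<longlongrightarrow> d) F"
  shows "vec_tendsto n (\<lambda>q. u q + c q \<cdot>\<^sub>v w q) (l + d \<cdot>\<^sub>v k) F"
  unfolding vec_tendsto_def
proof (intro conjI allI impI)
  have ev: "\<forall>\<^sub>F q in F. u q \<in> carrier_vec n \<and> w q \<in> carrier_vec n"
    using u w by (auto simp: vec_tendsto_def intro: eventually_conj)
  have lk: "l \<in> carrier_vec n" "k \<in> carrier_vec n" using u w by (auto simp: vec_tendsto_def)
  show "l + d \<cdot>\<^sub>v k \<in> carrier_vec n" using lk by simp
  show "\<forall>\<^sub>F q in F. u q + c q \<cdot>\<^sub>v w q \<in> carrier_vec n" using ev by eventually_elim simp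
  fix i assume i: "i < n"
  have "((\<lambda>q. vec_index (u q) i + c q * vec_index (w q) i) \<longlongrightarrow> vec_index l i + d * vec_index k i) F"
    using u w i by (intro tendsto_intros c) (auto simp: vec_tendsto_def)
  moreover have "\<forall>\<^sub>F q in F. vec_index (u q) i + c q * vec_index (w q) i = vec_index (u q + c q \<cdot>\<^sub>v w q) i"
    using ev by eventually_elim (use i in auto)
  ultimately show "((\<lambda>q. vec_index (u q + c q \<cdot>\<^sub>v w q) i) \<longlongrightarrow> vec_index (l + d \<cdot>\<^sub>v k) i) F"
    using lk i by (auto intro: Lim_transform_eventually)
qed

lemma vec_tendsto_transform:
  assumes "vec_tendsto n u l F" "\<forall>\<^sub>F q in F. u q = w q"
  shows "vec_tendsto n w l F"
  unfolding vec_tendsto_def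
proof (intro conjI allI impI)
  show "l \<in> carrier_vec n" using assms(1) by (simp add: vec_tendsto_def)
  have "\<forall>\<^sub>F q in F. u q \<in> carrier_vec n" using assms(1) by (simp add: vec_tendsto_def)
  then show "\<forall>\<^sub>F q in F. w q \<in> carrier_vec n" using assms(2) by eventually_elim simp
  fix i assume "i < n"
  then have "((\<lambda>q. vec_index (u q) i) \<longlongrightarrow> vec_index l i) F" using assms(1) by (simp add: vec_tendsto_def)
  moreover have "\<forall>\<^sub>F q in F. vec_index (u q) i = vec_index (w q) i" using assms(2) by eventually_elim simp
  ultimately show "((\<lambda>q. vec_index (w q) i) \<longlongrightarrow> vec_index l i) F" by (rule Lim_transform_eventually)
qed

lemma rip_mult_tendsto:
  assumes "mat_tendsto n A L F" "x \<in> carrier_vec n"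
  shows "((\<lambda>q. rip (A q *\<^sub>v x) x) \<longlongrightarrow> rip (L *\<^sub>v x) x) F"
  by (intro tendsto_rip[of n] vec_tendsto_mult assms vec_tendsto_const)

lemma bdry_value_rip_nonneg:
  assumes p: "cmod p = 1" and G: "has_bdry_value n n G p" "\<And>q. q \<in> outside_disc \<Longrightarrow> G q \<in> carrier_mat n n"
    and pos: "\<And>q. q \<in> outside_disc \<Longrightarrow> 0 \<le> rip (G q *\<^sub>v x) x" and x: "x \<in> carrier_vec n"
  shows "0 \<le> rip (bdry_value n n G p *\<^sub>v x) x"
proof (rule tendsto_lowerbound)
  show "((\<lambda>q. rip (G q *\<^sub>v x) x) \<longlongrightarrow> rip (bdry_value n n G p *\<^sub>v x) x) (at p within stolz p 2)"
    by (rule rip_mult_tendsto[OF bdry_value_mat_tendsto[OF p G] x])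
  show "\<forall>\<^sub>F q in at p within stolz p 2. 0 \<le> rip (G q *\<^sub>v x) x"
    using eventually_in_stolz by (rule eventually_mono) (rule pos)
  show "at p within stolz p 2 \<noteq> bot" using p by (rule at_within_stolz_neq_bot) simp
qed

lemma bdry_value_rip_mult_le:
  assumes p: "cmod p = 1" and G: "has_bdry_value n n G p" "\<And>q. q \<in> outside_disc \<Longrightarrow> G q \<in> carrier_mat n n"
    and le: "\<And>q. q \<in> outside_disc \<Longrightarrow> rip (G q *\<^sub>v x) (G q *\<^sub>v x) \<le> D" and x: "x \<in> carrier_vec n"
  shows "rip (bdry_value n n G p *\<^sub>v x) (bdry_value n n G p *\<^sub>v x) \<le> D"
proof (rule tendsto_upperbound)
  show "((\<lambda>q. rip (G q *\<^sub>v x) (G q *\<^sub>v x)) \<longlongrightarrow> rip (bdry_value n n G p *\<^sub>v x) (bdry_value n n G p *\<^sub>v x)) (at p within stolz p 2)"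
    by (intro tendsto_rip[of n] vec_tendsto_mult bdry_value_mat_tendsto[OF p G] vec_tendsto_const[OF x])
  show "\<forall>\<^sub>F q in at p within stolz p 2. rip (G q *\<^sub>v x) (G q *\<^sub>v x) \<le> D"
    using eventually_in_stolz by (rule eventually_mono) (rule le)
  show "at p within stolz p 2 \<noteq> bot" using p by (rule at_within_stolz_neq_bot) simp
qed

lemma youla_passive_bdry:
  assumes p: "cmod p = 1"
    and P: "has_bdry_value n n P p" "\<And>q. q \<in> outside_disc \<Longrightarrow> P q \<in> carrier_mat n n"
    and Q: "has_bdry_value n n Q p" "\<And>q. q \<in> outside_disc \<Longrightarrow> Q q \<in> carrier_mat n n"
    and yp: "\<And>q. q \<in> outside_disc \<Longrightarrow> youla_passive n \<epsilon> (P q) (Q q)"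
  shows "youla_passive n \<epsilon> (bdry_value n n P p) (bdry_value n n Q p)"
  unfolding youla_passive_def
proof
  fix v :: "complex vec" assume v: "v \<in> carrier_vec n"
  let ?F = "at p within stolz p 2"
  note Pt = bdry_value_mat_tendsto[OF p P] and Qt = bdry_value_mat_tendsto[OF p Q]
  note Qv = vec_tendsto_mult[OF Qt vec_tendsto_const[OF v]]
  show "2 * rip (bdry_value n n P p *\<^sub>v (bdry_value n n Q p *\<^sub>v v)) (bdry_value n n Q p *\<^sub>v v) +
        \<epsilon> * rip (bdry_value n n Q p *\<^sub>v v) (bdry_value n n Q p *\<^sub>v v) \<le> 2 * rip (bdry_value n n Q p *\<^sub>v v) v"
  proof (rule tendsto_le[of ?F])
    show "?F \<noteq> bot" using p by (rule at_within_stolz_neq_bot) simp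
    show "((\<lambda>q. 2 * rip (Q q *\<^sub>v v) v) \<longlongrightarrow> 2 * rip (bdry_value n n Q p *\<^sub>v v) v) ?F"
      by (intro tendsto_intros tendsto_rip[OF Qv] vec_tendsto_const[OF v])
    show "((\<lambda>q. 2 * rip (P q *\<^sub>v (Q q *\<^sub>v v)) (Q q *\<^sub>v v) + \<epsilon> * rip (Q q *\<^sub>v v) (Q q *\<^sub>v v)) \<longlongrightarrow>
        2 * rip (bdry_value n n P p *\<^sub>v (bdry_value n n Q p *\<^sub>v v)) (bdry_value n n Q p *\<^sub>v v) +
        \<epsilon> * rip (bdry_value n n Q p *\<^sub>v v) (bdry_value n n Q p *\<^sub>v v)) ?F"
      by (intro tendsto_intros tendsto_rip[OF Qv Qv] tendsto_rip[OF vec_tendsto_mult[OF Pt Qv] Qv])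
    show "\<forall>\<^sub>F q in ?F. 2 * rip (P q *\<^sub>v (Q q *\<^sub>v v)) (Q q *\<^sub>v v) + \<epsilon> * rip (Q q *\<^sub>v v) (Q q *\<^sub>v v) \<le> 2 * rip (Q q *\<^sub>v v) v"
      using eventually_in_stolz by (rule eventually_mono) (use yp v in \<open>auto simp: youla_passive_def\<close>)
  qed
qed

text \<open>The inequality \<open>Q + Q\<^sup>H \<ge> Q\<^sup>H (P + P\<^sup>H + \<epsilon> I) Q\<close> is not a positive-realness condition, but for invertible \<open>Q\<close>
  it says that \<open>Q\<^sup>-\<^sup>1 - P - \<epsilon> I / 2\<close> is positive real. The shift \<open>Q + \<delta> I\<close> makes the inverse bounded and
  costs only an arbitrarily small part of \<open>\<epsilon>\<close>.\<close>

lemma youla_passive_interior: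
  assumes PH: "Hinf outside_disc n n P" and QH: "Hinf outside_disc n n Q"
    and pos: "\<And>q v. q \<in> outside_disc \<Longrightarrow> v \<in> carrier_vec n \<Longrightarrow> 0 \<le> rip (P q *\<^sub>v v) v"
    and \<epsilon>: "0 < \<epsilon>"
    and bd: "\<And>p. cmod p = 1 \<Longrightarrow> has_bdry_value n n P p \<Longrightarrow> has_bdry_value n n Q p \<Longrightarrow>
       youla_passive n \<epsilon> (bdry_value n n P p) (bdry_value n n Q p)"
    and q: "q \<in> outside_disc"
  shows "youla_passive n \<epsilon> (P q) (Q q)"
proof -
  obtain B where B: "0 \<le> B" "\<And>q i j. q \<in> outside_disc \<Longrightarrow> i < n \<Longrightarrow> j < n \<Longrightarrow> cmod (P q $$ (i,j)) \<le> B"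
    and Pc: "\<And>q. q \<in> outside_disc \<Longrightarrow> P q \<in> carrier_mat n n"
    and Ph: "\<And>i j. i < n \<Longrightarrow> j < n \<Longrightarrow> (\<lambda>q. P q $$ (i,j)) holomorphic_on outside_disc"
    using HinfE[OF PH] by metis
  have Qc: "\<And>q. q \<in> outside_disc \<Longrightarrow> Q q \<in> carrier_mat n n"
    and Qh: "\<And>i j. i < n \<Longrightarrow> j < n \<Longrightarrow> (\<lambda>q. Q q $$ (i,j)) holomorphic_on outside_disc"
    using HinfE[OF QH] by metis+
  define D where "D = real n ^ 3 * B\<^sup>2"
  have "0 \<le> D" by (simp add: D_def)
  have PD: "rip (P q *\<^sub>v u) (P q *\<^sub>v u) \<le> D * rip u u" if "q \<in> outside_disc" "u \<in> carrier_vec n" for q u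
    unfolding D_def using that B by (intro rip_mult_le_of_entries Pc) auto
  obtain NP where NP: "negligible NP" "\<And>t. t \<notin> NP \<Longrightarrow> has_bdry_value n n P (cis t)"
    using Hinf_has_bdry_value_ae[OF PH] by blast
  obtain NQ where NQ: "negligible NQ" "\<And>t. t \<notin> NQ \<Longrightarrow> has_bdry_value n n Q (cis t)"
    using Hinf_has_bdry_value_ae[OF QH] by blast
  have Ppos: "0 \<le> rip (bdry_value n n P p *\<^sub>v v) v" if "cmod p = 1" "has_bdry_value n n P p" "v \<in> carrier_vec n" for p v
    using bdry_value_rip_nonneg[OF that(1,2) Pc pos] that by blast
  have Qpos_b: "0 \<le> rip (bdry_value n n Q p *\<^sub>v v) v"
    if p: "cmod p = 1" and "has_bdry_value n n P p" "has_bdry_value n n Q p" and v: "v \<in> carrier_vec n" for p v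
  proof -
    have "osp n \<epsilon> (bdry_value n n Q p)"
      by (rule youla_passive_imp_osp[OF _ _ bd]) (use that Ppos in auto)
    then have "\<epsilon> * rip (bdry_value n n Q p *\<^sub>v v) (bdry_value n n Q p *\<^sub>v v) \<le> 2 * rip (bdry_value n n Q p *\<^sub>v v) v"
      using v by (simp add: osp_def)
    moreover have "0 \<le> \<epsilon> * rip (bdry_value n n Q p *\<^sub>v v) (bdry_value n n Q p *\<^sub>v v)"
      using \<epsilon> rip_self_nonneg by simp
    ultimately show ?thesis by linarith
  qed
  have Qpos: "0 \<le> rip (Q q *\<^sub>v v) v" if "q \<in> outside_disc" "v \<in> carrier_vec n" for q v
    by (rule Hinf_positive_real[OF QH NP(1) _ that]) (use Qpos_b NP(2) in auto)
  have shifted: "rip (P q *\<^sub>v x) x + \<epsilon>' / 2 * rip x x \<le> rip y x"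
    if "0 < \<epsilon>'" "0 < \<delta>" "\<delta> * (D + 1 + \<epsilon>') \<le> 1" "\<delta> * (D + 1 + \<epsilon>')\<^sup>2 \<le> \<epsilon> - \<epsilon>'"
      and y: "y \<in> carrier_vec n" and x: "x = Q q *\<^sub>v y + complex_of_real \<delta> \<cdot>\<^sub>v y" for \<epsilon>' \<delta> x y
  proof -
    define A where "A = (\<lambda>q. Q q + complex_of_real \<delta> \<cdot>\<^sub>m 1\<^sub>m n)"
    have Ac: "A q \<in> carrier_mat n n" if "q \<in> outside_disc" for q using Qc[OF that] by (simp add: A_def)
    have Av: "A q *\<^sub>v v = Q q *\<^sub>v v + complex_of_real \<delta> \<cdot>\<^sub>v v" if "q \<in> outside_disc" "v \<in> carrier_vec n" for q v
      unfolding A_def using Qc[OF that(1)] that(2)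
      by (simp add: add_mult_distrib_mat_vec[of _ n n] smult_mat_mult_vec[of _ n n])
    \<comment> \<open>Coercivity with constant \<delta> gives both the invertibility of
      \<open>A\<close> and the bound 1 / \<delta> on its inverse \<open>W\<close>.\<close>
    have coer: "\<delta> * rip v v \<le> rip (A q *\<^sub>v v) v" if "q \<in> outside_disc" "v \<in> carrier_vec n" for q v
      using Qpos[OF that] Qc[OF that(1)] that(2) unfolding Av[OF that]
      by (simp add: rip_add_left[of _ n] rip_smult_left[of _ n])
    have det: "Determinant.det (A q) \<noteq> 0" if q: "q \<in> outside_disc" for q
    proof (rule det_nonzeroI[OF Ac[OF q]])
      fix v assume v: "v \<in> carrier_vec n" and "A q *\<^sub>v v = 0\<^sub>v n"
      then have "\<delta> * rip v v \<le> 0" using coer[OF q v] by (simp add: rip_def)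
      then have "rip v v \<le> 0" using \<open>0 < \<delta>\<close> by (simp add: mult_le_0_iff)
      then show "v = 0\<^sub>v n" by (rule rip_self_eq_0[OF v])
    qed
    define W where "W = (\<lambda>q. mat_inv (A q))"
    have Wc: "W q \<in> carrier_mat n n" if "q \<in> outside_disc" for q
      using mat_inv_det(1)[OF Ac[OF that] det[OF that]] by (simp add: W_def)
    have AW: "Q q *\<^sub>v (W q *\<^sub>v v) + complex_of_real \<delta> \<cdot>\<^sub>v (W q *\<^sub>v v) = v" if "q \<in> outside_disc" "v \<in> carrier_vec n" for q v
      using mat_inv_vec(2)[OF Ac[OF that(1)] det[OF that(1)] that(2)] Av[OF that(1), of "W q *\<^sub>v v"] Wc[OF that(1)] that(2)
      by (simp add: W_def)
    have Wb: "cmod (W q $$ (i,j)) \<le> 1 / \<delta>" if q: "q \<in> outside_disc" and ij: "i < n" "j < n" for q i j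
    proof (rule entries_le_of_rip[OF Wc[OF q] _ _ ij])
      fix v :: "complex vec" assume v: "v \<in> carrier_vec n"
      have w: "W q *\<^sub>v v \<in> carrier_vec n" using Wc[OF q] v by simp
      have "\<delta> * rip (W q *\<^sub>v v) (W q *\<^sub>v v) \<le> rip v (W q *\<^sub>v v)"
        using coer[OF q w] AW[OF q v] Av[OF q w] by simp
      moreover have "2 * rip v (W q *\<^sub>v v) \<le> rip v v / \<delta> + \<delta> * rip (W q *\<^sub>v v) (W q *\<^sub>v v)"
        using v w \<open>0 < \<delta>\<close> by (rule rip_young)
      ultimately have "\<delta> * rip (W q *\<^sub>v v) (W q *\<^sub>v v) \<le> rip v v / \<delta>" by linarith
      then have "1 / \<delta> * (\<delta> * rip (W q *\<^sub>v v) (W q *\<^sub>v v)) \<le> 1 / \<delta> * (rip v v / \<delta>)"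
        using \<open>0 < \<delta>\<close> by (intro mult_left_mono) auto
      then show "rip (W q *\<^sub>v v) (W q *\<^sub>v v) \<le> (1 / \<delta>)\<^sup>2 * rip v v"
        using \<open>0 < \<delta>\<close> by (simp add: power2_eq_square)
    qed (use \<open>0 < \<delta>\<close> in simp)
    have Wh: "(\<lambda>q. W q $$ (i,j)) holomorphic_on outside_disc" if ij: "i < n" "j < n" for i j
      unfolding W_def
    proof (rule holomorphic_mat_inv[OF Ac _ det ij])
      fix i j assume ij: "i < n" "j < n"
      have "(\<lambda>q. Q q $$ (i,j) + complex_of_real \<delta> * (1\<^sub>m n $$ (i,j))) holomorphic_on outside_disc"
        by (intro holomorphic_intros Qh ij)
      moreover have "Q q $$ (i,j) + complex_of_real \<delta> * (1\<^sub>m n $$ (i,j)) = A q $$ (i,j)" if "q \<in> outside_disc" for q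
        using Qc[OF that] ij by (simp add: A_def)
      ultimately show "(\<lambda>q. A q $$ (i,j)) holomorphic_on outside_disc" by (simp cong: holomorphic_cong)
    qed
    have WH: "Hinf outside_disc n n W" unfolding Hinf_def using Wc Wh Wb by blast
    obtain NW where NW: "negligible NW" "\<And>t. t \<notin> NW \<Longrightarrow> has_bdry_value n n W (cis t)"
      using Hinf_has_bdry_value_ae[OF WH] by blast
    define c where "c = \<epsilon>' / 2"
    \<comment> \<open>At \<open>x = A y\<close> its quadratic form is
      \<open>rip y x - rip (P x) x - c * rip x x\<close>, so positive realness of \<open>G\<close>
      is the desired inequality.\<close>
    define G where "G = (\<lambda>q. W q - P q - complex_of_real c \<cdot>\<^sub>m 1\<^sub>m n)"
    have Gc: "G q \<in> carrier_mat n n" for q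
      unfolding G_def by (intro minus_carrier_mat smult_carrier_mat one_carrier_mat)
    have Gi: "G q $$ (i,j) = W q $$ (i,j) - P q $$ (i,j) - complex_of_real c * (1\<^sub>m n $$ (i,j))"
      if "q \<in> outside_disc" "i < n" "j < n" for q i j
      using Wc[OF that(1)] Pc[OF that(1)] that by (simp add: G_def)
    have Grip: "rip (G q *\<^sub>v v) v = rip (W q *\<^sub>v v) v - rip (P q *\<^sub>v v) v - c * rip v v"
      if "q \<in> outside_disc" "v \<in> carrier_vec n" for q v
    proof -
      note c = Wc[OF that(1)] Pc[OF that(1)] that(2)
      have "G q *\<^sub>v v = W q *\<^sub>v v - P q *\<^sub>v v - complex_of_real c \<cdot>\<^sub>v v"
        unfolding G_def using c
        by (subst minus_mult_distrib_mat_vec[OF minus_carrier_mat[OF c(2)] _ c(3)])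
           (simp_all add: minus_mult_distrib_mat_vec[OF c(1,2,3)] smult_mat_mult_vec[of _ n n])
      then show ?thesis
        using c by (simp add: rip_diff_left[of _ n] rip_smult_left[of _ n])
    qed
    have GH: "Hinf outside_disc n n G"
      unfolding Hinf_def
    proof (intro conjI ballI allI impI exI)
      fix q i j assume q: "q \<in> outside_disc" and ij: "i < n" "j < n"
      have "cmod (G q $$ (i,j)) \<le> cmod (W q $$ (i,j) - P q $$ (i,j)) + cmod (complex_of_real c * (1\<^sub>m n $$ (i,j)))"
        unfolding Gi[OF q ij] by (rule norm_triangle_ineq4)
      also have "cmod (W q $$ (i,j) - P q $$ (i,j)) \<le> 1 / \<delta> + B"
        using norm_triangle_ineq4[of "W q $$ (i,j)" "P q $$ (i,j)"] Wb[OF q ij] B(2)[OF q ij] by linarith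
      also have "cmod (complex_of_real c * (1\<^sub>m n $$ (i,j))) \<le> \<bar>c\<bar>" using ij by (simp add: norm_mult)
      finally show "cmod (G q $$ (i,j)) \<le> 1 / \<delta> + B + \<bar>c\<bar>" by simp
    next
      fix i j assume ij: "i < n" "j < n"
      have "(\<lambda>q. W q $$ (i,j) - P q $$ (i,j) - complex_of_real c * (1\<^sub>m n $$ (i,j))) holomorphic_on outside_disc"
        by (intro holomorphic_intros Wh Ph ij)
      then show "(\<lambda>q. G q $$ (i,j)) holomorphic_on outside_disc" using Gi ij by (simp cong: holomorphic_cong)
    qed (rule Gc)
    have "0 \<le> rip (G q *\<^sub>v x) x"
    proof (rule Hinf_positive_real[OF GH _ _ q])
      show "negligible (NP \<union> NQ \<union> NW)" using NP NQ NW by simp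
      show "x \<in> carrier_vec n" using x y Qc[OF q] by simp
      fix t and v :: "complex vec" assume t: "t \<notin> NP \<union> NQ \<union> NW" and Gb: "has_bdry_value n n G (cis t)" and v: "v \<in> carrier_vec n"
      define p where "p = cis t"
      have p: "cmod p = 1" by (simp add: p_def)
      have hb: "has_bdry_value n n P p" "has_bdry_value n n Q p" "has_bdry_value n n W p" "has_bdry_value n n G p"
        using t NP NQ NW Gb by (auto simp: p_def)
      define P' Q' W' where "P' = bdry_value n n P p" and "Q' = bdry_value n n Q p" and "W' = bdry_value n n W p"
      let ?F = "at p within stolz p 2"
      have nb: "?F \<noteq> bot" using p by (rule at_within_stolz_neq_bot) simp
      have Wt: "mat_tendsto n W W' ?F" unfolding W'_def by (rule bdry_value_mat_tendsto[OF p hb(3) Wc])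
      have Pt: "mat_tendsto n P P' ?F" unfolding P'_def by (rule bdry_value_mat_tendsto[OF p hb(1) Pc])
      have Qt: "mat_tendsto n Q Q' ?F" unfolding Q'_def by (rule bdry_value_mat_tendsto[OF p hb(2) Qc])
      have Wv: "vec_tendsto n (\<lambda>q. W q *\<^sub>v v) (W' *\<^sub>v v) ?F"
        by (rule vec_tendsto_mult[OF Wt vec_tendsto_const[OF v]])
      \<comment> \<open>The relation between the boundary values \<open>W'\<close> and
        \<open>Q'\<close> is obtained as the limit of \<open>A W v = v\<close>. It exhibits
        \<open>v\<close> as the shifted vector built from \<open>W' v\<close>, to which the estimate
        applies.\<close>
      have "vec_tendsto n (\<lambda>q. Q q *\<^sub>v (W q *\<^sub>v v) + complex_of_real \<delta> \<cdot>\<^sub>v (W q *\<^sub>v v))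
              (Q' *\<^sub>v (W' *\<^sub>v v) + complex_of_real \<delta> \<cdot>\<^sub>v (W' *\<^sub>v v)) ?F"
        by (intro vec_tendsto_add_smult vec_tendsto_mult[OF Qt Wv] Wv tendsto_const)
      then have "vec_tendsto n (\<lambda>_. v) (Q' *\<^sub>v (W' *\<^sub>v v) + complex_of_real \<delta> \<cdot>\<^sub>v (W' *\<^sub>v v)) ?F"
        by (rule vec_tendsto_transform) (rule eventually_mono[OF eventually_in_stolz], rule AW[OF _ v])
      then have veq: "v = Q' *\<^sub>v (W' *\<^sub>v v) + complex_of_real \<delta> \<cdot>\<^sub>v (W' *\<^sub>v v)"
        by (rule vec_tendsto_unique[OF nb vec_tendsto_const[OF v]])
      have W'v: "W' *\<^sub>v v \<in> carrier_vec n" using Wv by (simp add: vec_tendsto_def)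
      have "((\<lambda>q. rip (W q *\<^sub>v v) v - rip (P q *\<^sub>v v) v - c * rip v v) \<longlongrightarrow> rip (W' *\<^sub>v v) v - rip (P' *\<^sub>v v) v - c * rip v v) ?F"
        by (intro tendsto_intros rip_mult_tendsto[OF Wt v] rip_mult_tendsto[OF Pt v])
      moreover have "\<forall>\<^sub>F q in ?F. rip (W q *\<^sub>v v) v - rip (P q *\<^sub>v v) v - c * rip v v = rip (G q *\<^sub>v v) v"
        using eventually_in_stolz by eventually_elim (rule Grip[symmetric, OF _ v])
      ultimately have "((\<lambda>q. rip (G q *\<^sub>v v) v) \<longlongrightarrow> rip (W' *\<^sub>v v) v - rip (P' *\<^sub>v v) v - c * rip v v) ?F"
        by (rule Lim_transform_eventually)
      then have Geq: "rip (bdry_value n n G p *\<^sub>v v) v = rip (W' *\<^sub>v v) v - rip (P' *\<^sub>v v) v - c * rip v v"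
        using rip_mult_tendsto[OF bdry_value_mat_tendsto[OF p hb(4) Gc] v] by (intro tendsto_unique[OF nb])
      have "rip (P' *\<^sub>v v) v + \<epsilon>' / 2 * rip v v \<le> rip (W' *\<^sub>v v) v"
      proof (rule youla_shift_estimate[OF _ _ W'v _ _ \<open>0 \<le> D\<close> refl that(1-4) veq])
        show "P' \<in> carrier_mat n n" "Q' \<in> carrier_mat n n" by (simp_all add: P'_def Q'_def)
        show "youla_passive n \<epsilon> P' Q'" unfolding P'_def Q'_def by (rule bd[OF p hb(1,2)])
        show "rip (P' *\<^sub>v u) (P' *\<^sub>v u) \<le> D * rip u u" if "u \<in> carrier_vec n" for u
          unfolding P'_def using bdry_value_rip_mult_le[OF p hb(1) Pc PD] that by blast
      qed
      then show "0 \<le> rip (bdry_value n n G (cis t) *\<^sub>v v) v"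
        using Geq by (simp add: c_def p_def)
    qed
    moreover have "W q *\<^sub>v x = y"
      using mat_inv_vec(3)[OF Ac[OF q] det[OF q] y] unfolding Av[OF q y] x W_def .
    moreover have xc: "x \<in> carrier_vec n" using x y Qc[OF q] by simp
    ultimately show ?thesis using Grip[OF q xc] by (simp add: c_def)
  qed
  show ?thesis
    unfolding youla_passive_def
  proof
    fix y :: "complex vec" assume y: "y \<in> carrier_vec n"
    define a where "a = Q q *\<^sub>v y"
    have a: "a \<in> carrier_vec n" using Qc[OF q] y by (simp add: a_def)
    \<comment> \<open>First \<delta> tends to 0 with \<epsilon>' fixed, then \<epsilon>' tends to
      \<epsilon>; at \<epsilon>' = \<epsilon> itself the smallness conditions admit no positive
      \<delta>.\<close>
    have step: "rip (P q *\<^sub>v a) a + \<epsilon>' / 2 * rip a a \<le> rip y a" if \<epsilon>': "0 < \<epsilon>'" "\<epsilon>' < \<epsilon>" for \<epsilon>'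
    proof (rule tendsto_le[of "at_right (0::real)"])
      define x where "x = (\<lambda>\<delta>. a + complex_of_real \<delta> \<cdot>\<^sub>v y)"
      have "((\<lambda>\<delta>. complex_of_real \<delta>) \<longlongrightarrow> complex_of_real 0) (at_right 0)" by (intro tendsto_intros)
      then have "vec_tendsto n x (a + complex_of_real 0 \<cdot>\<^sub>v y) (at_right 0)"
        unfolding x_def by (intro vec_tendsto_add_smult vec_tendsto_const a y)
      moreover have "a + complex_of_real 0 \<cdot>\<^sub>v y = a" using a y by (intro eq_vecI) auto
      ultimately have xt: "vec_tendsto n x a (at_right 0)" by simp
      show "((\<lambda>\<delta>. rip y (x \<delta>)) \<longlongrightarrow> rip y a) (at_right 0)"
        by (intro tendsto_rip[of n] xt vec_tendsto_const y)
      show "((\<lambda>\<delta>. rip (P q *\<^sub>v x \<delta>) (x \<delta>) + \<epsilon>' / 2 * rip (x \<delta>) (x \<delta>)) \<longlongrightarrow> rip (P q *\<^sub>v a) a + \<epsilon>' / 2 * rip a a) (at_right 0)"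
        by (intro tendsto_intros tendsto_rip[OF xt xt] tendsto_rip[OF vec_tendsto_mult[OF mat_tendsto_const[OF Pc[OF q]] xt] xt]) auto
      define C where "C = D + 1 + \<epsilon>'"
      have "0 < C" using \<open>0 \<le> D\<close> \<epsilon>' by (simp add: C_def)
      \<comment> \<open>The two entries of the minimum are the two smallness conditions of
        \<open>shifted\<close>.\<close>
      define \<delta>0 where "\<delta>0 = min (1 / C) ((\<epsilon> - \<epsilon>') / C\<^sup>2)"
      have "0 < \<delta>0" using \<open>0 < C\<close> \<epsilon>' by (simp add: \<delta>0_def)
      show "\<forall>\<^sub>F \<delta> in at_right 0. rip (P q *\<^sub>v x \<delta>) (x \<delta>) + \<epsilon>' / 2 * rip (x \<delta>) (x \<delta>) \<le> rip y (x \<delta>)"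
      proof (rule eventually_at_rightI[OF _ \<open>0 < \<delta>0\<close>])
        fix \<delta> assume "\<delta> \<in> {0<..<\<delta>0}"
        then have d: "0 < \<delta>" "\<delta> \<le> 1 / C" "\<delta> \<le> (\<epsilon> - \<epsilon>') / C\<^sup>2" by (auto simp: \<delta>0_def)
        have "\<delta> * C \<le> 1" "\<delta> * C\<^sup>2 \<le> \<epsilon> - \<epsilon>'"
          using d \<open>0 < C\<close> by (simp_all add: pos_le_divide_eq)
        then show "rip (P q *\<^sub>v x \<delta>) (x \<delta>) + \<epsilon>' / 2 * rip (x \<delta>) (x \<delta>) \<le> rip y (x \<delta>)"
          using d \<epsilon>' y by (intro shifted) (auto simp: C_def x_def a_def)
      qed
    qed simp
    have "rip (P q *\<^sub>v a) a + \<epsilon> / 2 * rip a a \<le> rip y a"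
    proof (rule tendsto_le[of "at_left \<epsilon>"])
      show "((\<lambda>\<epsilon>'. rip (P q *\<^sub>v a) a + \<epsilon>' / 2 * rip a a) \<longlongrightarrow> rip (P q *\<^sub>v a) a + \<epsilon> / 2 * rip a a) (at_left \<epsilon>)"
        by (intro tendsto_intros) auto
      show "\<forall>\<^sub>F \<epsilon>' in at_left \<epsilon>. rip (P q *\<^sub>v a) a + \<epsilon>' / 2 * rip a a \<le> rip y a"
        by (rule eventually_at_leftI[of 0]) (use step \<epsilon> in auto)
    qed auto
    then show "2 * rip (P q *\<^sub>v (Q q *\<^sub>v y)) (Q q *\<^sub>v y) + \<epsilon> * rip (Q q *\<^sub>v y) (Q q *\<^sub>v y) \<le> 2 * rip (Q q *\<^sub>v y) y"
      using rip_commute[OF y a] unfolding a_def by simp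
  qed
qed

subsection \<open>Bilinear transformation and meromorphic feedback laws\<close>

lemma open_outside_disc: "open outside_disc"
  unfolding outside_disc_def by (intro open_Collect_less continuous_intros)

lemma connected_outside_disc: "connected outside_disc"
proof -
  have eq: "outside_disc = - cball 0 1" by (auto simp: outside_disc_def)
  show ?thesis unfolding eq by (rule connected_complement_bounded_convex) auto
qed

lemma open_right_half_plane: "open right_half_plane"
  unfolding right_half_plane_def by (intro open_Collect_less continuous_intros)

definition bilin :: "real \<Rightarrow> complex \<Rightarrow> complex" where
  "bilin \<tau> q = 1 / (2 * complex_of_real \<tau>) * ((q - 1) / (q + 1))"

definition bilin_inv :: "real \<Rightarrow> complex \<Rightarrow> complex" where
  "bilin_inv \<tau> s = (1 + 2 * complex_of_real \<tau> * s) / (1 - 2 * complex_of_real \<tau> * s)"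

lemma bilinear_transform_eq: "bilinear_transform \<tau> G q = G (bilin \<tau> q)"
  by (simp add: bilinear_transform_def bilin_def)

lemma outside_disc_neq_minus_1: "q \<in> outside_disc \<Longrightarrow> q + 1 \<noteq> 0"
  by (auto simp: outside_disc_def add_eq_0_iff2)

lemma bilin_in_right_half_plane:
  assumes "0 < \<tau>" "q \<in> outside_disc"
  shows "bilin \<tau> q \<in> right_half_plane"
proof -
  have q1: "q + 1 \<noteq> 0" by (rule outside_disc_neq_minus_1[OF assms(2)])
  have "Re ((q - 1) / (q + 1)) = ((cmod q)\<^sup>2 - 1) / (cmod (q + 1))\<^sup>2"
    unfolding Re_divide cmod_power2 by (simp add: power2_eq_square algebra_simps)
  moreover have "0 < ((cmod q)\<^sup>2 - 1) / (cmod (q + 1))\<^sup>2"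
    using q1 assms(2) by (intro divide_pos_pos) (auto simp: outside_disc_def one_less_power)
  ultimately have pos: "0 < Re ((q - 1) / (q + 1))" by simp
  have "bilin \<tau> q = complex_of_real (1 / (2 * \<tau>)) * ((q - 1) / (q + 1))" by (simp add: bilin_def)
  then have "Re (bilin \<tau> q) = 1 / (2 * \<tau>) * Re ((q - 1) / (q + 1))" by (simp only: Re_complex_of_real_mult)
  then show ?thesis using pos assms(1) by (simp add: right_half_plane_def)
qed

lemma bilin_inv_denom: "1 - 2 * complex_of_real \<tau> * s = 0 \<longleftrightarrow> s = 1 / (2 * complex_of_real \<tau>)" if "0 < \<tau>"
  using that by (auto simp: field_simps)

lemma bilin_bilin_inv:
  assumes "0 < \<tau>" "s \<noteq> 1 / (2 * complex_of_real \<tau>)"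
  shows "bilin \<tau> (bilin_inv \<tau> s) = s"
proof -
  define d where "d = 1 - 2 * complex_of_real \<tau> * s"
  have d: "d \<noteq> 0" using bilin_inv_denom[OF assms(1)] assms(2) by (simp add: d_def)
  have e: "bilin_inv \<tau> s = (2 - d) / d" by (simp add: bilin_inv_def d_def)
  have n: "bilin_inv \<tau> s - 1 = (2 - 2 * d) / d" "bilin_inv \<tau> s + 1 = 2 / d"
    using d by (simp_all add: e field_simps)
  have "(bilin_inv \<tau> s - 1) / (bilin_inv \<tau> s + 1) = 1 - d" unfolding n using d by (simp add: field_simps)
  then show ?thesis using assms(1) by (simp add: bilin_def d_def)
qed

lemma bilin_inv_in_outside_disc:
  assumes "0 < \<tau>" "s \<in> right_half_plane" "s \<noteq> 1 / (2 * complex_of_real \<tau>)"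
  shows "bilin_inv \<tau> s \<in> outside_disc"
proof -
  define z where "z = 2 * complex_of_real \<tau> * s"
  have "z = complex_of_real (2 * \<tau>) * s" by (simp add: z_def)
  then have "Re z = 2 * \<tau> * Re s" by (simp only: Re_complex_of_real_mult)
  then have "0 < Re z" using assms by (simp add: right_half_plane_def)
  have "(cmod (1 - z))\<^sup>2 < (cmod (1 + z))\<^sup>2"
    unfolding cmod_power2 using \<open>0 < Re z\<close> by (simp add: power2_eq_square algebra_simps)
  then have "cmod (1 - z) < cmod (1 + z)" by (rule power2_less_imp_less) simp
  moreover have "1 - z \<noteq> 0" using bilin_inv_denom[OF assms(1)] assms(3) by (simp add: z_def)
  ultimately show ?thesis by (simp add: outside_disc_def bilin_inv_def z_def[symmetric] norm_divide)
qed

lemma bilin_holomorphic: "bilin \<tau> holomorphic_on outside_disc"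
  unfolding bilin_def[abs_def] divide_inverse[of 1]
  using outside_disc_neq_minus_1 by (intro holomorphic_intros) auto

lemma Hinf_bilinear_transform:
  assumes "0 < \<tau>" "Hinf right_half_plane nr nc G"
  shows "Hinf outside_disc nr nc (bilinear_transform \<tau> G)"
proof -
  obtain B where B: "\<And>q i j. q \<in> right_half_plane \<Longrightarrow> i < nr \<Longrightarrow> j < nc \<Longrightarrow> cmod (G q $$ (i,j)) \<le> B"
    and c: "\<And>q. q \<in> right_half_plane \<Longrightarrow> G q \<in> carrier_mat nr nc"
    and h: "\<And>i j. i < nr \<Longrightarrow> j < nc \<Longrightarrow> (\<lambda>q. G q $$ (i,j)) holomorphic_on right_half_plane"
    using HinfE[OF assms(2)] by metis
  note b = bilin_in_right_half_plane[OF assms(1)]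
  have "(\<lambda>q. G (bilin \<tau> q) $$ (i,j)) holomorphic_on outside_disc" if "i < nr" "j < nc" for i j
    using holomorphic_on_compose_gen[OF bilin_holomorphic h[OF that]] b by (force simp: o_def)
  then show ?thesis
    unfolding Hinf_def bilinear_transform_eq using c B b by blast
qed

section \<open>Boundary values of rational transfer functions\<close>

lemma finite_resolvent_singularities:
  assumes A: "A \<in> carrier_mat n n"
  shows "finite {s. Determinant.det (s \<cdot>\<^sub>m 1\<^sub>m n - A) = (0::complex)}"
proof (rule finite_subset)
  show "{s. Determinant.det (s \<cdot>\<^sub>m 1\<^sub>m n - A) = 0} \<subseteq> {s. poly (char_poly A) s = 0}"
  proof
    fix s assume "s \<in> {s. Determinant.det (s \<cdot>\<^sub>m 1\<^sub>m n - A) = 0}"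
    then have "Determinant.det (s \<cdot>\<^sub>m 1\<^sub>m n - A) = 0" by simp
    moreover have "s \<cdot>\<^sub>m 1\<^sub>m n - A \<in> carrier_mat n n" using A by (intro minus_carrier_mat)
    ultimately obtain v where v: "v \<in> carrier_vec n" "v \<noteq> 0\<^sub>v n" "(s \<cdot>\<^sub>m 1\<^sub>m n - A) *\<^sub>v v = 0\<^sub>v n"
      using det_0_iff_vec_prod_zero_field by blast
    have "(s \<cdot>\<^sub>m 1\<^sub>m n - A) *\<^sub>v v = s \<cdot>\<^sub>v v - A *\<^sub>v v"
      using v A by (simp add: minus_mult_distrib_mat_vec[of _ n n] smult_mat_mult_vec[of _ n n])
    then have "s \<cdot>\<^sub>v v - A *\<^sub>v v = 0\<^sub>v n" using v by simp
    have "A *\<^sub>v v = s \<cdot>\<^sub>v v"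
    proof (rule eq_vecI)
      show "dim_vec (A *\<^sub>v v) = dim_vec (s \<cdot>\<^sub>v v)" using A v by simp
      fix i assume "i < dim_vec (s \<cdot>\<^sub>v v)"
      then have i: "i < n" using v by simp
      have "vec_index (s \<cdot>\<^sub>v v - A *\<^sub>v v) i = 0" using \<open>s \<cdot>\<^sub>v v - A *\<^sub>v v = 0\<^sub>v n\<close> i by simp
      then show "vec_index (A *\<^sub>v v) i = vec_index (s \<cdot>\<^sub>v v) i"
        using i A v by simp
    qed
    then have "eigenvalue A s" using v A by (auto simp: eigenvalue_def eigenvector_def)
    then show "s \<in> {s. poly (char_poly A) s = 0}" using eigenvalue_root_char_poly[OF A] by simp
  qed
  have "char_poly A \<noteq> 0" using degree_monic_char_poly[OF A] by (auto dest: arg_cong[of _ 0 lead_coeff])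
  then show "finite {s. poly (char_poly A) s = 0}" by (rule poly_roots_finite)
qed

lemma eventually_bilin_notin_finite:
  assumes "finite Z" "0 < \<tau>"
  shows "\<forall>\<^sub>F q in at p. bilin \<tau> q \<notin> Z"
proof -
  \<comment> \<open>At q = -1 division by zero gives \<open>bilin\<close> the value 0, so -1 may
    belong to the preimage; everywhere else \<open>bilin_inv\<close> recovers q.\<close>
  have "{q. bilin \<tau> q \<in> Z} \<subseteq> insert (-1) (bilin_inv \<tau> ` Z)"
  proof
    fix q assume q: "q \<in> {q. bilin \<tau> q \<in> Z}"
    show "q \<in> insert (-1) (bilin_inv \<tau> ` Z)"
    proof (cases "q = -1")
      case False
      then have "q + 1 \<noteq> 0" by (simp add: add_eq_0_iff2)
      define r where "r = (q - 1) / (q + 1)"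
      have "2 * complex_of_real \<tau> * bilin \<tau> q = r" using assms(2) by (simp add: bilin_def r_def)
      then have e: "bilin_inv \<tau> (bilin \<tau> q) = (1 + r) / (1 - r)" by (simp add: bilin_inv_def)
      have "1 + r = 2 * q / (q + 1)" "1 - r = 2 / (q + 1)"
        using \<open>q + 1 \<noteq> 0\<close> by (simp_all add: r_def field_simps)
      then have "bilin_inv \<tau> (bilin \<tau> q) = q" unfolding e using \<open>q + 1 \<noteq> 0\<close> by simp
      then show ?thesis using q by (metis imageI insertCI mem_Collect_eq)
    qed simp
  qed
  then have "finite {q. bilin \<tau> q \<in> Z}" using assms(1) by (simp add: finite_subset)
  then have "\<not> p islimpt {q. bilin \<tau> q \<in> Z}" by (rule islimpt_finite)
  then show ?thesis by (simp add: islimpt_iff_eventually)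
qed

text \<open>Cramer's rule exhibits each entry near \<open>p\<close> as a meromorphic function of
  \<open>q\<close>, also at \<open>p = -1\<close>, which corresponds to s = \<infinity>. The
  resolvent is singular at finitely many points only, and the \<open>Hinf\<close> bound excludes a
  pole, so the boundary value exists at every point of the circle.\<close>

lemma transfer_bilinear_has_bdry_value:
  assumes dims: "realization_dims nx ni no P" and H: "Hinf right_half_plane n n (transfer P i j)"
    and n: "ni i = n" "no j = n" and \<tau>: "0 < \<tau>" and p: "cmod p = 1"
  shows "has_bdry_value n n (bilinear_transform \<tau> (transfer P i j)) p"
  unfolding has_bdry_value_def
proof (intro allI impI)
  fix k l assume kl: "k < n" "l < n"
  define A B C D where "A = ssA P" and "B = ssB P i" and "C = ssC P j" and "D = ssD P i j"
  have "ssA P \<in> carrier_mat nx nx" "ssB P i \<in> carrier_mat nx (ni i)" "ssC P j \<in> carrier_mat (no j) nx"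
    "ssD P i j \<in> carrier_mat (no j) (ni i)"
    using dims unfolding realization_dims_def by blast+
  then have dim: "A \<in> carrier_mat nx nx" "B \<in> carrier_mat nx n" "C \<in> carrier_mat n nx" "D \<in> carrier_mat n n"
    unfolding A_def B_def C_def D_def n .
  define R where "R = (\<lambda>q. bilin \<tau> q \<cdot>\<^sub>m 1\<^sub>m nx - A)"
  have Rc: "R q \<in> carrier_mat nx nx" for q unfolding R_def using dim(1) by (rule minus_carrier_mat)
  have bm: "bilin \<tau> meromorphic_on {p}" unfolding bilin_def[abs_def] by (intro meromorphic_intros)
  have ent: "(\<lambda>q. R q $$ (a,b)) meromorphic_on {p}" if "a < nx" "b < nx" for a b
  proof -
    have "(\<lambda>q. bilin \<tau> q * (1\<^sub>m nx $$ (a,b)) - A $$ (a,b)) meromorphic_on {p}" by (intro meromorphic_intros bm)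
    moreover have "R q $$ (a,b) = bilin \<tau> q * (1\<^sub>m nx $$ (a,b)) - A $$ (a,b)" for q
      using that dim(1) by (simp add: R_def)
    ultimately show ?thesis by simp
  qed
  have mdet: "(\<lambda>q. Determinant.det (R q)) meromorphic_on {p}"
    by (rule det_closed[where X = "\<lambda>f. f meromorphic_on {p}", OF _ _ _ Rc ent]) (auto intro: meromorphic_intros)
  have madj: "(\<lambda>q. adj_mat (R q) $$ (a,b)) meromorphic_on {p}" if "a < nx" "b < nx" for a b
    by (rule adj_mat_closed[where X = "\<lambda>f. f meromorphic_on {p}", OF _ _ _ Rc ent that]) (auto intro: meromorphic_intros)
  define g where "g = (\<lambda>q. (\<Sum>b<nx. (\<Sum>a<nx. C $$ (k,a) * (1 / Determinant.det (R q) * adj_mat (R q) $$ (a,b))) * B $$ (b,l)) + D $$ (k,l))"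
  have mg: "g meromorphic_on {p}" unfolding g_def
    by (intro meromorphic_intros mdet madj) auto
  have "\<forall>\<^sub>F q in at p. Determinant.det (R q) \<noteq> 0"
    using eventually_bilin_notin_finite[OF finite_resolvent_singularities[OF dim(1)] \<tau>] by (simp add: R_def)
  then have ev: "\<forall>\<^sub>F q in at p. q \<in> outside_disc \<longrightarrow> bilinear_transform \<tau> (transfer P i j) q $$ (k,l) = g q"
  proof eventually_elim
    case (elim q)
    have Ri: "mat_inv (R q) \<in> carrier_mat nx nx" "mat_inv (R q) = (1 / Determinant.det (R q)) \<cdot>\<^sub>m adj_mat (R q)"
      using mat_inv_det[OF Rc elim] by auto
    have "bilinear_transform \<tau> (transfer P i j) q = C * mat_inv (R q) * B + D"
      using dim(1) by (simp add: bilinear_transform_eq transfer_def resolvent_pencil_def R_def A_def B_def C_def D_def)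
    moreover have "(C * mat_inv (R q) * B + D) $$ (k,l) = (\<Sum>b<nx. (C * mat_inv (R q)) $$ (k,b) * B $$ (b,l)) + D $$ (k,l)"
    proof -
      have CM: "C * mat_inv (R q) \<in> carrier_mat n nx" using dim(3) Ri(1) by (rule mult_carrier_mat)
      have "(C * mat_inv (R q) * B + D) $$ (k,l) = (C * mat_inv (R q) * B) $$ (k,l) + D $$ (k,l)"
        using dim(4) kl by (intro index_add_mat(1)) auto
      then show ?thesis by (simp only: index_mult_sum[OF CM dim(2) kl])
    qed
    moreover have "(C * mat_inv (R q)) $$ (k,b) = (\<Sum>a<nx. C $$ (k,a) * (1 / Determinant.det (R q) * adj_mat (R q) $$ (a,b)))" if "b < nx" for b
      using dim Ri kl that adj_mat(1)[OF Rc[of q]] by (subst index_mult_sum[of _ n nx _ nx]) auto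
    ultimately show ?case by (simp add: g_def)
  qed
  obtain M where M: "\<And>q. q \<in> outside_disc \<Longrightarrow> cmod (bilinear_transform \<tau> (transfer P i j) q $$ (k,l)) \<le> M"
    using HinfE[OF Hinf_bilinear_transform[OF \<tau> H]] kl by metis
  show "\<exists>l'. nt_limit (\<lambda>q. bilinear_transform \<tau> (transfer P i j) q $$ (k,l)) p l'"
    by (rule meromorphic_bounded_nt_limit[OF mg p ev M])
qed

text \<open>Where \<open>P\<close> and \<open>K\<close> are holomorphic and the determinant does not
  vanish, the product inside \<open>youla\<close> is already holomorphic, so
  \<open>remove_sings\<close> leaves its values unchanged.\<close>

lemma youla_eq_on_open:
  assumes S: "open S" "S \<subseteq> outside_disc" "q \<in> S"
    and P: "\<And>q. q \<in> S \<Longrightarrow> P q \<in> carrier_mat n n" "\<And>i j. i < n \<Longrightarrow> j < n \<Longrightarrow> (\<lambda>q. P q $$ (i,j)) holomorphic_on S"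
    and K: "\<And>q. q \<in> S \<Longrightarrow> K q \<in> carrier_mat n n" "\<And>i j. i < n \<Longrightarrow> j < n \<Longrightarrow> (\<lambda>q. K q $$ (i,j)) holomorphic_on S"
    and det: "\<And>q. q \<in> S \<Longrightarrow> Determinant.det (1\<^sub>m n + P q * K q) \<noteq> 0"
  shows "youla n P K q = K q * mat_inv (1\<^sub>m n + P q * K q)"
    and "\<And>i j. i < n \<Longrightarrow> j < n \<Longrightarrow> (\<lambda>q. youla n P K q $$ (i,j)) holomorphic_on S"
proof -
  define M where "M = (\<lambda>q. 1\<^sub>m n + P q * K q)"
  have Mc: "M q \<in> carrier_mat n n" if "q \<in> S" for q using P(1)[OF that] K(1)[OF that] by (simp add: M_def)
  have PKh: "(\<lambda>q. (P q * K q) $$ (i,j)) holomorphic_on S" if "i < n" "j < n" for i j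
    by (rule mult_index_holomorphic[OF P(1) K(1) P(2) K(2) that])
  have Mh: "(\<lambda>q. M q $$ (i,j)) holomorphic_on S" if ij: "i < n" "j < n" for i j
  proof -
    have "(\<lambda>q. 1\<^sub>m n $$ (i,j) + (P q * K q) $$ (i,j)) holomorphic_on S" by (intro holomorphic_intros PKh ij)
    moreover have "1\<^sub>m n $$ (i,j) + (P q * K q) $$ (i,j) = M q $$ (i,j)" if "q \<in> S" for q
      unfolding M_def using ij P(1)[OF that] K(1)[OF that] by (simp del: index_mult_mat(1))
    ultimately show ?thesis by (simp cong: holomorphic_cong)
  qed
  have dM: "Determinant.det (M q) \<noteq> 0" if "q \<in> S" for q using det[OF that] by (simp add: M_def)
  have Ic: "mat_inv (M q) \<in> carrier_mat n n" if "q \<in> S" for q by (rule mat_inv_det(1)[OF Mc[OF that] dM[OF that]])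
  have Gh: "(\<lambda>q. (K q * mat_inv (M q)) $$ (i,j)) holomorphic_on S" if ij: "i < n" "j < n" for i j
    by (rule mult_index_holomorphic[OF K(1) Ic K(2) holomorphic_mat_inv[OF Mc Mh dM] ij])
  have eq: "youla n P K q $$ (i,j) = (K q * mat_inv (M q)) $$ (i,j)" if "q \<in> S" "i < n" "j < n" for q i j
  proof -
    have "(\<lambda>q. (K q * mat_inv (M q)) $$ (i,j)) analytic_on {q}"
      using Gh[OF that(2,3)] S(1) that(1) analytic_at by blast
    then show ?thesis using that by (simp add: youla_def M_def del: index_mult_mat(1))
  qed
  show "youla n P K q = K q * mat_inv (1\<^sub>m n + P q * K q)"
  proof (rule eq_matI)
    have c: "K q * mat_inv (M q) \<in> carrier_mat n n" using K(1)[OF S(3)] Ic[OF S(3)] by simp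
    show "dim_row (youla n P K q) = dim_row (K q * mat_inv (1\<^sub>m n + P q * K q))"
         "dim_col (youla n P K q) = dim_col (K q * mat_inv (1\<^sub>m n + P q * K q))"
      using c by (auto simp: youla_def M_def)
    fix i j assume "i < dim_row (K q * mat_inv (1\<^sub>m n + P q * K q))" "j < dim_col (K q * mat_inv (1\<^sub>m n + P q * K q))"
    then have "i < n" "j < n" using c by (auto simp: M_def)
    then show "youla n P K q $$ (i,j) = (K q * mat_inv (1\<^sub>m n + P q * K q)) $$ (i,j)"
      using eq[OF S(3)] by (simp only: M_def)
  qed
  show "(\<lambda>q. youla n P K q $$ (i,j)) holomorphic_on S" if "i < n" "j < n" for i j
    using Gh[OF that] eq[OF _ that] by (simp cong: holomorphic_cong)
qed

text \<open>On the connected exterior the meromorphic determinant is either zero off a sparse set or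
  nonzero off a sparse set, and \<open>well_posed\<close> excludes the former. Discarding also the
  points where an entry of \<open>K\<close> fails to be analytic still removes only a sparse
  set.\<close>

lemma well_posed_regular_set:
  assumes P: "\<And>q. q \<in> outside_disc \<Longrightarrow> P q \<in> carrier_mat n n" "\<And>i j. i < n \<Longrightarrow> j < n \<Longrightarrow> (\<lambda>q. P q $$ (i,j)) holomorphic_on outside_disc"
    and K: "\<And>q. q \<in> outside_disc \<Longrightarrow> K q \<in> carrier_mat n n" "\<And>i j. i < n \<Longrightarrow> j < n \<Longrightarrow> (\<lambda>q. K q $$ (i,j)) meromorphic_on outside_disc"
    and wp: "well_posed n P K"
  obtains S where "open S" "S \<subseteq> outside_disc" "\<And>q. q \<in> outside_disc \<Longrightarrow> \<forall>\<^sub>F q' in at q. q' \<in> S"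
    "\<And>i j. i < n \<Longrightarrow> j < n \<Longrightarrow> (\<lambda>q. K q $$ (i,j)) holomorphic_on S"
    "\<And>q. q \<in> S \<Longrightarrow> Determinant.det (1\<^sub>m n + P q * K q) \<noteq> 0"
proof -
  \<comment> \<open>Written entrywise so that \<open>M q\<close> has size \<open>n\<close> for every
    \<open>q\<close>, as \<open>det_closed\<close> demands.\<close>
  define M where "M = (\<lambda>q. Matrix.mat n n (\<lambda>(i,j). 1\<^sub>m n $$ (i,j) + (\<Sum>l<n. P q $$ (i,l) * K q $$ (l,j))))"
  have Meq: "M q = 1\<^sub>m n + P q * K q" if "q \<in> outside_disc" for q
  proof (rule eq_matI)
    have c: "P q \<in> carrier_mat n n" "K q \<in> carrier_mat n n" using P(1) K(1) that by auto
    show "dim_row (M q) = dim_row (1\<^sub>m n + P q * K q)" "dim_col (M q) = dim_col (1\<^sub>m n + P q * K q)"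
      using c by (auto simp: M_def)
    fix i j assume "i < dim_row (1\<^sub>m n + P q * K q)" "j < dim_col (1\<^sub>m n + P q * K q)"
    then have "i < n" "j < n" using c by auto
    then show "M q $$ (i,j) = (1\<^sub>m n + P q * K q) $$ (i,j)"
      using c by (simp add: M_def index_mult_sum[OF c] del: index_mult_mat(1))
  qed
  have Pm: "(\<lambda>q. P q $$ (i,j)) meromorphic_on outside_disc" if "i < n" "j < n" for i j
    using P(2)[OF that] by (intro analytic_on_imp_meromorphic_on) (simp add: analytic_on_open[OF open_outside_disc])
  have Mm: "(\<lambda>q. M q $$ (i,j)) meromorphic_on outside_disc" if "i < n" "j < n" for i j
  proof -
    have "(\<lambda>q. 1\<^sub>m n $$ (i,j) + (\<Sum>l<n. P q $$ (i,l) * K q $$ (l,j))) meromorphic_on outside_disc"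
      using that by (intro meromorphic_intros Pm K(2)) auto
    then show ?thesis using that by (simp add: M_def)
  qed
  have dm: "(\<lambda>q. Determinant.det (M q)) meromorphic_on outside_disc"
  proof (rule det_closed[where X = "\<lambda>f. f meromorphic_on outside_disc", OF _ _ _ _ Mm])
    show "M z \<in> carrier_mat n n" for z by (simp add: M_def)
  qed (auto intro: meromorphic_intros)
  have "\<not> (\<forall>\<^sub>\<approx>q\<in>outside_disc. Determinant.det (M q) = 0)"
  proof
    assume a: "\<forall>\<^sub>\<approx>q\<in>outside_disc. Determinant.det (M q) = 0"
    have "\<forall>\<^sub>\<approx>q\<in>outside_disc. q \<in> outside_disc"
      by (rule eventually_in_cosparse[OF order_refl open_outside_disc])
    with a have "\<forall>\<^sub>\<approx>q\<in>outside_disc. Determinant.det (1\<^sub>m n + P q * K q) = 0"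
      by eventually_elim (simp add: Meq)
    then show False using wp by (simp add: well_posed_def)
  qed
  then have d: "\<forall>\<^sub>\<approx>q\<in>outside_disc. Determinant.det (M q) \<noteq> 0"
    using meromorphic_imp_constant_or_avoid[OF dm open_outside_disc connected_outside_disc, of 0] by blast
  have "\<forall>\<^sub>\<approx>q\<in>outside_disc. \<forall>ij\<in>{..<n}\<times>{..<n}. (\<lambda>q. K q $$ ij) analytic_on {q}"
    using meromorphic_on_imp_analytic_cosparse[OF K(2)] by (intro eventually_ball_finite) auto
  with d have ev: "\<forall>\<^sub>\<approx>q\<in>outside_disc. Determinant.det (M q) \<noteq> 0 \<and> (\<forall>ij\<in>{..<n}\<times>{..<n}. (\<lambda>q. K q $$ ij) analytic_on {q})"
    by eventually_elim simp
  define pts where "pts = {q. \<not> (Determinant.det (M q) \<noteq> 0 \<and> (\<forall>ij\<in>{..<n}\<times>{..<n}. (\<lambda>q. K q $$ ij) analytic_on {q}))}"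
  have sp: "pts sparse_in outside_disc" using ev unfolding eventually_cosparse pts_def .
  show ?thesis
  proof (rule that[of "outside_disc - pts"])
    show "open (outside_disc - pts)" by (rule open_diff_sparse_pts[OF open_outside_disc sp])
    fix q assume q: "q \<in> outside_disc"
    have "\<forall>\<^sub>F q' in at q. q' \<in> outside_disc"
      using open_outside_disc q by (rule eventually_at_in_open')
    moreover have "\<forall>\<^sub>F q' in at q. q' \<notin> pts"
      using sp q by (simp add: sparse_in_eventually_iff[OF open_outside_disc])
    ultimately show "\<forall>\<^sub>F q' in at q. q' \<in> outside_disc - pts" by eventually_elim simp
  next
    fix i j assume "i < n" "j < n"
    then have "(\<lambda>q. K q $$ (i,j)) analytic_on (outside_disc - pts)"
      by (subst analytic_on_analytic_at) (auto simp: pts_def)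
    then show "(\<lambda>q. K q $$ (i,j)) holomorphic_on (outside_disc - pts)" by (rule analytic_imp_holomorphic)
  next
    fix q assume "q \<in> outside_disc - pts"
    then show "Determinant.det (1\<^sub>m n + P q * K q) \<noteq> 0" using Meq[of q] by (auto simp: pts_def)
  qed auto
qed

text \<open>The entry bound 2 / \<epsilon> near \<open>s\<close> is incompatible with a pole. By the
  choice of representative in \<open>nicely_meromorphic_on\<close>, \<open>K\<close> is then
  continuous at \<open>s\<close>, and the non-strict inequality passes to the limit.\<close>

lemma osp_removable:
  assumes K: "feedback_law n K" and s: "s \<in> right_half_plane" and \<epsilon>: "0 < \<epsilon>"
    and ev: "\<forall>\<^sub>F s' in at s. osp n \<epsilon> (K s')"
  shows "osp n \<epsilon> (K s)" "\<And>i j. i < n \<Longrightarrow> j < n \<Longrightarrow> \<not> is_pole (\<lambda>s. K s $$ (i,j)) s"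
proof -
  have Kc: "\<And>s. s \<in> right_half_plane \<Longrightarrow> K s \<in> carrier_mat n n"
    and Kn: "\<And>i j. i < n \<Longrightarrow> j < n \<Longrightarrow> (\<lambda>s. K s $$ (i,j)) nicely_meromorphic_on right_half_plane"
    using K by (auto simp: feedback_law_def)
  have "\<forall>\<^sub>F s' in at s. s' \<in> right_half_plane" using open_right_half_plane s by (rule eventually_at_in_open')
  then have cev: "\<forall>\<^sub>F s' in at s. K s' \<in> carrier_mat n n" by (rule eventually_mono) (rule Kc)
  show np: "\<not> is_pole (\<lambda>s. K s $$ (i,j)) s" if ij: "i < n" "j < n" for i j
  proof
    assume "is_pole (\<lambda>s. K s $$ (i,j)) s"
    then have "\<forall>r>0. \<forall>\<^sub>F s' in at s. r \<le> cmod (K s' $$ (i,j))"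
      unfolding is_pole_def by (simp add: filterlim_at_infinity[of 0])
    moreover have "0 < 2 / \<epsilon> + 1" using \<epsilon> by (simp add: add_pos_pos)
    ultimately have "\<forall>\<^sub>F s' in at s. 2 / \<epsilon> + 1 \<le> cmod (K s' $$ (i,j))" by blast
    then have "\<forall>\<^sub>F s' in at s. False"
      using ev cev
    proof eventually_elim
      case (elim s')
      then show ?case using osp_entry_le[OF elim(3,2) \<epsilon> ij] by linarith
    qed
    then show False by simp
  qed
  have Kt: "mat_tendsto n K (K s) (at s)"
    unfolding mat_tendsto_def
  proof (intro conjI allI impI Kc[OF s] cev)
    fix i j assume ij: "i < n" "j < n"
    show "((\<lambda>s. K s $$ (i,j)) \<longlongrightarrow> K s $$ (i,j)) (at s)"
      using Kn[OF ij] np[OF ij] s by (auto simp: nicely_meromorphic_on_def)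
  qed
  show "osp n \<epsilon> (K s)"
    unfolding osp_def
  proof
    fix v :: "complex vec" assume v: "v \<in> carrier_vec n"
    note Kv = vec_tendsto_mult[OF Kt vec_tendsto_const[OF v]]
    show "\<epsilon> * rip (K s *\<^sub>v v) (K s *\<^sub>v v) \<le> 2 * rip (K s *\<^sub>v v) v"
    proof (rule tendsto_le[of "at s"])
      show "((\<lambda>s'. 2 * rip (K s' *\<^sub>v v) v) \<longlongrightarrow> 2 * rip (K s *\<^sub>v v) v) (at s)"
        by (intro tendsto_intros tendsto_rip[OF Kv vec_tendsto_const[OF v]])
      show "((\<lambda>s'. \<epsilon> * rip (K s' *\<^sub>v v) (K s' *\<^sub>v v)) \<longlongrightarrow> \<epsilon> * rip (K s *\<^sub>v v) (K s *\<^sub>v v)) (at s)"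
        by (intro tendsto_intros tendsto_rip[OF Kv Kv])
      show "\<forall>\<^sub>F s' in at s. \<epsilon> * rip (K s' *\<^sub>v v) (K s' *\<^sub>v v) \<le> 2 * rip (K s' *\<^sub>v v) v"
        using ev by (rule eventually_mono) (use v in \<open>simp add: osp_def\<close>)
    qed simp
  qed
qed

text \<open>The image of \<open>outside_disc\<close> under \<open>bilin\<close> misses s = 1 / (2
  \<tau>), which corresponds to q = \<infinity>. At that point the hypothesis of
  \<open>osp_removable\<close> is obtained by applying the same lemma at all nearby points.\<close>

lemma feedback_classI_of_cosparse:
  assumes K: "feedback_law n K" and \<epsilon>: "0 < \<epsilon>" and \<tau>: "0 < \<tau>"
    and ev: "\<And>q. q \<in> outside_disc \<Longrightarrow> \<forall>\<^sub>F q' in at q. osp n \<epsilon> (bilinear_transform \<tau> K q')"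
  shows "feedback_class n \<epsilon> K"
proof -
  define s0 where "s0 = 1 / (2 * complex_of_real \<tau>)"
  have ev1: "\<forall>\<^sub>F s' in at s. osp n \<epsilon> (K s')" if s: "s \<in> right_half_plane" "s \<noteq> s0" for s
  proof -
    have "\<forall>\<^sub>F s' in at s. s' \<in> - {s0}" using s(2) by (intro eventually_at_in_open') auto
    then have ne: "\<forall>\<^sub>F s' in at s. s' \<noteq> s0 \<and> s' \<noteq> s"
      using eventually_neq_at_within[of s s] by eventually_elim simp
    have "(bilin_inv \<tau> \<longlongrightarrow> bilin_inv \<tau> s) (at s)"
      unfolding bilin_inv_def[abs_def]
      by (intro tendsto_intros) (use bilin_inv_denom[OF \<tau>, of s] s(2) in \<open>simp add: s0_def\<close>)
    \<comment> \<open>The hypothesis speaks of punctured neighbourhoods, so \<open>bilin_inv\<close>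
      must not return to its value at \<open>s\<close>.\<close>
    moreover have "\<forall>\<^sub>F s' in at s. bilin_inv \<tau> s' \<noteq> bilin_inv \<tau> s"
      using ne
    proof eventually_elim
      case (elim s')
      then show ?case using bilin_bilin_inv[OF \<tau>, of s'] bilin_bilin_inv[OF \<tau>, of s] s(2) by (auto simp: s0_def)
    qed
    ultimately have "filterlim (bilin_inv \<tau>) (at (bilin_inv \<tau> s)) (at s)"
      unfolding filterlim_at by simp
    from eventually_compose_filterlim[OF ev[OF bilin_inv_in_outside_disc[OF \<tau> s[unfolded s0_def]]] this]
    have "\<forall>\<^sub>F s' in at s. osp n \<epsilon> (K (bilin \<tau> (bilin_inv \<tau> s')))" by (simp add: bilinear_transform_eq)
    then show ?thesis
      using ne by eventually_elim (use bilin_bilin_inv[OF \<tau>] in \<open>simp add: s0_def\<close>)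
  qed
  have ev2: "\<forall>\<^sub>F s' in at s. osp n \<epsilon> (K s')" if s: "s \<in> right_half_plane" for s
  proof (cases "s = s0")
    case True
    have "\<forall>\<^sub>F s' in at s. s' \<in> right_half_plane" using open_right_half_plane s by (rule eventually_at_in_open')
    then show ?thesis
      using eventually_neq_at_within[of s s]
    proof eventually_elim
      case (elim s')
      then show ?case using osp_removable(1)[OF K elim(1) \<epsilon> ev1[OF elim(1)]] True by simp
    qed
  qed (use ev1 s in blast)
  note osp = osp_removable[OF K _ \<epsilon> ev2]
  have Kc: "\<And>s. s \<in> right_half_plane \<Longrightarrow> K s \<in> carrier_mat n n"
    and Kn: "\<And>i j. i < n \<Longrightarrow> j < n \<Longrightarrow> (\<lambda>s. K s $$ (i,j)) nicely_meromorphic_on right_half_plane"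
    using K by (auto simp: feedback_law_def)
  have "(\<lambda>s. K s $$ (i,j)) holomorphic_on right_half_plane" if "i < n" "j < n" for i j
    by (rule analytic_imp_holomorphic[OF nicely_meromorphic_without_singularities[OF Kn[OF that]]])
       (use osp(2) that in blast)
  moreover have "cmod (K s $$ (i,j)) \<le> 2 / \<epsilon>" if "s \<in> right_half_plane" "i < n" "j < n" for s i j
    by (rule osp_entry_le[OF Kc[OF that(1)] osp(1)[OF that(1)] \<epsilon> that(2,3)]) (use that in auto)
  ultimately have "Hinf right_half_plane n n K" unfolding Hinf_def using Kc by blast
  moreover have "psd (mat_adjoint (K s) + K s - complex_of_real \<epsilon> \<cdot>\<^sub>m (mat_adjoint (K s) * K s))"
    if "s \<in> right_half_plane" for s
    unfolding psd_osp[OF Kc[OF that]] using osp(1)[OF that] that by (auto simp: osp_def)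
  ultimately show ?thesis by (simp add: feedback_class_def)
qed

subsection \<open>Block form of the boundary condition\<close>

lemma rip_append:
  assumes "a \<in> carrier_vec n" "b \<in> carrier_vec m" "c \<in> carrier_vec n" "d \<in> carrier_vec m"
  shows "rip (a @\<^sub>v b) (c @\<^sub>v d) = rip a c + rip b d"
proof -
  have "conjugate (c @\<^sub>v d) = conjugate c @\<^sub>v conjugate d"
    using assms by (intro eq_vecI) (auto simp: append_vec_def Let_def)
  then show ?thesis using assms by (simp add: rip_def scalar_prod_append[of _ n _ m])
qed

lemma psd_four_block:
  assumes Q: "Q \<in> carrier_mat n n" and F: "F \<in> carrier_mat n n"
  shows "psd (four_block_mat Q Q (0\<^sub>m n n) F + mat_adjoint (four_block_mat Q Q (0\<^sub>m n n) F)) \<longleftrightarrow>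
    (\<forall>v1\<in>carrier_vec n. \<forall>v2\<in>carrier_vec n. 0 \<le> rip (Q *\<^sub>v v1) v1 + rip (Q *\<^sub>v v2) v1 + rip (F *\<^sub>v v2) v2)"
proof -
  define U where "U = four_block_mat Q Q (0\<^sub>m n n) F"
  have U: "U \<in> carrier_mat (n + n) (n + n)" unfolding U_def using Q F by (rule four_block_carrier_mat)
  have eq: "rip (U *\<^sub>v (v1 @\<^sub>v v2)) (v1 @\<^sub>v v2) = rip (Q *\<^sub>v v1) v1 + rip (Q *\<^sub>v v2) v1 + rip (F *\<^sub>v v2) v2"
    if v: "v1 \<in> carrier_vec n" "v2 \<in> carrier_vec n" for v1 v2
  proof -
    have "U *\<^sub>v (v1 @\<^sub>v v2) = (Q *\<^sub>v v1 + Q *\<^sub>v v2) @\<^sub>v (0\<^sub>m n n *\<^sub>v v1 + F *\<^sub>v v2)"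
      unfolding U_def by (rule four_block_mat_mult_vec[OF Q Q _ F v]) simp
    also have "0\<^sub>m n n *\<^sub>v v1 + F *\<^sub>v v2 = F *\<^sub>v v2" using v F by (intro eq_vecI) auto
    finally show ?thesis using v Q F by (simp add: rip_append[of _ n _ n] rip_add_left[of _ n])
  qed
  show ?thesis
    unfolding U_def[symmetric] psd_herm_sum[OF U]
  proof (intro iffI ballI)
    fix v1 v2 :: "complex vec"
    assume "\<forall>v\<in>carrier_vec (n + n). 0 \<le> rip (U *\<^sub>v v) v" and v: "v1 \<in> carrier_vec n" "v2 \<in> carrier_vec n"
    then have "0 \<le> rip (U *\<^sub>v (v1 @\<^sub>v v2)) (v1 @\<^sub>v v2)" by simp
    then show "0 \<le> rip (Q *\<^sub>v v1) v1 + rip (Q *\<^sub>v v2) v1 + rip (F *\<^sub>v v2) v2" unfolding eq[OF v] .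
  next
    fix v :: "complex vec"
    assume a: "\<forall>v1\<in>carrier_vec n. \<forall>v2\<in>carrier_vec n. 0 \<le> rip (Q *\<^sub>v v1) v1 + rip (Q *\<^sub>v v2) v1 + rip (F *\<^sub>v v2) v2"
      and v: "v \<in> carrier_vec (n + n)"
    define v1 v2 where "v1 = vec_first v n" and "v2 = vec_last v n"
    have c: "v1 \<in> carrier_vec n" "v2 \<in> carrier_vec n" by (simp_all add: v1_def v2_def)
    have "v = v1 @\<^sub>v v2" using v by (simp add: v1_def v2_def)
    then show "0 \<le> rip (U *\<^sub>v v) v" using a c eq[OF c] by simp
  qed
qed

lemma four_block_bdry_value:
  assumes p: "cmod p = 1"
    and Q: "\<And>q. q \<in> outside_disc \<Longrightarrow> Q q \<in> carrier_mat n n" and F: "\<And>q. q \<in> outside_disc \<Longrightarrow> F q \<in> carrier_mat n n"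
    and U: "U = (\<lambda>q. four_block_mat (Q q) (Q q) (0\<^sub>m n n) (F q))"
  shows "has_bdry_value (n + n) (n + n) U p \<longleftrightarrow> has_bdry_value n n Q p \<and> has_bdry_value n n F p"
    and "has_bdry_value n n Q p \<Longrightarrow> has_bdry_value n n F p \<Longrightarrow>
      bdry_value (n + n) (n + n) U p =
        four_block_mat (bdry_value n n Q p) (bdry_value n n Q p) (0\<^sub>m n n) (bdry_value n n F p)"
proof -
  have ind: "U q $$ (i,j) = (if i < n then if j < n then Q q $$ (i,j) else Q q $$ (i,j - n)
      else if j < n then 0 else F q $$ (i - n, j - n))"
    if q: "q \<in> outside_disc" and ij: "i < n + n" "j < n + n" for q i j
    using Q[OF q] F[OF q] ij unfolding U by auto
  have lim: "nt_limit (\<lambda>q. U q $$ (i,j)) p l \<longleftrightarrow>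
      (if i < n then if j < n then nt_limit (\<lambda>q. Q q $$ (i,j)) p l else nt_limit (\<lambda>q. Q q $$ (i,j - n)) p l
       else if j < n then nt_limit (\<lambda>_. 0) p l else nt_limit (\<lambda>q. F q $$ (i - n, j - n)) p l)"
    if ij: "i < n + n" "j < n + n" for i j l
    using ind[OF _ ij] by (cases "i < n"; cases "j < n"; simp; intro nt_limit_cong; simp)
  have zero: "nt_limit (\<lambda>_. 0) p 0" by (simp add: nt_limit_def)
  show "has_bdry_value (n + n) (n + n) U p \<longleftrightarrow> has_bdry_value n n Q p \<and> has_bdry_value n n F p"
  proof (intro iffI conjI)
    assume b: "has_bdry_value (n + n) (n + n) U p"
    show "has_bdry_value n n Q p"
      unfolding has_bdry_value_def
    proof (intro allI impI)
      fix i j assume ij: "i < n" "j < n"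
      then obtain l where "nt_limit (\<lambda>q. U q $$ (i,j)) p l"
        using b[unfolded has_bdry_value_def, rule_format, of i j] by auto
      then show "\<exists>l. nt_limit (\<lambda>q. Q q $$ (i,j)) p l" using lim[of i j l] ij by auto
    qed
    show "has_bdry_value n n F p"
      unfolding has_bdry_value_def
    proof (intro allI impI)
      fix i j assume ij: "i < n" "j < n"
      then obtain l where "nt_limit (\<lambda>q. U q $$ (i + n,j + n)) p l"
        using b[unfolded has_bdry_value_def, rule_format, of "i + n" "j + n"] by auto
      then show "\<exists>l. nt_limit (\<lambda>q. F q $$ (i,j)) p l" using lim[of "i + n" "j + n" l] ij by auto
    qed
  next
    assume QF: "has_bdry_value n n Q p \<and> has_bdry_value n n F p"
    show "has_bdry_value (n + n) (n + n) U p"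
      unfolding has_bdry_value_def
    proof (intro allI impI)
      fix i j assume ij: "i < n + n" "j < n + n"
      have "\<exists>l. nt_limit (\<lambda>q. Q q $$ (i,j)) p l" if "i < n" "j < n" for i j
        using QF that by (simp add: has_bdry_value_def)
      moreover have "\<exists>l. nt_limit (\<lambda>q. F q $$ (i,j)) p l" if "i < n" "j < n" for i j
        using QF that by (simp add: has_bdry_value_def)
      ultimately show "\<exists>l. nt_limit (\<lambda>q. U q $$ (i,j)) p l"
        unfolding lim[OF ij] using ij zero by (cases "i < n"; cases "j < n") auto
    qed
  qed
  assume hQ: "has_bdry_value n n Q p" and hF: "has_bdry_value n n F p"
  show "bdry_value (n + n) (n + n) U p =
        four_block_mat (bdry_value n n Q p) (bdry_value n n Q p) (0\<^sub>m n n) (bdry_value n n F p)"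
    (is "_ = ?V")
  proof (rule eq_matI)
    have V: "?V \<in> carrier_mat (n + n) (n + n)" by (intro four_block_carrier_mat) simp_all
    show "dim_row (bdry_value (n + n) (n + n) U p) = dim_row ?V" "dim_col (bdry_value (n + n) (n + n) U p) = dim_col ?V"
      using V by (auto simp: bdry_value_def)
    fix i j assume "i < dim_row ?V" "j < dim_col ?V"
    moreover have dims: "dim_row (bdry_value n n G p) = n" "dim_col (bdry_value n n G p) = n" for G
      by (simp_all add: bdry_value_def)
    ultimately have ij: "i < n + n" "j < n + n" by simp_all
    have "nt_limit (\<lambda>q. U q $$ (i,j)) p (?V $$ (i,j))"
      unfolding lim[OF ij] using ij zero bdry_value_index[OF p hQ] bdry_value_index[OF p hF]
      by (cases "i < n"; cases "j < n") (auto simp: dims)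
    then show "bdry_value (n + n) (n + n) U p $$ (i,j) = ?V $$ (i,j)"
      by (rule bdry_value_index_eqI[OF p _ ij])
  qed
qed

theorem theorem4:
  fixes P :: realization
    and nx n :: nat and ni :: "input_port \<Rightarrow> nat" and no :: "output_port \<Rightarrow> nat"
    and \<epsilon> \<tau> :: real
    and K Pt Kt Qt F U :: "complex \<Rightarrow> complex mat"
  assumes "ni In_u = n" and "no Out_y = n"
    and "plant_class nx ni no P"
    and "\<epsilon> > 0" and "\<tau> > 0"
    and "feedback_law n K"
    and "Pt = bilinear_transform \<tau> (transfer P In_u Out_y)"
    and "Kt = bilinear_transform \<tau> K"
    and "well_posed n Pt Kt"
    and "Qt = youla n Pt Kt"
    and "spectral_factor n \<epsilon> Pt F"
    and "U = (\<lambda>q. four_block_mat (Qt q) (Qt q) (0\<^sub>m n n) (F q))"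
  shows "feedback_class n \<epsilon> K \<longleftrightarrow>
           Hinf outside_disc n n Qt \<and>
           (\<forall>\<Omega>\<in>{-pi..pi}. has_bdry_value (n + n) (n + n) U (cis \<Omega>) \<longrightarrow>
              psd (bdry_value (n + n) (n + n) U (cis \<Omega>)
                   + mat_adjoint (bdry_value (n + n) (n + n) U (cis \<Omega>))))"
proof -
  note n = assms(1,2) and \<epsilon> = assms(4) and \<tau> = assms(5) and Klaw = assms(6) and U = assms(12)
  define G where "G = transfer P In_u Out_y"
  have PG: "Pt = bilinear_transform \<tau> G" by (simp add: assms(7) G_def)
  have dims: "realization_dims nx ni no P"
    using assms(3) by (simp add: plant_class_def minimal_realization_def)
  have "Hinf right_half_plane (no Out_y) (ni In_u) (transfer P In_u Out_y)"
    using assms(3) unfolding plant_class_def by blast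
  then have GH: "Hinf right_half_plane n n G" by (simp add: G_def n)
  have Gc: "G s \<in> carrier_mat n n" if "s \<in> right_half_plane" for s using GH that by (simp add: Hinf_def)
  have "psd (G s + mat_adjoint (G s))" if "s \<in> right_half_plane" for s
    using assms(3) that unfolding plant_class_def G_def by blast
  then have Gpos: "0 \<le> rip (G s *\<^sub>v v) v" if "s \<in> right_half_plane" "v \<in> carrier_vec n" for s v
    using psd_herm_sum[OF Gc] that by blast
  have PH: "Hinf outside_disc n n Pt" unfolding PG by (rule Hinf_bilinear_transform[OF \<tau> GH])
  have Pc: "Pt q \<in> carrier_mat n n" if "q \<in> outside_disc" for q using PH that by (simp add: Hinf_def)
  have Ph: "(\<lambda>q. Pt q $$ (i,j)) holomorphic_on outside_disc" if "i < n" "j < n" for i j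
    using PH that by (simp add: Hinf_def)
  have Ppos: "0 \<le> rip (Pt q *\<^sub>v v) v" if "q \<in> outside_disc" "v \<in> carrier_vec n" for q v
    unfolding PG bilinear_transform_eq by (rule Gpos[OF bilin_in_right_half_plane[OF \<tau> that(1)] that(2)])
  have Pb: "has_bdry_value n n Pt p" if "cmod p = 1" for p
    unfolding PG G_def
    by (rule transfer_bilinear_has_bdry_value[OF dims _ n \<tau> that]) (use GH in \<open>simp add: G_def\<close>)
  have FH: "Hinf outside_disc n n F" and Frat: "rational_mat n n F"
    and Finv: "\<And>p. cmod p = 1 \<Longrightarrow> mat_inv (bdry_value n n Pt p + mat_adjoint (bdry_value n n Pt p)
                   + complex_of_real \<epsilon> \<cdot>\<^sub>m 1\<^sub>m n) = bdry_value n n F p + mat_adjoint (bdry_value n n F p)"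
    using assms(11) by (auto simp: spectral_factor_def)
  have Fc: "F q \<in> carrier_mat n n" if "q \<in> outside_disc" for q using FH that by (simp add: Hinf_def)
  have Fb: "has_bdry_value n n F p" if "cmod p = 1" for p by (rule rational_has_bdry_value[OF Frat FH that])
  have Qc: "Qt q \<in> carrier_mat n n" for q by (simp add: assms(10) youla_def)
  \<comment> \<open>\<open>F\<close> has boundary values everywhere on the circle, so the
    exceptional points of \<open>U\<close> are those of \<open>Qt\<close>.\<close>
  have Ub: "has_bdry_value (n + n) (n + n) U p \<longleftrightarrow> has_bdry_value n n Qt p" if "cmod p = 1" for p
    using four_block_bdry_value(1)[OF that Qc Fc U] Fb[OF that] by simp
  have psd_iff: "psd (bdry_value (n + n) (n + n) U p + mat_adjoint (bdry_value (n + n) (n + n) U p)) \<longleftrightarrow>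
      youla_passive n \<epsilon> (bdry_value n n Pt p) (bdry_value n n Qt p)"
    if p: "cmod p = 1" and Qb: "has_bdry_value n n Qt p" for p
  proof -
    have Ueq: "bdry_value (n + n) (n + n) U p =
        four_block_mat (bdry_value n n Qt p) (bdry_value n n Qt p) (0\<^sub>m n n) (bdry_value n n F p)"
      by (rule four_block_bdry_value(2)[OF p Qc Fc U Qb Fb[OF p]])
    have "0 \<le> rip (bdry_value n n Pt p *\<^sub>v v) v" if "v \<in> carrier_vec n" for v
      by (rule bdry_value_rip_nonneg[OF p Pb[OF p] Pc Ppos[OF _ that] that])
    then show ?thesis
      unfolding Ueq youla_passive_def psd_four_block[OF bdry_value_carrier bdry_value_carrier]
      by (intro youla_block_iff[OF bdry_value_carrier bdry_value_carrier bdry_value_carrier _ \<epsilon> Finv[OF p]])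
  qed
  have Kc: "Kt q \<in> carrier_mat n n" if "q \<in> outside_disc" for q
    using Klaw bilin_in_right_half_plane[OF \<tau> that] by (simp add: assms(8) bilinear_transform_eq feedback_law_def)
  show ?thesis
  proof
    assume fc: "feedback_class n \<epsilon> K"
    have KH: "Hinf outside_disc n n Kt"
      unfolding assms(8) using fc by (intro Hinf_bilinear_transform[OF \<tau>]) (simp add: feedback_class_def)
    have Kh: "(\<lambda>q. Kt q $$ (i,j)) holomorphic_on outside_disc" if "i < n" "j < n" for i j
      using KH that by (simp add: Hinf_def)
    have Kosp: "osp n \<epsilon> (Kt q)" if q: "q \<in> outside_disc" for q
    proof -
      have "psd (mat_adjoint (Kt q) + Kt q - complex_of_real \<epsilon> \<cdot>\<^sub>m (mat_adjoint (Kt q) * Kt q))"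
        unfolding assms(8) bilinear_transform_eq
        using fc bilin_in_right_half_plane[OF \<tau> q] by (simp add: feedback_class_def)
      then show ?thesis unfolding psd_osp[OF Kc[OF q]] osp_def .
    qed
    note det = youla_of_osp(1)[OF Pc Kc Kosp \<epsilon> Ppos]
    have det': "Determinant.det (1\<^sub>m n + Pt q * Kt q) \<noteq> 0" if "q \<in> outside_disc" for q
      by (rule det) (use that in auto)
    have Qeq: "Qt q = Kt q * mat_inv (1\<^sub>m n + Pt q * Kt q)" if "q \<in> outside_disc" for q
      unfolding assms(10) by (rule youla_eq_on_open(1)[OF open_outside_disc order_refl that Pc Ph Kc Kh det'])
    have yp: "youla_passive n \<epsilon> (Pt q) (Qt q)" if q: "q \<in> outside_disc" for q
      unfolding Qeq[OF q] by (rule youla_of_osp(2)[OF Pc[OF q] Kc[OF q] Kosp[OF q] \<epsilon> Ppos[OF q]])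
    \<comment> \<open>Any point of the exterior would do: \<open>youla_eq_on_open\<close> asks for
      an element of its open set also where it concludes holomorphy.\<close>
    have "2 \<in> outside_disc" by (simp add: outside_disc_def)
    then have Qh: "(\<lambda>q. Qt q $$ (i,j)) holomorphic_on outside_disc" if "i < n" "j < n" for i j
      unfolding assms(10) by (rule youla_eq_on_open(2)[OF open_outside_disc order_refl _ Pc Ph Kc Kh det' that])
    have "cmod (Qt q $$ (i,j)) \<le> 2 / \<epsilon>" if q: "q \<in> outside_disc" and ij: "i < n" "j < n" for q i j
      by (rule osp_entry_le[OF Qc youla_passive_imp_osp[OF Pc[OF q] Qc yp[OF q] Ppos[OF q]] \<epsilon> ij])
    then have "Hinf outside_disc n n Qt" unfolding Hinf_def using Qc Qh by blast
    moreover have "psd (bdry_value (n + n) (n + n) U (cis \<Omega>) + mat_adjoint (bdry_value (n + n) (n + n) U (cis \<Omega>)))"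
      if "has_bdry_value (n + n) (n + n) U (cis \<Omega>)" for \<Omega>
    proof -
      have p: "cmod (cis \<Omega>) = 1" by simp
      have Qb: "has_bdry_value n n Qt (cis \<Omega>)" using that Ub[OF p] by simp
      show ?thesis
        unfolding psd_iff[OF p Qb] by (rule youla_passive_bdry[OF p Pb[OF p] Pc Qb Qc yp])
    qed
    ultimately show "Hinf outside_disc n n Qt \<and>
           (\<forall>\<Omega>\<in>{-pi..pi}. has_bdry_value (n + n) (n + n) U (cis \<Omega>) \<longrightarrow>
              psd (bdry_value (n + n) (n + n) U (cis \<Omega>)
                   + mat_adjoint (bdry_value (n + n) (n + n) U (cis \<Omega>))))" by blast
  next
    assume R: "Hinf outside_disc n n Qt \<and>
           (\<forall>\<Omega>\<in>{-pi..pi}. has_bdry_value (n + n) (n + n) U (cis \<Omega>) \<longrightarrow>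
              psd (bdry_value (n + n) (n + n) U (cis \<Omega>)
                   + mat_adjoint (bdry_value (n + n) (n + n) U (cis \<Omega>))))"
    have bd: "youla_passive n \<epsilon> (bdry_value n n Pt p) (bdry_value n n Qt p)"
      if p: "cmod p = 1" and Qb: "has_bdry_value n n Qt p" for p
    proof -
      have "p \<noteq> 0" using p by auto
      then have "cis (Arg p) = p" using p by (simp add: cis_Arg sgn_div_norm)
      moreover have "Arg p \<in> {-pi..pi}" using Arg_bounded[of p] by auto
      ultimately have "psd (bdry_value (n + n) (n + n) U p + mat_adjoint (bdry_value (n + n) (n + n) U p))"
        using R Ub[OF p] Qb by metis
      then show ?thesis using psd_iff[OF p Qb] by simp
    qed
    have yp: "youla_passive n \<epsilon> (Pt q) (Qt q)" if "q \<in> outside_disc" for q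
      by (rule youla_passive_interior[OF PH conjunct1[OF R] Ppos \<epsilon> bd that])
    have bh: "bilin \<tau> analytic_on outside_disc"
      using bilin_holomorphic by (simp add: analytic_on_open[OF open_outside_disc])
    have Km: "(\<lambda>q. Kt q $$ (i,j)) meromorphic_on outside_disc" if "i < n" "j < n" for i j
      unfolding assms(8) bilinear_transform_eq
    proof (rule meromorphic_on_compose[OF _ bh])
      show "(\<lambda>s. K s $$ (i,j)) meromorphic_on right_half_plane"
        using Klaw that by (simp add: feedback_law_def nicely_meromorphic_on_def)
      show "bilin \<tau> ` outside_disc \<subseteq> right_half_plane" using bilin_in_right_half_plane[OF \<tau>] by blast
    qed
    \<comment> \<open>In this direction \<open>Kt\<close> is only known to be meromorphic, so the
      pointwise formula for \<open>Qt\<close> is available on a regular set \<open>S\<close> that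
      contains a punctured neighbourhood of each point of the exterior.\<close>
    obtain S where S: "open S" "S \<subseteq> outside_disc" "\<And>q. q \<in> outside_disc \<Longrightarrow> \<forall>\<^sub>F q' in at q. q' \<in> S"
      "\<And>i j. i < n \<Longrightarrow> j < n \<Longrightarrow> (\<lambda>q. Kt q $$ (i,j)) holomorphic_on S"
      "\<And>q. q \<in> S \<Longrightarrow> Determinant.det (1\<^sub>m n + Pt q * Kt q) \<noteq> 0"
      by (rule well_posed_regular_set[OF Pc Ph Kc Km assms(9)]) (assumption | rule that)+
    have Kosp: "osp n \<epsilon> (Kt q)" if q: "q \<in> S" for q
    proof -
      have qo: "q \<in> outside_disc" using S(2) q by blast
      have Qeq: "Qt q = Kt q * mat_inv (1\<^sub>m n + Pt q * Kt q)"
        unfolding assms(10)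
        by (rule youla_eq_on_open(1)[OF S(1,2) q _ _ _ S(4,5)])
           (use S(2) Pc Kc in \<open>auto intro: holomorphic_on_subset[OF Ph]\<close>)
      note o = osp_of_youla[OF Pc[OF qo] Qc yp[OF qo] \<epsilon>]
      have "Kt q = Qt q * mat_inv (1\<^sub>m n - Pt q * Qt q)"
        by (rule feedback_of_youla[OF Pc[OF qo] Kc[OF qo] S(5)[OF q] Qeq o(1)])
      then show ?thesis using o(2) by simp
    qed
    show "feedback_class n \<epsilon> K"
    proof (rule feedback_classI_of_cosparse[OF Klaw \<epsilon> \<tau>])
      fix q assume "q \<in> outside_disc"
      then show "\<forall>\<^sub>F q' in at q. osp n \<epsilon> (bilinear_transform \<tau> K q')"
        using S(3)[of q] Kosp by (auto simp: assms(8) elim: eventually_mono)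
    qed
  qed
qed

end
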